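(* In the variables $(A,B,k,I)$ put $$J_1=4K\,B-\{E+(k^2-1)K\}\,A\,I,\qquad J_2=4K'\,B+\{E'-k^2K'\}\,A\,I,\qquad \mathcal{N}=-\frac{2K}{A\,J_1},$$ with $K=K(k)$, $E=E(k)$, $K'=K'(k)$, $E'=E'(k)$, and consider the Lagrangian $$\mathcal{L}=J_1^2\,(\dot{\mathcal{N}}-1)+J_2\,\dot I-8\,\frac{d}{d\tau}\Big(\frac BA\,K^2\Big).$$ Then $$\mathcal{L}=4\,\frac{J_1K}{A^2}\,\dot A-2\Big\{k\,I\,K^2+\frac{J_1^2-16B^2K^2}{k(k^2-1)\,I\,A^2}\Big\}\,\dot k+\Big\{J_2+\frac{2K}{AI}\,(J_1-4BK)\Big\}\,\dot I-J_1^2,$$ and the following three systems are the Euler–Lagrange equations of $\mathcal{L}$ (the first directly in the variables $(A,B,k,I)$, the other two after the substitutions of variables given below): (i) $\dot A=2A^2B,\quad \dot B=\frac18I^2k^2(1-k^2)A^3,\quad \dot k=\frac12\,I\,k(1-k^2)A^2,\quad \dot I=0$; (ii) Jacobi's system $\dot A=2A^2B,\ \dot B=bA^3,\ \dot a=-16bA^2,\ \dot b=abA^2$, in variables $(A,B,a,b)$ related to $(A,B,k,I)$ by $$a=I-2Ik^2,\qquad 8b=I^2k^2(1-k^2);$$ (iii) the system $\dot x=(u+y^2+z^2)x,\ \dot y=(u+y^2-2z^2)y,\ \dot z=(u-2y^2+z^2)z,\ \dot u=u^2-y^4+y^2z^2-z^4$, in variables $(x,y,z,u)$ related to $(A,B,k,I)$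 by $$x=\frac{1+i}{\sqrt\pi}\,kA,\quad y=(1+i)\,\boldsymbol{I}A,\quad z^2=2i\,\boldsymbol{I}^2(1-k^2)A^2,\quad u=2A\big\{B-i\,\boldsymbol{I}^2(2k^2-1)A\big\},\quad 12\,i\,\boldsymbol{I}^2=I .$$
   Context: The dot denotes the derivative with respect to the independent variable $\tau$ (the same for all three systems). The action is $S=\int\mathcal{L}(X,\dot X)\,d\tau$. The Legendre complete elliptic integrals are $$K(k)=\int_0^1\frac{d\lambda}{\sqrt{(1-\lambda^2)(1-k^2\lambda^2)}},\quad K'(k)=\int_k^1\frac{d\lambda}{\sqrt{(1-\lambda^2)(\lambda^2-k^2)}},$$ $$E(k)=\int_0^1\sqrt{\frac{1-k^2\lambda^2}{1-\lambda^2}}\,d\lambda,\quad E'(k)=\int_0^1\sqrt{\frac{1-(1-k^2)\lambda^2}{1-\lambda^2}}\,d\lambda$$ (the prime is not a derivative). The inverse of the substitution in (iii) is $A=\frac{1-i}{2\boldsymbol{I}}y$, $B=\frac{1+i}{2}\frac{\boldsymbol{I}}{y}(u+y^2-2z^2)$, $\boldsymbol{I}^2=\frac1\pi\frac{y^2-z^2}{x^2}$, $k^2=1-\frac{z^2}{y^2}$. All statements are on the open set where the expressions are defined. *)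

theory Defs
  imports "HOL-Complex_Analysis.Complex_Analysis"
begin

section \<open>Complete elliptic integrals of a complex modulus\<close>

text \<open>
  The four integrals below are used for moduli in the open right half plane cut along
  \<open>[1, \<infinity>)\<close>.  There the principal square roots never meet their branch cut along the path of
  integration, and the four functions are the holomorphic continuations of the real integrals for
  \<open>0 < k < 1\<close>.  To the left of the imaginary axis the path integral for \<open>K'\<close> and the
  (even) integral for \<open>E'\<close> no longer belong to the same pair of branches.
\<close>

definition moduli :: "complex set" where
  "moduli = {k. Re k > 0 \<and> \<not> (Im k = 0 \<and> Re k \<ge> 1)}"

definition ellK :: "complex \<Rightarrow> complex" where
  "ellK k = integral {0..1}
     (\<lambda>l::real. 1 / csqrt ((1 - of_real l ^ 2) * (1 - k ^ 2 * of_real l ^ 2)))"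

text \<open>
  The integral of \<open>ellK'\<close> is taken along the segment from \<open>k\<close> to \<open>1\<close>.  The root is written as a
  product of two principal roots, because for complex \<open>k\<close> the product under the root may cross the
  negative real axis although neither factor does; for \<open>0 < k < 1\<close> both factors are positive and
  there is no difference.
\<close>

definition ellK' :: "complex \<Rightarrow> complex" where
  "ellK' k = contour_integral (linepath k 1)
     (\<lambda>l. 1 / (csqrt (1 - l ^ 2) * csqrt (l ^ 2 - k ^ 2)))"

definition ellE :: "complex \<Rightarrow> complex" where
  "ellE k = integral {0..1}
     (\<lambda>l::real. csqrt ((1 - k ^ 2 * of_real l ^ 2) / (1 - of_real l ^ 2)))"

definition ellE' :: "complex \<Rightarrow> complex" where
  "ellE' k = integral {0..1}
     (\<lambda>l::real. csqrt ((1 - (1 - k ^ 2) * of_real l ^ 2) / (1 - of_real l ^ 2)))"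


section \<open>Curves and Euler--Lagrange equations\<close>

definition partial_deriv :: "'n::finite \<Rightarrow> (complex ^ 'n \<Rightarrow> complex) \<Rightarrow> complex ^ 'n \<Rightarrow> complex" where
  "partial_deriv j F q = deriv (\<lambda>s. F (\<chi> i. if i = j then s else q $ i)) (q $ j)"

text \<open>
  The derivative of \<open>F (X \<tau>)\<close> with respect to \<open>\<tau>\<close>, as a function of the position
  \<open>q = X \<tau>\<close> and the velocity \<open>v = X' \<tau>\<close>.
\<close>

definition total_deriv :: "(complex ^ 'n::finite \<Rightarrow> complex) \<Rightarrow> complex ^ 'n \<Rightarrow> complex ^ 'n \<Rightarrow> complex" where
  "total_deriv F q v = (\<Sum>j\<in>UNIV. partial_deriv j F q * v $ j)"

text \<open>
  The domain \<open>T\<close> of the independent variable is any set without isolated points (so that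
  derivatives within \<open>T\<close> are unique).  This covers both open sets of complex \<open>\<tau>\<close> (holomorphic
  curves) and real intervals (curves depending on a real \<open>\<tau>\<close>, with real or complex components).
\<close>

definition curve :: "(complex ^ 'n::finite) set \<Rightarrow> complex set \<Rightarrow>
    (complex \<Rightarrow> complex ^ 'n) \<Rightarrow> (complex \<Rightarrow> complex ^ 'n) \<Rightarrow> bool" where
  "curve D T X X' \<longleftrightarrow> (\<forall>\<tau>\<in>T. \<tau> islimpt T \<and> X \<tau> \<in> D \<and>
     (\<forall>j. ((\<lambda>t. X t $ j) has_field_derivative X' \<tau> $ j) (at \<tau> within T)))"

text \<open>
  A Lagrangian \<open>L\<close> is a function of position and velocity; the curve \<open>X\<close> has velocity \<open>X'\<close>.
\<close>

definition euler_lagrange :: "(complex ^ 'n::finite \<Rightarrow> complex ^ 'n \<Rightarrow> complex) \<Rightarrow> complex set \<Rightarrow>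
    (complex \<Rightarrow> complex ^ 'n) \<Rightarrow> (complex \<Rightarrow> complex ^ 'n) \<Rightarrow> bool" where
  "euler_lagrange L T X X' \<longleftrightarrow> (\<forall>\<tau>\<in>T. \<forall>j.
     ((\<lambda>t. partial_deriv j (\<lambda>v. L (X t) v) (X' t)) has_field_derivative
        partial_deriv j (\<lambda>q. L q (X' \<tau>)) (X \<tau>)) (at \<tau> within T))"

text \<open>The Lagrangian \<open>L\<close> rewritten in new variables \<open>y\<close>, where the old ones are \<open>q = \<Phi> y\<close>.\<close>

definition substituted :: "(complex ^ 'm::finite \<Rightarrow> complex ^ 'n::finite) \<Rightarrow>
    (complex ^ 'n \<Rightarrow> complex ^ 'n \<Rightarrow> complex) \<Rightarrow> complex ^ 'm \<Rightarrow> complex ^ 'm \<Rightarrow> complex" where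
  "substituted \<Phi> L y w = L (\<Phi> y) (\<chi> j. total_deriv (\<lambda>y. \<Phi> y $ j) y w)"

definition EL_system :: "(complex ^ 'n::finite \<Rightarrow> complex ^ 'n \<Rightarrow> complex) \<Rightarrow> (complex ^ 'n) set \<Rightarrow>
    (complex ^ 'n \<Rightarrow> complex ^ 'n) \<Rightarrow> bool" where
  "EL_system L D F \<longleftrightarrow> (\<forall>T X X'. curve D T X X' \<longrightarrow>
     (euler_lagrange L T X X' \<longleftrightarrow> (\<forall>\<tau>\<in>T. X' \<tau> = F (X \<tau>))))"

text \<open>
  Here \<open>R q y\<close> says that the old variables \<open>q\<close> and the new variables \<open>y\<close> are related by
  the substitution.  The substitutions below involve square roots, so \<open>q\<close> and \<open>y\<close> are not
  globally functions of each other.  The first part substitutes in the Euler--Lagrange equations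
  written in the old variables; the second part substitutes in the Lagrangian itself, by means of an
  arbitrary continuous branch of \<open>q\<close> as a function of \<open>y\<close>.
\<close>

definition EL_system_after :: "(complex ^ 'm::finite \<Rightarrow> complex ^ 'n::finite \<Rightarrow> bool) \<Rightarrow>
    (complex ^ 'm \<Rightarrow> complex ^ 'm \<Rightarrow> complex) \<Rightarrow> (complex ^ 'm) set \<Rightarrow>
    (complex ^ 'n \<Rightarrow> complex ^ 'n) \<Rightarrow> bool" where
  "EL_system_after R L D G \<longleftrightarrow>
     (\<forall>T X X' Y Y'. curve D T X X' \<and> curve UNIV T Y Y' \<and> (\<forall>\<tau>\<in>T. R (X \<tau>) (Y \<tau>)) \<longrightarrow>
        (euler_lagrange L T X X' \<longleftrightarrow> (\<forall>\<tau>\<in>T. Y' \<tau> = G (Y \<tau>)))) \<and>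
     (\<forall>V \<Phi>. open V \<and> continuous_on V \<Phi> \<and> (\<forall>y\<in>V. \<Phi> y \<in> D \<and> R (\<Phi> y) y) \<longrightarrow>
        EL_system (substituted \<Phi> L) V G)"


section \<open>The Lagrangian\<close>

text \<open>The components \<open>1, 2, 3, 4\<close> of a position \<open>q\<close> are \<open>A, B, k, I\<close>.\<close>

definition J1 :: "complex ^ 4 \<Rightarrow> complex" where
  "J1 q = (let A = q $ 1; B = q $ 2; k = q $ 3; I = q $ 4 in
     4 * ellK k * B - (ellE k + (k ^ 2 - 1) * ellK k) * A * I)"

definition J2 :: "complex ^ 4 \<Rightarrow> complex" where
  "J2 q = (let A = q $ 1; B = q $ 2; k = q $ 3; I = q $ 4 in
     4 * ellK' k * B + (ellE' k - k ^ 2 * ellK' k) * A * I)"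

definition calN :: "complex ^ 4 \<Rightarrow> complex" where
  "calN q = - (2 * ellK (q $ 3) / (q $ 1 * J1 q))"

definition domain_L :: "(complex ^ 4) set" where
  "domain_L = {q. q $ 1 \<noteq> 0 \<and> q $ 3 \<in> moduli \<and> q $ 4 \<noteq> 0 \<and> J1 q \<noteq> 0}"

definition lagrangian :: "complex ^ 4 \<Rightarrow> complex ^ 4 \<Rightarrow> complex" where
  "lagrangian q v = J1 q ^ 2 * (total_deriv calN q v - 1) + J2 q * v $ 4
     - 8 * total_deriv (\<lambda>q. q $ 2 / q $ 1 * ellK (q $ 3) ^ 2) q v"


section \<open>The three systems and the substitutions\<close>

definition system_ABkI :: "complex ^ 4 \<Rightarrow> complex ^ 4" where
  "system_ABkI q = (let A = q $ 1; B = q $ 2; k = q $ 3; I = q $ 4 in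
     vector [2 * A ^ 2 * B,
             1 / 8 * I ^ 2 * k ^ 2 * (1 - k ^ 2) * A ^ 3,
             1 / 2 * I * k * (1 - k ^ 2) * A ^ 2,
             0])"

text \<open>The components of \<open>y\<close> are \<open>A, B, a, b\<close>.\<close>

definition jacobi_system :: "complex ^ 4 \<Rightarrow> complex ^ 4" where
  "jacobi_system y = (let A = y $ 1; B = y $ 2; a = y $ 3; b = y $ 4 in
     vector [2 * A ^ 2 * B, b * A ^ 3, - 16 * b * A ^ 2, a * b * A ^ 2])"

definition jacobi_subst :: "complex ^ 4 \<Rightarrow> complex ^ 4 \<Rightarrow> bool" where
  "jacobi_subst q y \<longleftrightarrow> (let k = q $ 3; I = q $ 4; a = y $ 3; b = y $ 4 in
     y $ 1 = q $ 1 \<and> y $ 2 = q $ 2 \<and>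
     a = I - 2 * I * k ^ 2 \<and>
     8 * b = I ^ 2 * k ^ 2 * (1 - k ^ 2))"

text \<open>The components of \<open>w\<close> are \<open>x, y, z, u\<close>.\<close>

definition xyzu_system :: "complex ^ 4 \<Rightarrow> complex ^ 4" where
  "xyzu_system w = (let x = w $ 1; y = w $ 2; z = w $ 3; u = w $ 4 in
     vector [(u + y ^ 2 + z ^ 2) * x,
             (u + y ^ 2 - 2 * z ^ 2) * y,
             (u - 2 * y ^ 2 + z ^ 2) * z,
             u ^ 2 - y ^ 4 + y ^ 2 * z ^ 2 - z ^ 4])"

text \<open>\<open>J\<close> is the auxiliary quantity with \<open>12 i J^2 = I\<close> (a bold \<open>I\<close> in print).\<close>

definition xyzu_subst :: "complex ^ 4 \<Rightarrow> complex ^ 4 \<Rightarrow> bool" where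
  "xyzu_subst q w \<longleftrightarrow> (\<exists>J. let A = q $ 1; B = q $ 2; k = q $ 3; I = q $ 4 in
     12 * \<i> * J ^ 2 = I \<and>
     w $ 1 = (1 + \<i>) / of_real (sqrt pi) * k * A \<and>
     w $ 2 = (1 + \<i>) * J * A \<and>
     (w $ 3) ^ 2 = 2 * \<i> * J ^ 2 * (1 - k ^ 2) * A ^ 2 \<and>
     w $ 4 = 2 * A * (B - \<i> * J ^ 2 * (2 * k ^ 2 - 1) * A))"

end

theory Submission
  imports Defs
begin

text \<open>
  Up to the total derivative in its last term, the Lagrangian is \<open>J1\<^sup>2 N' + J2 I' - J1\<^sup>2\<close>, so
  \<open>J1\<^sup>2, N\<close> and \<open>J2, I\<close> are conjugate pairs and \<open>J1\<^sup>2\<close> is the Hamiltonian.  If the four functions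
  \<open>J1, N, J2, I\<close> are local coordinates, the Euler--Lagrange equations therefore say
  \<open>J1' = 0\<close>, \<open>N' = 1\<close>, \<open>J2' = 0\<close>, \<open>I' = 0\<close> (lemma \<open>euler_lagrange_canonical\<close>).  This form
  does not depend on the variables in which the four functions are written: a substitution only
  replaces them by their compositions with it.  For systems (ii) and (iii) it is thus enough that
  the substitution has an invertible differential and that this differential maps the vector field
  (i) to that of the system (\<open>EL_system_after_coordinates\<close>).

  Two pointwise facts remain for system (i).  Along its vector field the four derivatives are
  \<open>0, 1, 0, 0\<close>; this is a computation with the derivatives of the elliptic integrals
  (\<open>canonical_flow\<close>).  And the differentials of the four functions are linearly independent
  (\<open>canonical_coordinates_injective\<close>).  For the latter put \<open>\<alpha> = E - (1 - k\<^sup>2) K\<close> and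
  \<open>\<beta> = E' - k\<^sup>2 K'\<close>, so that \<open>J1 = 4 K B - \<alpha> A I\<close> and \<open>J2 = 4 K' B + \<beta> A I\<close>.  The pairs
  \<open>(K, \<alpha>)\<close> and \<open>(K', - \<beta>)\<close> solve the same linear system in \<open>k\<close>, so their Wronskian
  \<open>\<alpha> K' + \<beta> K\<close> is constant on the connected set of moduli.  It is positive at \<open>k = 1/2\<close>, hence
  nowhere zero (\<open>wronskian_nz\<close>; by Legendre's relation it is \<open>\<pi> / 2\<close>), and independence follows by
  elimination.

  Three points need analysis.  The Euler--Lagrange equations differentiate gradients once more
  and cancel mixed second derivatives; Cauchy's integral formula in one variable shows that partial
  derivatives of a complex differentiable function are complex differentiable and commute.  The
  derivative formulas of the elliptic integrals follow by differentiating under the integral sign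
  after \<open>l = sin \<theta>\<close> has removed the singular endpoint; the path integral for \<open>K'\<close> equals
  \<open>K (\<surd>(1 - k\<^sup>2))\<close>, first on the real interval \<open>(0, 1)\<close> and then everywhere by analytic
  continuation.  Finally, a continuous branch of one of the substitutions is automatically
  differentiable, because its components are built by rational operations and nonvanishing
  continuous square roots.
\<close>

no_notation fps_nth (infixl "$" 75)

section \<open>Holomorphic functions of several complex variables\<close>

text \<open>
  Complex differentiability at a point: the real Frechet derivative is the complex linear form
  whose coefficients are the partial derivatives.
\<close>

definition cdiff :: "(complex ^ 'n::finite \<Rightarrow> complex) \<Rightarrow> complex ^ 'n \<Rightarrow> bool" where
  "cdiff f q \<longleftrightarrow> (f has_derivative total_deriv f q) (at q)"

lemma has_derivative_vec_components:
  fixes f :: "'a::real_normed_vector \<Rightarrow> complex ^ 'n::finite"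
  assumes "\<And>i. ((\<lambda>x. f x $ i) has_derivative (\<lambda>h. f' h $ i)) (at x within S)"
  shows "(f has_derivative f') (at x within S)"
proof -
  have "((\<lambda>x. f x \<bullet> b) has_derivative (\<lambda>h. f' h \<bullet> b)) (at x within S)"
    if b: "b \<in> Basis" for b
  proof -
    from b obtain i u where u: "b = axis i u" by (auto simp: Basis_vec_def)
    show ?thesis
      unfolding u inner_axis
      by (rule has_derivative_inner_left[OF assms])
  qed
  then show ?thesis
    unfolding has_derivative_componentwise_within[of f] by blast
qed

lemma scalar_mult_axis: "s *s axis j (1::complex) = axis j s"
  by (simp add: vec_eq_iff axis_def)

lemma total_deriv_scale: "total_deriv f q (s *s h) = s * total_deriv f q h"
  by (simp add: total_deriv_def sum_distrib_left ac_simps)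

lemma total_deriv_diff: "total_deriv f q (h - h') = total_deriv f q h - total_deriv f q h'"
  by (simp add: total_deriv_def sum_subtractf algebra_simps)

lemma total_deriv_zero [simp]: "total_deriv f q 0 = 0"
  by (simp add: total_deriv_def)

lemma total_deriv_axis: "total_deriv f q (axis j 1) = partial_deriv j f q"
  by (simp add: total_deriv_def axis_def if_distrib cong: if_cong)

text \<open>
  Any complex linear Frechet derivative is the total derivative, because restricting it to the
  coordinate lines gives the partial derivatives.  This turns the calculus of \<open>has_derivative\<close> into
  a calculus of partial derivatives.
\<close>

lemma total_derivI:
  fixes f :: "complex ^ 'n::finite \<Rightarrow> complex"
  assumes D: "(f has_derivative D) (at q)" and lin: "\<And>s h. D (s *s h) = s * D h"
  shows "total_deriv f q = D" and "cdiff f q"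
proof -
  have part: "partial_deriv j f q = D (axis j 1)" for j
  proof -
    have line: "((\<lambda>s. \<chi> i. if i = j then s else q $ i) has_derivative (\<lambda>s. axis j s)) (at (q $ j))"
    proof (rule has_derivative_vec_components)
      fix i
      show "((\<lambda>s. (\<chi> i. if i = j then s else q $ i) $ i) has_derivative (\<lambda>h. axis j h $ i)) (at (q $ j))"
        by (cases "i = j") (auto simp: axis_def)
    qed
    have at_q: "(\<chi> i. if i = j then q $ j else q $ i) = q"
      by (simp add: vec_eq_iff)
    have "((\<lambda>s. f (\<chi> i. if i = j then s else q $ i)) has_derivative (\<lambda>s. D (axis j s))) (at (q $ j))"
    proof (rule has_derivative_compose[where f = "\<lambda>s. \<chi> i. if i = j then s else q $ i" and f' = "axis j"
          and g = f and g' = D])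
      show "(f has_derivative D) (at (\<chi> i. if i = j then q $ j else q $ i))"
        unfolding at_q by (rule D)
    qed (rule line)
    also have "(\<lambda>s. D (axis j s)) = (*) (D (axis j 1))"
    proof
      show "D (axis j s) = D (axis j 1) * s" for s
        using lin[of s "axis j 1"] unfolding scalar_mult_axis by (simp only: mult.commute)
    qed
    finally show ?thesis
      unfolding partial_deriv_def by (intro DERIV_imp_deriv) (simp add: has_field_derivative_def)
  qed
  show tot: "total_deriv f q = D"
  proof
    fix v
    have "D v = D (\<Sum>j\<in>UNIV. v $ j *s axis j 1)"
      by (simp add: basis_expansion)
    also have "\<dots> = (\<Sum>j\<in>UNIV. D (v $ j *s axis j 1))"
      by (rule linear_sum[OF has_derivative_linear[OF D]])
    finally show "total_deriv f q v = D v"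
      by (simp add: total_deriv_def part lin mult.commute)
  qed
  show "cdiff f q"
    using D unfolding cdiff_def tot .
qed

lemma cdiffD: "cdiff f q \<Longrightarrow> (f has_derivative total_deriv f q) (at q)"
  by (simp add: cdiff_def)

lemma continuous_on_cdiff:
  assumes "\<And>q. q \<in> S \<Longrightarrow> cdiff f q"
  shows "continuous_on S f"
  by (intro continuous_at_imp_continuous_on ballI has_derivative_continuous[OF cdiffD[OF assms]])

lemma cdiff_cong:
  assumes "open S" "q \<in> S" "\<And>x. x \<in> S \<Longrightarrow> f x = g x" "cdiff g q"
  shows "cdiff f q" and "total_deriv f q = total_deriv g q"
proof -
  have "(f has_derivative total_deriv g q) (at q)"
    by (rule has_derivative_transform_within_open[OF cdiffD[OF assms(4)] assms(1,2)]) (simp add: assms)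
  from total_derivI[OF this total_deriv_scale]
  show "cdiff f q" and "total_deriv f q = total_deriv g q" by auto
qed

lemma has_derivative_component: "((\<lambda>q. q $ i) has_derivative (\<lambda>h. h $ i)) (at (q :: complex ^ 'n::finite))"
  by (rule bounded_linear_imp_has_derivative[OF bounded_linear_vec_nth])

lemma cdiff_component: "cdiff (\<lambda>y. y $ i) q"
  and total_deriv_component: "total_deriv (\<lambda>y. y $ i) q h = h $ i"
proof -
  from total_derivI[OF has_derivative_component[of i q]] show "cdiff (\<lambda>y. y $ i) q" "total_deriv (\<lambda>y. y $ i) q h = h $ i"
    by (simp_all add: fun_eq_iff)
qed

lemma cdiff_chain:
  fixes \<Phi> :: "complex ^ 'm::finite \<Rightarrow> complex ^ 'n::finite"
  assumes f: "cdiff f (\<Phi> y)" and \<Phi>: "\<And>i. cdiff (\<lambda>y. \<Phi> y $ i) y"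
  shows "cdiff (\<lambda>y. f (\<Phi> y)) y"
    and "total_deriv (\<lambda>y. f (\<Phi> y)) y w = total_deriv f (\<Phi> y) (\<chi> i. total_deriv (\<lambda>y. \<Phi> y $ i) y w)"
proof -
  have "(\<Phi> has_derivative (\<lambda>w. \<chi> i. total_deriv (\<lambda>y. \<Phi> y $ i) y w)) (at y)"
    by (rule has_derivative_vec_components) (use \<Phi> in \<open>simp add: cdiff_def\<close>)
  from has_derivative_compose[OF this cdiffD[OF f]]
  have *: "((\<lambda>y. f (\<Phi> y)) has_derivative
      (\<lambda>w. total_deriv f (\<Phi> y) (\<chi> i. total_deriv (\<lambda>y. \<Phi> y $ i) y w))) (at y)" .
  have "(\<chi> i. total_deriv (\<lambda>y. \<Phi> y $ i) y (s *s h)) = s *s (\<chi> i. total_deriv (\<lambda>y. \<Phi> y $ i) y h)" for s h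
    by (simp add: vec_eq_iff total_deriv_scale)
  then show "cdiff (\<lambda>y. f (\<Phi> y)) y"
    and "total_deriv (\<lambda>y. f (\<Phi> y)) y w = total_deriv f (\<Phi> y) (\<chi> i. total_deriv (\<lambda>y. \<Phi> y $ i) y w)"
    using total_derivI[OF *] by (simp_all add: total_deriv_scale)
qed

lemma cdiff_along_curve:
  fixes X :: "complex \<Rightarrow> complex ^ 'n::finite"
  assumes f: "cdiff f (X \<tau>)"
    and X: "\<And>j. ((\<lambda>t. X t $ j) has_field_derivative v $ j) (at \<tau> within T)"
  shows "((\<lambda>t. f (X t)) has_field_derivative total_deriv f (X \<tau>) v) (at \<tau> within T)"
proof -
  have "(X has_derivative (\<lambda>s. s *s v)) (at \<tau> within T)"
  proof (rule has_derivative_vec_components)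
    show "((\<lambda>t. X t $ j) has_derivative (\<lambda>s. (s *s v) $ j)) (at \<tau> within T)" for j
      using X[of j] unfolding has_field_derivative_def vector_smult_component mult.commute[of _ "v $ j"] .
  qed
  from has_derivative_compose[OF this cdiffD[OF f]]
  show ?thesis
    unfolding has_field_derivative_def total_deriv_scale mult.commute[of _ "total_deriv f (X \<tau>) v"] .
qed

lemma cdiff_const: "cdiff (\<lambda>_. c) q"
  by (rule total_derivI(2)[of _ "\<lambda>_. 0"]) auto

lemma cdiff_mult:
  assumes "cdiff f q" "cdiff g q"
  shows "cdiff (\<lambda>q. f q * g q) q"
  by (rule total_derivI(2)[OF has_derivative_mult[OF assms[THEN cdiffD]]])
     (simp add: total_deriv_scale algebra_simps)

lemma cdiff_add:
  assumes "cdiff f q" "cdiff g q"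
  shows "cdiff (\<lambda>q. f q + g q) q"
  by (rule total_derivI(2)[OF has_derivative_add[OF assms[THEN cdiffD]]])
     (simp add: total_deriv_scale algebra_simps)

lemma cdiff_compose_field:
  assumes "(g has_field_derivative g') (at (f q))" "cdiff f q"
  shows "cdiff (\<lambda>q. g (f q)) q" "total_deriv (\<lambda>q. g (f q)) q h = g' * total_deriv f q h"
proof -
  have *: "((\<lambda>q. g (f q)) has_derivative (\<lambda>h. g' * total_deriv f q h)) (at q)"
    using has_derivative_compose[OF cdiffD[OF assms(2)], of g "(*) g'"] assms(1)
    by (simp add: has_field_derivative_def)
  show "cdiff (\<lambda>q. g (f q)) q" "total_deriv (\<lambda>q. g (f q)) q h = g' * total_deriv f q h"
    using total_derivI[OF *] by (simp_all add: total_deriv_scale)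
qed

lemma cdiff_minus: "cdiff f q \<Longrightarrow> cdiff (\<lambda>q. - f q) q"
  using cdiff_mult[OF cdiff_const[of "- 1"], of f q] by simp

lemma cdiff_diff: "cdiff f q \<Longrightarrow> cdiff g q \<Longrightarrow> cdiff (\<lambda>q. f q - g q) q"
  using cdiff_add[OF _ cdiff_minus, of f q g] by simp

lemma cdiff_divide:
  assumes "cdiff f q" "cdiff g q" "g q \<noteq> 0"
  shows "cdiff (\<lambda>q. f q / g q) q"
  using cdiff_mult[OF assms(1) cdiff_compose_field(1)[OF DERIV_inverse[OF assms(3)] assms(2)]]
  by (simp add: divide_inverse)

lemma cdiff_power: "cdiff f q \<Longrightarrow> cdiff (\<lambda>q. f q ^ n) q"
  by (induction n) (simp_all add: cdiff_const cdiff_mult)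

lemmas cdiff_intros = cdiff_const cdiff_component cdiff_add cdiff_minus cdiff_diff cdiff_mult cdiff_divide cdiff_power

text \<open>
  Near \<open>y\<close> the quotient \<open>g x / g y\<close> stays in the right half plane, where it is the principal square
  root of its square; so \<open>g\<close> is there a constant multiple of \<open>csqrt\<close> of a differentiable function.
\<close>

lemma cdiff_continuous_sqrt:
  fixes g :: "complex ^ 'n::finite \<Rightarrow> complex"
  assumes V: "open V" "y \<in> V" and cont: "continuous_on V g" and nz: "g y \<noteq> 0"
    and sq: "\<And>x. x \<in> V \<Longrightarrow> g x ^ 2 = f x" and f: "cdiff f y"
  shows "cdiff g y"
proof -
  define W where "W = V \<inter> (\<lambda>x. g x / g y) -` {z. Re z > 0}"
  have "continuous_on V (\<lambda>x. g x / g y)"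
    using cont nz by (intro continuous_intros) auto
  then have "open W"
    unfolding W_def by (rule continuous_open_preimage[OF _ V(1) open_halfspace_Re_gt])
  moreover have "y \<in> W"
    using nz V by (simp add: W_def)
  moreover have "g x = g y * csqrt (f x / g y ^ 2)" if "x \<in> W" for x
  proof -
    have "csqrt (f x / g y ^ 2) = csqrt ((g x / g y) ^ 2)"
      using that sq by (simp add: W_def power_divide)
    also have "\<dots> = g x / g y"
      using that by (intro csqrt_square) (auto simp: W_def)
    finally show ?thesis using nz by simp
  qed
  moreover have "cdiff (\<lambda>x. g y * csqrt (f x / g y ^ 2)) y"
  proof (rule cdiff_compose_field(1)[where g = "\<lambda>z. g y * csqrt (z / g y ^ 2)"])
    have "f y / g y ^ 2 = 1" using nz by (simp flip: sq[OF V(2)])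
    then show "((\<lambda>z. g y * csqrt (z / g y ^ 2)) has_field_derivative
        g y * (1 / g y ^ 2 / (2 * csqrt (f y / g y ^ 2)))) (at (f y))"
      by (intro DERIV_cmult has_field_derivative_csqrt' DERIV_cdivide DERIV_ident) simp
  qed (rule f)
  ultimately show ?thesis
    by (rule cdiff_cong(1))
qed

section \<open>Partial derivatives of holomorphic functions\<close>

lemma norm_scaled_axis: "norm (\<zeta> *s axis j (1::complex)) = norm \<zeta>"
proof -
  have "(\<Sum>i\<in>UNIV. (norm (axis j \<zeta> $ i))\<^sup>2) = (norm \<zeta>)\<^sup>2"
    by (subst sum.cong[OF refl, where h = "\<lambda>i. if i = j then (norm \<zeta>)\<^sup>2 else 0"]) (auto simp: axis_def)
  then show ?thesis
    by (simp add: scalar_mult_axis norm_vec_def L2_set_def)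
qed

lemma has_derivative_shift_cdiff:
  assumes "cdiff f (q + v)"
  shows "((\<lambda>q. f (q + v)) has_derivative total_deriv f (q + v)) (at q)"
proof -
  have "((\<lambda>q. q + v) has_derivative (\<lambda>h. h)) (at q)"
    by (auto intro!: derivative_eq_intros)
  from has_derivative_compose[where f = "\<lambda>q. q + v", OF this cdiffD[OF assms]]
  show ?thesis .
qed

text \<open>
  The weight in Cauchy's formula for the first derivative over the circle of radius \<open>r\<close>
  parametrised by \<open>[0, 1]\<close>.
\<close>

definition circle_weight :: "real \<Rightarrow> real \<Rightarrow> complex" where
  "circle_weight r t = exp (- (2 * of_real pi * \<i> * of_real t)) / of_real r"

text \<open>
  Cauchy's formula in the single variable \<open>j\<close>.  It expresses a partial derivative by values of
  \<open>f\<close>, and is the source of all regularity of partial derivatives below.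
\<close>

lemma partial_deriv_Cauchy:
  fixes f :: "complex ^ 'n::finite \<Rightarrow> complex"
  assumes r: "r > 0" and f: "\<And>x. x \<in> cball q r \<Longrightarrow> cdiff f x"
  shows "partial_deriv j f q = integral (cbox 0 1)
           (\<lambda>t. f (q + circlepath 0 r t *s axis j 1) * circle_weight r t)"
proof -
  define g where "g s = f (q + s *s axis j 1)" for s
  have g': "(g has_field_derivative partial_deriv j f (q + s *s axis j 1)) (at s)" if "s \<in> cball 0 r" for s
  proof -
    have "cdiff f (q + s *s axis j 1)"
      using that by (intro f) (simp add: dist_norm norm_scaled_axis)
    moreover have "((\<lambda>s. (q + s *s axis j 1) $ i) has_field_derivative axis j 1 $ i) (at s)" for i
      by (auto intro!: derivative_eq_intros)
    ultimately have "((\<lambda>s. f (q + s *s axis j 1)) has_field_derivative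
        total_deriv f (q + s *s axis j 1) (axis j 1)) (at s)"
      by (intro cdiff_along_curve)
    then show ?thesis
      by (simp add: g_def[abs_def] total_deriv_axis)
  qed
  have "g holomorphic_on cball 0 r"
    using g' by (meson field_differentiable_at_within field_differentiable_def holomorphic_on_def)
  then have "(g has_field_derivative 1 / (2 * of_real pi * \<i>) *
      contour_integral (circlepath 0 r) (\<lambda>u. g u / (u - 0)\<^sup>2)) (at 0)"
    using r by (intro Cauchy_derivative_integral_circlepath holomorphic_on_imp_continuous_on)
      (auto elim: holomorphic_on_subset)
  from DERIV_unique[OF this g'[of 0]] r
  have "partial_deriv j f q = 1 / (2 * of_real pi * \<i>) * contour_integral (circlepath 0 r) (\<lambda>u. g u / u\<^sup>2)"
    by simp
  also have "\<dots> = integral {0..1} (\<lambda>t. 1 / (2 * of_real pi * \<i>) *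
      (g (circlepath 0 r t) / (circlepath 0 r t)\<^sup>2 * (2 * pi * \<i> * r * exp (2 * of_real pi * \<i> * t))))"
    unfolding contour_integral_integral vector_derivative_circlepath
    by (rule integral_mult_right[symmetric])
  also have "\<dots> = integral {0..1} (\<lambda>t. f (q + circlepath 0 r t *s axis j 1) * circle_weight r t)"
  proof (rule integral_cong)
    fix t :: real
    define e where "e = exp (2 * of_real pi * \<i> * of_real t)"
    have c: "circlepath 0 r t = of_real r * e" and w: "circle_weight r t = 1 / (of_real r * e)" and "e \<noteq> 0"
      by (simp_all add: e_def circlepath circle_weight_def exp_minus field_simps)
    then show "1 / (2 * of_real pi * \<i>) *
      (g (circlepath 0 r t) / (circlepath 0 r t)\<^sup>2 * (2 * pi * \<i> * r * exp (2 * of_real pi * \<i> * t)))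
      = f (q + circlepath 0 r t *s axis j 1) * circle_weight r t"
      using r unfolding g_def c w e_def[symmetric] by (simp add: field_simps power2_eq_square)
  qed
  finally show ?thesis by simp
qed

lemma circle_shift_in_cball:
  assumes "q \<in> ball q0 r" "r > 0"
  shows "q + circlepath 0 r t *s axis j (1::complex) \<in> cball q0 (2 * r)"
proof -
  have "norm (circlepath 0 r t *s axis j (1::complex)) = r"
    unfolding norm_scaled_axis using \<open>r > 0\<close> by (simp add: circlepath norm_mult)
  then have "dist q0 (q + circlepath 0 r t *s axis j 1) \<le> dist q0 q + r"
    by (metis add.commute add_diff_cancel_left' dist_commute dist_norm dist_triangle)
  then show ?thesis using assms by simp
qed

lemma continuous_on_circle_shift:
  fixes f :: "complex ^ 'n::finite \<Rightarrow> complex"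
  assumes "continuous_on (cball q0 (2 * r)) f" "r > 0"
  shows "continuous_on (ball q0 r \<times> cbox 0 1) (\<lambda>x. f (fst x + circlepath 0 r (snd x) *s axis j 1))"
proof (rule continuous_on_compose2[OF assms(1)])
  show "continuous_on (ball q0 r \<times> cbox 0 1)
      (\<lambda>x :: (complex ^ 'n) \<times> real. fst x + circlepath 0 r (snd x) *s axis j 1)"
    unfolding circlepath vector_scalar_mult_def
    by (intro continuous_intros)
qed (use assms circle_shift_in_cball in auto)

lemma continuous_on_partial_deriv:
  fixes f :: "complex ^ 'n::finite \<Rightarrow> complex"
  assumes S: "open S" and f: "\<And>q. q \<in> S \<Longrightarrow> cdiff f q"
  shows "continuous_on S (partial_deriv j f)"
proof -
  have cf: "continuous_on S f"
    by (rule continuous_on_cdiff[OF f])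
  have "isCont (partial_deriv j f) q" if "q \<in> S" for q
  proof -
    from S(1) that obtain e where e: "e > 0" "cball q e \<subseteq> S"
      using open_contains_cball by blast
    define r where "r = e / 2"
    have r: "r > 0" "cball q (2 * r) \<subseteq> S" using e by (auto simp: r_def)
    have "continuous_on (ball q r \<times> cbox 0 1)
        (\<lambda>x. f (fst x + circlepath 0 r (snd x) *s axis j 1) * circle_weight r (snd x))"
      unfolding circle_weight_def
      by (intro continuous_intros continuous_on_circle_shift[OF continuous_on_subset[OF cf r(2)] r(1)])
        (use r in auto)
    then have "continuous_on (ball q r) (\<lambda>x. integral (cbox 0 1)
         (\<lambda>t. f (x + circlepath 0 r t *s axis j 1) * circle_weight r t))"
      by (intro integral_continuous_on_param) (simp add: split_beta)
    moreover have "integral (cbox 0 1) (\<lambda>t. f (x + circlepath 0 r t *s axis j 1) * circle_weight r t)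
        = partial_deriv j f x" if "x \<in> ball q r" for x
    proof (rule partial_deriv_Cauchy[symmetric, OF r(1)])
      fix y assume "y \<in> cball x r"
      then have "y \<in> cball q (2 * r)"
        using that dist_triangle[of q y x] by simp
      then show "cdiff f y" using r f by blast
    qed
    ultimately have "continuous_on (ball q r) (partial_deriv j f)"
      by (rule continuous_on_eq)
    then show ?thesis
      using r(1) by (simp add: continuous_on_eq_continuous_at)
  qed
  then show ?thesis by (simp add: continuous_at_imp_continuous_on)
qed

text \<open>
  Differentiation under the integral sign in Cauchy's formula, with respect to all variables at
  once.  The derivative of the integrand is continuous because the partial derivatives are.
\<close>

lemma
  fixes f :: "complex ^ 'n::finite \<Rightarrow> complex"
  assumes S: "open S" and f: "\<And>q. q \<in> S \<Longrightarrow> cdiff f q" and r: "r > 0" "cball q0 (2 * r) \<subseteq> S"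
  shows partial_deriv_cdiff_cball: "cdiff (partial_deriv j f) q0"
    and partial_partial_deriv_Cauchy: "partial_deriv i (partial_deriv j f) q0 = integral (cbox 0 1)
          (\<lambda>t. partial_deriv i f (q0 + circlepath 0 r t *s axis j 1) * circle_weight r t)"
proof -
  define C where "C t = circlepath 0 r t *s axis j (1::complex)" for t
  have shift: "q + C t \<in> S" if "q \<in> ball q0 r" for q t
    using circle_shift_in_cball[OF that r(1)] r(2) unfolding C_def by blast
  have near: "x \<in> S" if "q \<in> ball q0 r" "x \<in> cball q r" for q x
  proof -
    have "x \<in> cball q0 (2 * r)" using that dist_triangle[of q0 x q] by simp
    then show ?thesis using r by blast
  qed
  have q0: "q0 \<in> ball q0 r" using r by simp
  have cf: "continuous_on (cball q0 (2*r)) f"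
    by (rule continuous_on_subset[OF continuous_on_cdiff[OF f] r(2)])
  define fx where "fx q t = Blinfun (\<lambda>h. total_deriv f (q + C t) h * circle_weight r t)" for q t
  have fx: "blinfun_apply (fx q t) = (\<lambda>h. total_deriv f (q + C t) h * circle_weight r t)"
    if "q \<in> ball q0 r" for q t
  proof -
    have "bounded_linear (total_deriv f (q + C t))"
      using f[OF shift[OF that]] by (meson cdiffD has_derivative_bounded_linear)
    then have "bounded_linear (\<lambda>h. total_deriv f (q + C t) h * circle_weight r t)"
      by (rule bounded_linear_compose[OF bounded_linear_mult_left])
    then show ?thesis
      unfolding fx_def by (rule bounded_linear_Blinfun_apply)
  qed
  have cont_fx: "continuous_on (ball q0 r \<times> cbox 0 1) (\<lambda>(q, t). fx q t)"
  proof (rule continuous_on_blinfun_componentwise)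
    fix h :: "complex ^ 'n"
    have cp: "continuous_on (ball q0 r \<times> cbox 0 1) (\<lambda>x. partial_deriv l f (fst x + C (snd x)))" for l
      unfolding C_def
      by (rule continuous_on_circle_shift[OF continuous_on_subset[OF continuous_on_partial_deriv[OF S f] r(2)] r(1)])
    have "continuous_on (ball q0 r \<times> cbox 0 1)
        (\<lambda>x. total_deriv f (fst x + C (snd x)) h * circle_weight r (snd x))"
      unfolding total_deriv_def circle_weight_def using r by (intro continuous_intros cp) auto
    then show "continuous_on (ball q0 r \<times> cbox 0 1) (\<lambda>x. (case x of (q, t) \<Rightarrow> fx q t) h)"
      by (rule continuous_on_eq) (auto simp: fx)
  qed
  have "((\<lambda>q. integral (cbox 0 1) (\<lambda>t. f (q + C t) * circle_weight r t))
      has_derivative (integral (cbox 0 1) (fx q0))) (at q0 within ball q0 r)"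
  proof (rule leibniz_rule)
    fix q t assume q: "q \<in> ball q0 r"
    have "((\<lambda>q. f (q + C t)) has_derivative total_deriv f (q + C t)) (at q)"
      by (rule has_derivative_shift_cdiff[OF f[OF shift[OF q]]])
    then show "((\<lambda>q. f (q + C t) * circle_weight r t) has_derivative fx q t) (at q within ball q0 r)"
      unfolding fx[OF q] by (rule has_derivative_mult_left[OF has_derivative_at_withinI])
  next
    fix q assume q: "q \<in> ball q0 r"
    have "continuous_on (cbox 0 1) (\<lambda>t. f (fst (q, t) + circlepath 0 r (snd (q, t)) *s axis j 1))"
      by (rule continuous_on_compose2[OF continuous_on_circle_shift[OF cf r(1), of j], of _ "\<lambda>t. (q, t)"])
         (use q in \<open>auto intro!: continuous_intros\<close>)
    then show "(\<lambda>t. f (q + C t) * circle_weight r t) integrable_on cbox 0 1"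
      unfolding C_def circle_weight_def using r
      by (intro integrable_continuous continuous_intros) auto
  qed (use cont_fx r in auto)
  then have der: "((\<lambda>q. integral (cbox 0 1) (\<lambda>t. f (q + C t) * circle_weight r t))
      has_derivative (integral (cbox 0 1) (fx q0))) (at q0)"
    using r by (simp add: at_within_open[of q0 "ball q0 r"])
  have int_fx: "integral (cbox 0 1) (fx q0) h = integral (cbox 0 1) (\<lambda>t. total_deriv f (q0 + C t) h * circle_weight r t)" for h
  proof -
    have "continuous_on (cbox 0 1) (\<lambda>t. case (q0, t) of (q, t) \<Rightarrow> fx q t)"
      by (rule continuous_on_compose2[OF cont_fx, of _ "\<lambda>t. (q0, t)"])
         (use q0 in \<open>auto intro!: continuous_intros\<close>)
    then have "fx q0 integrable_on cbox 0 1"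
      by (intro integrable_continuous) simp
    from integral_linear[OF this, of "\<lambda>b. blinfun_apply b h"]
    show ?thesis
      using fx[OF q0] by (simp add: o_def blinfun.bounded_linear_left)
  qed
  have der': "(partial_deriv j f has_derivative (integral (cbox 0 1) (fx q0))) (at q0)"
  proof (rule has_derivative_transform_within_open[OF der open_ball q0])
    show "integral (cbox 0 1) (\<lambda>t. f (q + C t) * circle_weight r t) = partial_deriv j f q"
      if "q \<in> ball q0 r" for q
      unfolding C_def by (rule partial_deriv_Cauchy[symmetric, OF r(1) f[OF near[OF that]]])
  qed
  have scale: "integral (cbox 0 1) (fx q0) (s *s h) = s * integral (cbox 0 1) (fx q0) h" for s h
    unfolding int_fx by (simp add: total_deriv_scale mult.assoc)
  show "cdiff (partial_deriv j f) q0"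
    by (rule total_derivI(2)[OF der' scale])
  have "partial_deriv i (partial_deriv j f) q0 = integral (cbox 0 1) (fx q0) (axis i 1)"
    unfolding total_deriv_axis[symmetric] total_derivI(1)[OF der' scale] ..
  then show "partial_deriv i (partial_deriv j f) q0 = integral (cbox 0 1)
          (\<lambda>t. partial_deriv i f (q0 + circlepath 0 r t *s axis j 1) * circle_weight r t)"
    unfolding int_fx total_deriv_axis C_def .
qed

lemma partial_deriv_cdiff:
  assumes "open S" "\<And>q. q \<in> S \<Longrightarrow> cdiff f q" "q \<in> S"
  shows "cdiff (partial_deriv j f) q"
proof -
  from assms obtain e where "e > 0" "cball q e \<subseteq> S"
    using open_contains_cball by blast
  then show ?thesis
    using partial_deriv_cdiff_cball[OF assms(1,2), of "e / 2" q] by simp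
qed

text \<open>
  Both sides are the Cauchy integral over the \<open>j\<close>-circle of \<open>\<partial>\<^sub>i f\<close>: the left by differentiating
  Cauchy's formula for \<open>f\<close>, the right by Cauchy's formula for \<open>\<partial>\<^sub>i f\<close>.
\<close>

lemma partial_deriv_commute:
  assumes S: "open S" and f: "\<And>q. q \<in> S \<Longrightarrow> cdiff f q" and q: "q \<in> S"
  shows "partial_deriv i (partial_deriv j f) q = partial_deriv j (partial_deriv i f) q"
proof -
  from S q obtain e where e: "e > 0" "cball q e \<subseteq> S"
    using open_contains_cball by blast
  have "cdiff (partial_deriv i f) x" if "x \<in> cball q (e / 2)" for x
  proof (rule partial_deriv_cdiff[OF S f])
    have "x \<in> cball q e" using that e(1) zero_le_dist[of q x] by simp
    then show "x \<in> S" using e(2) by blast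
  qed
  from partial_deriv_Cauchy[where q = q and r = "e / 2" and j = j, OF _ this] e
    partial_partial_deriv_Cauchy[OF S f, of "e / 2" q i j]
  show ?thesis by simp
qed

section \<open>Lagrangians in canonical form\<close>

lemma vector_4_nth [simp]:
  "(vector [a, b, c, d] :: 'a::zero ^ 4) $ 1 = a" "(vector [a, b, c, d] :: 'a::zero ^ 4) $ 2 = b"
  "(vector [a, b, c, d] :: 'a::zero ^ 4) $ 3 = c" "(vector [a, b, c, d] :: 'a::zero ^ 4) $ 4 = d"
  unfolding vector_def by simp_all

text \<open>
  Four covectors on a four-dimensional space without common zero are linearly independent: a square
  matrix that is injective on columns is injective on rows.
\<close>

lemma covectors_independent:
  fixes p :: "4 \<Rightarrow> 4 \<Rightarrow> complex"
  assumes inj: "\<And>h :: complex ^ 4. (\<And>i. (\<Sum>j\<in>UNIV. p i j * h $ j) = 0) \<Longrightarrow> h = 0"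
    and rel: "\<And>j. (\<Sum>i\<in>UNIV. w $ i * p i j) = 0"
  shows "w = 0"
proof -
  define M :: "complex ^ 4 ^ 4" where "M = (\<chi> i j. p i j)"
  have "M *v h = 0 \<Longrightarrow> h = 0" for h
    using inj[of h] by (simp add: M_def matrix_vector_mult_def vec_eq_iff)
  then obtain B where "B ** M = mat 1"
    using matrix_left_invertible_ker by blast
  then have MB: "M ** B = mat 1"
    using matrix_left_right_inverse by blast
  have "w v* M = 0"
    using rel by (simp add: M_def vector_matrix_mult_def vec_eq_iff mult.commute)
  then have "w v* (M ** B) = 0"
    by (simp flip: vector_matrix_mul_assoc)
  then show ?thesis by (simp add: MB)
qed

text \<open>
  The symmetry of second derivatives in the form in which the Euler--Lagrange equations use it:
  \<open>\<partial>\<^sub>j (d f (v)) = d (\<partial>\<^sub>j f) (v)\<close>.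
\<close>

lemma
  assumes S: "open S" and f: "\<And>q. q \<in> S \<Longrightarrow> cdiff f q" and q: "q \<in> S"
  shows cdiff_total_deriv: "cdiff (\<lambda>q. total_deriv f q v) q"
    and partial_deriv_total_deriv:
      "partial_deriv j (\<lambda>q. total_deriv f q v) q = total_deriv (partial_deriv j f) q v"
proof -
  have "((\<lambda>q. total_deriv f q v) has_derivative
      (\<lambda>h. \<Sum>i\<in>UNIV. total_deriv (partial_deriv i f) q h * v $ i)) (at q)"
    unfolding total_deriv_def[of f]
    by (intro has_derivative_sum has_derivative_mult_left cdiffD partial_deriv_cdiff[OF S f q])
  note D = total_derivI[OF this]
  have scale: "(\<Sum>i\<in>UNIV. total_deriv (partial_deriv i f) q (s *s h) * v $ i) =
      s * (\<Sum>i\<in>UNIV. total_deriv (partial_deriv i f) q h * v $ i)" for s h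
    by (simp add: total_deriv_scale sum_distrib_left mult.assoc)
  show "cdiff (\<lambda>q. total_deriv f q v) q"
    by (rule D(2)[OF scale])
  have "partial_deriv j (\<lambda>q. total_deriv f q v) q = (\<Sum>i\<in>UNIV. partial_deriv j (partial_deriv i f) q * v $ i)"
    unfolding total_deriv_axis[symmetric, of j "\<lambda>q. total_deriv f q v"] D(1)[OF scale]
    by (simp add: total_deriv_axis)
  also have "\<dots> = total_deriv (partial_deriv j f) q v"
    unfolding total_deriv_def by (simp add: partial_deriv_commute[OF S f q, of j])
  finally show "partial_deriv j (\<lambda>q. total_deriv f q v) q = total_deriv (partial_deriv j f) q v" .
qed

lemma partial_deriv_mult:
  assumes "cdiff f q" "cdiff g q"
  shows "partial_deriv j (\<lambda>q. f q * g q) q = partial_deriv j f q * g q + f q * partial_deriv j g q"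
proof -
  have "total_deriv (\<lambda>q. f q * g q) q = (\<lambda>h. f q * total_deriv g q h + total_deriv f q h * g q)"
    by (rule total_derivI(1)[OF has_derivative_mult[OF assms[THEN cdiffD]]])
       (simp add: total_deriv_scale algebra_simps)
  from fun_cong[OF this, of "axis j 1"] show ?thesis
    by (simp add: total_deriv_axis)
qed

lemma partial_deriv_add:
  assumes "cdiff f q" "cdiff g q"
  shows "partial_deriv j (\<lambda>q. f q + g q) q = partial_deriv j f q + partial_deriv j g q"
proof -
  have "total_deriv (\<lambda>q. f q + g q) q = (\<lambda>h. total_deriv f q h + total_deriv g q h)"
    by (rule total_derivI(1)[OF has_derivative_add[OF assms[THEN cdiffD]]])
       (simp add: total_deriv_scale algebra_simps)
  from fun_cong[OF this, of "axis j 1"] show ?thesis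
    by (simp add: total_deriv_axis)
qed

lemma partial_deriv_const [simp]: "partial_deriv j (\<lambda>_. c) q = 0"
  by (simp add: partial_deriv_def)

lemma cdiff_total_deriv_velocity:
  "cdiff (total_deriv f q) v" and partial_deriv_total_deriv_velocity: "partial_deriv j (total_deriv f q) v = partial_deriv j f q"
proof -
  have "(total_deriv f q has_derivative total_deriv f q) (at v)"
    unfolding total_deriv_def[abs_def]
    by (intro has_derivative_sum has_derivative_mult_right bounded_linear_imp_has_derivative bounded_linear_vec_nth)
  note D = total_derivI[OF this total_deriv_scale]
  show "cdiff (total_deriv f q) v" by (rule D(2))
  show "partial_deriv j (total_deriv f q) v = partial_deriv j f q"
    using fun_cong[OF D(1), of "axis j 1"] by (simp add: total_deriv_axis)
qed

lemma partial_deriv_cong: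
  assumes "open S" "q \<in> S" "\<And>x. x \<in> S \<Longrightarrow> f x = g x" "cdiff g q"
  shows "partial_deriv j f q = partial_deriv j g q"
  using cdiff_cong(2)[OF assms] total_deriv_axis by metis

text \<open>
  Second derivatives cancel between the two sides of the Euler--Lagrange equations, and the total
  derivative of \<open>f\<close> drops out with them.  What is left is the linear relation
  \<open>2 P P' \<partial>\<^sub>j N - 2 P (N' - 1) \<partial>\<^sub>j P + Q' \<partial>\<^sub>j R - R' \<partial>\<^sub>j Q = 0\<close> between the four gradients, so all
  its coefficients vanish.
\<close>

lemma euler_lagrange_canonical:
  fixes P N Q R f :: "complex ^ 4 \<Rightarrow> complex"
  assumes S: "open S"
    and P: "\<And>q. q \<in> S \<Longrightarrow> cdiff P q" and N: "\<And>q. q \<in> S \<Longrightarrow> cdiff N q"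
    and Q: "\<And>q. q \<in> S \<Longrightarrow> cdiff Q q" and R: "\<And>q. q \<in> S \<Longrightarrow> cdiff R q"
    and f: "\<And>q. q \<in> S \<Longrightarrow> cdiff f q"
    and P0: "\<And>q. q \<in> S \<Longrightarrow> P q \<noteq> 0"
    and L: "\<And>q v. q \<in> S \<Longrightarrow>
      L q v = P q ^ 2 * (total_deriv N q v - 1) + Q q * total_deriv R q v + c * total_deriv f q v"
    and inj: "\<And>q h. q \<in> S \<Longrightarrow> total_deriv P q h = 0 \<Longrightarrow> total_deriv N q h = 0 \<Longrightarrow>
      total_deriv Q q h = 0 \<Longrightarrow> total_deriv R q h = 0 \<Longrightarrow> h = 0"
    and X: "curve S T X X'"
  shows "euler_lagrange L T X X' \<longleftrightarrow> (\<forall>\<tau>\<in>T. total_deriv P (X \<tau>) (X' \<tau>) = 0 \<and>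
    total_deriv N (X \<tau>) (X' \<tau>) = 1 \<and> total_deriv Q (X \<tau>) (X' \<tau>) = 0 \<and> total_deriv R (X \<tau>) (X' \<tau>) = 0)"
proof -
  define p where "p j q = P q * P q * partial_deriv j N q + Q q * partial_deriv j R q + c * partial_deriv j f q"
    for j q
  (* m1 hides the constant -1 from the simplifier, which would turn the sum into a difference and
     so block the sum rule for partial derivatives. *)
  define m1 :: complex where "m1 = - 1"
  have momentum: "partial_deriv j (L q) v = p j q" if "q \<in> S" for j q v
  proof -
    have "L q = (\<lambda>v. P q * P q * (total_deriv N q v + m1) + (Q q * total_deriv R q v + c * total_deriv f q v))"
      by (rule ext) (simp add: L[OF that] power2_eq_square m1_def)
    then show ?thesis
      by (simp add: p_def partial_deriv_add partial_deriv_mult cdiff_mult cdiff_add cdiff_const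
          cdiff_total_deriv_velocity partial_deriv_total_deriv_velocity)
  qed
  have force: "partial_deriv j (\<lambda>q. L q v) q =
      2 * P q * partial_deriv j P q * (total_deriv N q v - 1) + P q * P q * total_deriv (partial_deriv j N) q v
      + partial_deriv j Q q * total_deriv R q v + Q q * total_deriv (partial_deriv j R) q v
      + c * total_deriv (partial_deriv j f) q v" if q: "q \<in> S" for j q v
  proof -
    let ?L = "\<lambda>q. P q * P q * (total_deriv N q v + m1) + (Q q * total_deriv R q v + c * total_deriv f q v)"
    note cd = cdiff_mult cdiff_add cdiff_const P[OF q] Q[OF q]
      cdiff_total_deriv[OF S N q] cdiff_total_deriv[OF S R q] cdiff_total_deriv[OF S f q]
    have "partial_deriv j (\<lambda>q. L q v) q = partial_deriv j ?L q"
      by (rule partial_deriv_cong[OF S q]) (simp add: L power2_eq_square m1_def, intro cd)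
    also have "\<dots> = 2 * P q * partial_deriv j P q * (total_deriv N q v - 1) + P q * P q * total_deriv (partial_deriv j N) q v
      + partial_deriv j Q q * total_deriv R q v + Q q * total_deriv (partial_deriv j R) q v
      + c * total_deriv (partial_deriv j f) q v"
      by (simp add: partial_deriv_add partial_deriv_mult cd partial_deriv_total_deriv[OF S N q]
          partial_deriv_total_deriv[OF S R q] partial_deriv_total_deriv[OF S f q]) (simp add: m1_def algebra_simps)
    finally show ?thesis .
  qed
  have "(\<forall>j. ((\<lambda>t. partial_deriv j (\<lambda>v. L (X t) v) (X' t)) has_field_derivative
        partial_deriv j (\<lambda>q. L q (X' \<tau>)) (X \<tau>)) (at \<tau> within T)) \<longleftrightarrow>
     total_deriv P (X \<tau>) (X' \<tau>) = 0 \<and> total_deriv N (X \<tau>) (X' \<tau>) = 1 \<and>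
     total_deriv Q (X \<tau>) (X' \<tau>) = 0 \<and> total_deriv R (X \<tau>) (X' \<tau>) = 0"
    (is "(\<forall>j. ?EL j) \<longleftrightarrow> ?canonical") if \<tau>: "\<tau> \<in> T" for \<tau>
  proof -
    define q v where "q = X \<tau>" and "v = X' \<tau>"
    have q: "q \<in> S" and lim: "at \<tau> within T \<noteq> bot"
      using X \<tau> by (auto simp: curve_def q_def trivial_limit_within)
    have X_deriv: "((\<lambda>t. X t $ j) has_field_derivative v $ j) (at \<tau> within T)" for j
      using X \<tau> by (simp add: curve_def v_def)
    have along: "((\<lambda>t. g (X t)) has_field_derivative total_deriv g q v) (at \<tau> within T)" if "cdiff g q" for g
      unfolding q_def by (rule cdiff_along_curve[OF that[unfolded q_def] X_deriv])
    have EL: "?EL j \<longleftrightarrow> 2 * P q * total_deriv P q v * partial_deriv j N q + total_deriv Q q v * partial_deriv j R q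
        - 2 * P q * (total_deriv N q v - 1) * partial_deriv j P q - total_deriv R q v * partial_deriv j Q q = 0"
        (is "_ \<longleftrightarrow> ?e = 0") for j
    proof -
      let ?D = "2 * P q * total_deriv P q v * partial_deriv j N q + P q * P q * total_deriv (partial_deriv j N) q v
          + total_deriv Q q v * partial_deriv j R q + Q q * total_deriv (partial_deriv j R) q v
          + c * total_deriv (partial_deriv j f) q v"
      have pd: "cdiff (partial_deriv j N) q" "cdiff (partial_deriv j R) q" "cdiff (partial_deriv j f) q"
        using partial_deriv_cdiff[OF S _ q] N R f by auto
      have regroup: "(a * x + a * x) * y + b * (x * x) + (d * r + e * s) + c * g
          = 2 * x * a * y + x * x * b + d * r + s * e + c * g" for a b d e g r s x y :: complex
        by (simp add: algebra_simps)
      have "((\<lambda>t. p j (X t)) has_field_derivative ?D) (at \<tau> within T)"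
        unfolding p_def
        by (rule DERIV_cong[OF DERIV_add[OF DERIV_add[OF
              DERIV_mult[OF DERIV_mult[OF along[OF P[OF q]] along[OF P[OF q]]] along[OF pd(1)]]
              DERIV_mult[OF along[OF Q[OF q]] along[OF pd(2)]]] DERIV_cmult[OF along[OF pd(3)], of c]]])
          (unfold q_def, rule regroup)
      then have mom: "((\<lambda>t. partial_deriv j (\<lambda>v. L (X t) v) (X' t)) has_field_derivative ?D) (at \<tau> within T)"
        by (rule has_field_derivative_transform_within[OF _ zero_less_one \<tau>])
           (use X momentum in \<open>auto simp: curve_def\<close>)
      have "?EL j \<longleftrightarrow> ?D = partial_deriv j (\<lambda>q. L q v) q"
      proof
        assume "?EL j"
        from has_field_derivative_unique[OF mom this lim]
        show "?D = partial_deriv j (\<lambda>q. L q v) q"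
          unfolding v_def[symmetric] q_def[symmetric] .
      next
        assume "?D = partial_deriv j (\<lambda>q. L q v) q"
        then show "?EL j"
          using mom unfolding v_def[symmetric] q_def[symmetric] by (simp only:)
      qed
      also have "\<dots> \<longleftrightarrow> ?D - partial_deriv j (\<lambda>q. L q v) q = 0"
        by simp
      also have "?D - partial_deriv j (\<lambda>q. L q v) q = ?e"
        unfolding force[OF q] by (simp add: algebra_simps)
      finally show ?thesis .
    qed
    show ?thesis
    proof
      assume "\<forall>j. ?EL j"
      then have e0: "2 * P q * total_deriv P q v * partial_deriv j N q + total_deriv Q q v * partial_deriv j R q
        - 2 * P q * (total_deriv N q v - 1) * partial_deriv j P q - total_deriv R q v * partial_deriv j Q q = 0" for j
        using EL by blast
      define F where "F = (\<lambda>i::4. if i = 1 then P else if i = 2 then N else if i = 3 then Q else R)"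
      define w :: "complex ^ 4" where "w = vector [- 2 * P q * (total_deriv N q v - 1), 2 * P q * total_deriv P q v,
        - total_deriv R q v, total_deriv Q q v]"
      have "w = 0"
      proof (rule covectors_independent[where p = "\<lambda>i j. partial_deriv j (F i) q"])
        fix h :: "complex ^ 4" assume "\<And>i. (\<Sum>j\<in>UNIV. partial_deriv j (F i) q * h $ j) = 0"
        then have "total_deriv (F i) q h = 0" for i by (simp add: total_deriv_def)
        from this[of 1] this[of 2] this[of 3] this[of 4] show "h = 0"
          by (intro inj[OF q]) (simp_all add: F_def)
      next
        show "(\<Sum>i\<in>UNIV. w $ i * partial_deriv j (F i) q) = 0" for j
          using e0[of j] by (simp add: sum_4 F_def w_def algebra_simps)
      qed
      then have "w $ 1 = 0" "w $ 2 = 0" "w $ 3 = 0" "w $ 4 = 0" by simp_all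
      then show ?canonical
        unfolding q_def[symmetric] v_def[symmetric] using P0[OF q] by (simp add: w_def)
    next
      assume ?canonical
      then show "\<forall>j. ?EL j"
        unfolding EL unfolding q_def v_def by simp
    qed
  qed
  then show ?thesis unfolding euler_lagrange_def by blast
qed

section \<open>Complete elliptic integrals as functions of the parameter\<close>

text \<open>
  The plane cut along \<open>[1, \<infinity>)\<close>.
\<close>

definition slit :: "complex set" where
  "slit = {m. 1 - m \<notin> \<real>\<^sub>\<le>\<^sub>0}"

text \<open>
  The complete elliptic integrals in the parameter \<open>m = k\<^sup>2\<close> and in trigonometric form, which has a
  continuous integrand and is holomorphic in \<open>m\<close> on the whole slit plane.
\<close>

definition paramK :: "complex \<Rightarrow> complex" where
  "paramK m = integral {0..pi / 2} (\<lambda>\<theta>. 1 / csqrt (1 - m * of_real (sin \<theta> ^ 2)))"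

definition paramE :: "complex \<Rightarrow> complex" where
  "paramE m = integral {0..pi / 2} (\<lambda>\<theta>. csqrt (1 - m * of_real (sin \<theta> ^ 2)))"

lemma open_slit: "open slit"
proof -
  have "slit = (\<lambda>m. 1 - m) -` (- \<real>\<^sub>\<le>\<^sub>0)"
    by (auto simp: slit_def)
  also have "open \<dots>"
    by (intro open_vimage continuous_intros) auto
  finally show ?thesis .
qed

lemma slit_radicand:
  assumes "m \<in> slit" "0 \<le> s" "s \<le> 1"
  shows "1 - m * of_real s \<notin> \<real>\<^sub>\<le>\<^sub>0"
proof
  assume *: "1 - m * of_real s \<in> \<real>\<^sub>\<le>\<^sub>0"
  then have "s \<noteq> 0" by auto
  with * assms(2) have "Im m = 0" "s * Re m \<ge> 1" "s > 0"
    by (auto simp: complex_nonpos_Reals_iff mult.commute)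
  then have "Re m \<ge> 1"
    using assms(3) by (smt (verit) mult_le_cancel_right1 mult_nonneg_nonneg mult_right_mono mult_less_0_iff mult_left_le_one_le)
  with \<open>Im m = 0\<close> assms(1) show False
    by (simp add: slit_def complex_nonpos_Reals_iff)
qed

lemma slit_radicand_sin: "m \<in> slit \<Longrightarrow> 1 - m * of_real (sin \<theta> ^ 2) \<notin> \<real>\<^sub>\<le>\<^sub>0"
  by (rule slit_radicand) (auto simp: abs_square_le_1 simp del: of_real_power)

lemma slit_radicand_nz: "m \<in> slit \<Longrightarrow> csqrt (1 - m * of_real (sin \<theta> ^ 2)) \<noteq> 0"
  using slit_radicand_sin[of m \<theta>] by (auto simp del: of_real_power)

lemma continuous_on_radicand:
  fixes f :: "'a::t2_space \<Rightarrow> complex"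
  assumes "continuous_on A f" "continuous_on A g" "\<And>x. x \<in> A \<Longrightarrow> f x \<in> slit"
  shows "continuous_on A (\<lambda>x. csqrt (1 - f x * of_real (sin (g x) ^ 2)))"
  by (rule continuous_on_compose2[OF continuous_on_csqrt])
     (use assms slit_radicand_sin in \<open>auto intro!: continuous_intros simp del: of_real_power\<close>)

lemma has_field_derivative_param_integral:
  fixes f f' :: "complex \<Rightarrow> real \<Rightarrow> complex"
  assumes U: "open U" "m \<in> U"
    and der: "\<And>m t. m \<in> U \<Longrightarrow> ((\<lambda>m. f m t) has_field_derivative f' m t) (at m)"
    and cont: "\<And>m. m \<in> U \<Longrightarrow> continuous_on {a..b} (f m)"
    and cont': "continuous_on (U \<times> {a..b}) (\<lambda>(m, t). f' m t)"
  shows "((\<lambda>m. integral {a..b} (f m)) has_field_derivative integral {a..b} (f' m)) (at m)"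
proof -
  obtain e where e: "e > 0" "ball m e \<subseteq> U"
    by (rule openE[OF U])
  have "((\<lambda>m. integral (cbox a b) (f m)) has_field_derivative integral (cbox a b) (f' m)) (at m within ball m e)"
  proof (rule leibniz_rule_field_derivative[where f = f and fx = f'])
    fix x t assume "x \<in> ball m e" "t \<in> cbox a b"
    then show "((\<lambda>m. f m t) has_field_derivative f' x t) (at x within ball m e)"
      using e by (intro has_field_derivative_at_within[OF der]) auto
  next
    fix x assume "x \<in> ball m e"
    then show "f x integrable_on cbox a b"
      using cont e by (intro integrable_continuous) auto
  next
    show "continuous_on (ball m e \<times> cbox a b) (\<lambda>(m, t). f' m t)"
      by (rule continuous_on_subset[OF cont']) (use e in auto)
  qed (use e in auto)
  then show ?thesis
    using e by (simp add: at_within_open[of m "ball m e"])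
qed

text \<open>
  With \<open>s = \<surd>(1 - m sin\<^sup>2 \<theta>)\<close> the derivative \<open>- sin\<^sup>2 \<theta> / (2 s)\<close> of the integrand is
  \<open>(s - 1 / s) / (2 m)\<close>.
\<close>

lemma paramE_deriv:
  assumes m: "m \<in> slit" "m \<noteq> 0"
  shows "(paramE has_field_derivative (paramE m - paramK m) / (2 * m)) (at m)"
proof -
  let ?s = "\<lambda>m \<theta>. csqrt (1 - m * of_real (sin \<theta> ^ 2))"
  have "(paramE has_field_derivative integral {0..pi/2} (\<lambda>\<theta>. - of_real (sin \<theta> ^ 2) / (2 * ?s m \<theta>))) (at m)"
    unfolding paramE_def[abs_def]
  proof (rule has_field_derivative_param_integral[OF open_slit m(1)])
    fix m \<theta> assume "m \<in> slit"
    then show "((\<lambda>m. ?s m \<theta>) has_field_derivative - of_real (sin \<theta> ^ 2) / (2 * ?s m \<theta>)) (at m)"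
      using slit_radicand_sin
      by (auto intro!: derivative_eq_intros simp del: of_real_power)
  next
    fix m assume "m \<in> slit"
    then show "continuous_on {0..pi / 2} (?s m)"
      by (intro continuous_on_radicand continuous_intros)
  next
    show "continuous_on (slit \<times> {0..pi / 2}) (\<lambda>(m, \<theta>). - of_real (sin \<theta> ^ 2) / (2 * ?s m \<theta>))"
      unfolding split_beta
      by (intro continuous_intros continuous_on_radicand)
        (use slit_radicand_nz in \<open>auto simp del: of_real_power\<close>)
  qed
  moreover have "integral {0..pi/2} (\<lambda>\<theta>. - of_real (sin \<theta> ^ 2) / (2 * ?s m \<theta>)) = (paramE m - paramK m) / (2 * m)"
  proof -
    have "integral {0..pi/2} (\<lambda>\<theta>. - of_real (sin \<theta> ^ 2) / (2 * ?s m \<theta>))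
        = integral {0..pi/2} (\<lambda>\<theta>. (?s m \<theta> - 1 / ?s m \<theta>) / (2 * m))"
    proof (rule integral_cong)
      fix \<theta>
      have "- of_real (sin \<theta> ^ 2) = (?s m \<theta> ^ 2 - 1) / m"
        using m by (simp add: field_simps)
      then show "- of_real (sin \<theta> ^ 2) / (2 * ?s m \<theta>) = (?s m \<theta> - 1 / ?s m \<theta>) / (2 * m)"
        using m slit_radicand_nz[OF m(1), of \<theta>]
        by (simp only:) (simp add: field_simps power2_eq_square del: of_real_power power2_csqrt)
    qed
    also have "\<dots> = integral {0..pi/2} (\<lambda>\<theta>. ?s m \<theta> - 1 / ?s m \<theta>) / (2 * m)"
      by simp
    also have "integral {0..pi/2} (\<lambda>\<theta>. ?s m \<theta> - 1 / ?s m \<theta>) = paramE m - paramK m"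
      unfolding paramE_def paramK_def using m slit_radicand_nz
      by (intro integral_diff integrable_continuous_real continuous_intros continuous_on_radicand) auto
    finally show ?thesis .
  qed
  ultimately show ?thesis by simp
qed

text \<open>
  The integrands differ by the derivative of \<open>m sin \<theta> cos \<theta> / \<surd>(1 - m sin\<^sup>2 \<theta>)\<close>, which vanishes at
  both ends of the interval.
\<close>

lemma integral_inverse_cube:
  assumes m: "m \<in> slit"
  shows "integral {0..pi / 2} (\<lambda>\<theta>. (1 - m) / csqrt (1 - m * of_real (sin \<theta> ^ 2)) ^ 3) = paramE m"
proof -
  let ?s = "\<lambda>\<theta>. csqrt (1 - m * of_real (sin \<theta> ^ 2))"
  let ?F = "\<lambda>\<theta>. of_real (sin \<theta> * cos \<theta>) / ?s \<theta>"
  have nz: "?s \<theta> \<noteq> 0" for \<theta> by (rule slit_radicand_nz[OF m])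
  have "((\<lambda>\<theta>. ?s \<theta> - (1 - m) / ?s \<theta> ^ 3) has_integral (m * ?F (pi / 2) - m * ?F 0)) {0..pi / 2}"
  proof (rule fundamental_theorem_of_calculus)
    fix \<theta> :: real
    let ?S = "of_real (sin \<theta>) :: complex" and ?C = "of_real (cos \<theta>) :: complex"
    have ds: "(?s has_vector_derivative - (m * ?S * ?C) / ?s \<theta>) (at \<theta> within {0..pi/2})"
    proof -
      have "((\<lambda>\<theta>. of_real (sin \<theta> ^ 2) :: complex) has_vector_derivative of_real (2 * sin \<theta> * cos \<theta>)) (at \<theta> within {0..pi/2})"
        by (intro has_vector_derivative_of_real) (auto intro!: derivative_eq_intros)
      then have "((\<lambda>\<theta>. 1 - m * of_real (sin \<theta> ^ 2)) has_vector_derivative - (m * of_real (2 * sin \<theta> * cos \<theta>))) (at \<theta> within {0..pi/2})"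
        by (auto intro!: derivative_eq_intros)
      from field_vector_diff_chain_within[OF this has_field_derivative_at_within[OF has_field_derivative_csqrt[OF slit_radicand_sin[OF m]]]]
      show ?thesis
        by (simp add: o_def field_simps del: of_real_power)
    qed
    have dF: "(?F has_vector_derivative
       (?C ^ 2 - ?S ^ 2) / ?s \<theta> + m * ?S ^ 2 * ?C ^ 2 / ?s \<theta> ^ 3) (at \<theta> within {0..pi/2})"
    proof -
      have sc: "((\<lambda>\<theta>. of_real (sin \<theta> * cos \<theta>)) has_vector_derivative (of_real (cos \<theta> * cos \<theta> - sin \<theta> * sin \<theta>) :: complex)) (at \<theta> within {0..pi/2})"
        by (intro has_vector_derivative_of_real) (auto intro!: derivative_eq_intros)
      have "((\<lambda>\<theta>. inverse (?s \<theta>)) has_vector_derivative - (- (m * ?S * ?C) / ?s \<theta>) / ?s \<theta> ^ 2) (at \<theta> within {0..pi/2})"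
        using field_vector_diff_chain_within[OF ds has_field_derivative_at_within[OF DERIV_inverse[OF nz]]] nz
        by (simp add: o_def field_simps power2_eq_square del: of_real_power power2_csqrt)
      from has_vector_derivative_mult[OF sc this] nz[of \<theta>] show ?thesis
        by (simp add: field_simps power2_eq_square power3_eq_cube del: power2_csqrt)
    qed
    have "?s \<theta> - (1 - m) / ?s \<theta> ^ 3 = m * ((?C ^ 2 - ?S ^ 2) / ?s \<theta> + m * ?S ^ 2 * ?C ^ 2 / ?s \<theta> ^ 3)"
    proof -
      have s2: "?s \<theta> ^ 2 = 1 - m * ?S ^ 2" by simp
      have C2: "?C ^ 2 = 1 - ?S ^ 2"
        by (metis cos_squared_eq of_real_1 of_real_diff of_real_power)
      have "?s \<theta> ^ 4 - (1 - m) = m * ((?C ^ 2 - ?S ^ 2) * ?s \<theta> ^ 2 + m * ?S ^ 2 * ?C ^ 2)"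
      proof -
        have "?s \<theta> ^ 4 = (1 - m * ?S ^ 2) ^ 2"
          unfolding s2[symmetric] by (simp only: power_mult[symmetric]) simp
        then show ?thesis
          unfolding s2 C2 by (simp only:) (simp add: power2_eq_square algebra_simps)
      qed
      moreover have "s - c / s ^ 3 = m * (X / s + Y / s ^ 3)"
        if "s \<noteq> 0" "s ^ 4 - c = m * (X * s ^ 2 + Y)" for s X Y c :: complex
      proof -
        have "s - c / s ^ 3 = (s ^ 4 - c) / s ^ 3"
          using that(1) by (simp add: field_simps eval_nat_numeral)
        also have "\<dots> = m * (X / s + Y / s ^ 3)"
          unfolding that(2) using that(1) by (simp add: field_simps eval_nat_numeral)
        finally show ?thesis .
      qed
      ultimately show ?thesis
        using nz by blast
    qed
    then show "((\<lambda>\<theta>. m * ?F \<theta>) has_vector_derivative (?s \<theta> - (1 - m) / ?s \<theta> ^ 3)) (at \<theta> within {0..pi/2})"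
      using has_vector_derivative_mult_right[OF dF, of m] by simp
  qed simp
  then have "integral {0..pi/2} (\<lambda>\<theta>. ?s \<theta> - (1 - m) / ?s \<theta> ^ 3) = 0"
    by (simp add: integral_unique)
  moreover have "integral {0..pi/2} (\<lambda>\<theta>. ?s \<theta> - (1 - m) / ?s \<theta> ^ 3) = 
      paramE m - integral {0..pi/2} (\<lambda>\<theta>. (1 - m) / ?s \<theta> ^ 3)"
    unfolding paramE_def
    by (intro integral_diff integrable_continuous_real continuous_intros continuous_on_radicand) (use nz m in auto)
  ultimately show ?thesis by simp
qed

text \<open>
  The derivative \<open>sin\<^sup>2 \<theta> / (2 s\<^sup>3)\<close> of the integrand is \<open>(1 / s\<^sup>3 - 1 / s) / (2 m)\<close>, and the integral
  of \<open>1 / s\<^sup>3\<close> has been reduced to \<open>E\<close>.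
\<close>

lemma paramK_deriv:
  assumes m: "m \<in> slit" "m \<noteq> 0"
  shows "(paramK has_field_derivative (paramE m / (1 - m) - paramK m) / (2 * m)) (at m)"
proof -
  let ?s = "\<lambda>m \<theta>. csqrt (1 - m * of_real (sin \<theta> ^ 2))"
  have m1: "1 - m \<noteq> 0" using m by (auto simp: slit_def)
  have "(paramK has_field_derivative integral {0..pi/2} (\<lambda>\<theta>. of_real (sin \<theta> ^ 2) / (2 * ?s m \<theta> ^ 3))) (at m)"
    unfolding paramK_def[abs_def]
  proof (rule has_field_derivative_param_integral[OF open_slit m(1)])
    fix m \<theta> assume m: "m \<in> slit"
    have "((\<lambda>m. inverse (?s m \<theta>)) has_field_derivative - (inverse (?s m \<theta>) * (- of_real (sin \<theta> ^ 2) / (2 * ?s m \<theta>)) * inverse (?s m \<theta>))) (at m)"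
      using slit_radicand_sin[OF m, of \<theta>] slit_radicand_nz[OF m, of \<theta>]
      by (intro DERIV_inverse' has_field_derivative_csqrt')
         (auto intro!: derivative_eq_intros simp del: of_real_power)
    then show "((\<lambda>m. 1 / ?s m \<theta>) has_field_derivative of_real (sin \<theta> ^ 2) / (2 * ?s m \<theta> ^ 3)) (at m)"
      by (simp add: field_simps power3_eq_cube del: of_real_power)
  next
    fix m assume m: "m \<in> slit"
    then show "continuous_on {0..pi / 2} (\<lambda>\<theta>. 1 / ?s m \<theta>)"
      using slit_radicand_nz by (intro continuous_intros continuous_on_radicand) auto
  next
    show "continuous_on (slit \<times> {0..pi / 2}) (\<lambda>(m, \<theta>). of_real (sin \<theta> ^ 2) / (2 * ?s m \<theta> ^ 3))"
      unfolding split_beta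
      by (intro continuous_intros continuous_on_radicand)
        (use slit_radicand_nz in \<open>auto simp del: of_real_power\<close>)
  qed
  moreover have "integral {0..pi/2} (\<lambda>\<theta>. of_real (sin \<theta> ^ 2) / (2 * ?s m \<theta> ^ 3)) = (paramE m / (1 - m) - paramK m) / (2 * m)"
  proof -
    have rational: "S / (2 * s ^ 3) = ((1 - m) / s ^ 3 / (1 - m) - 1 / s) / (2 * m)"
      if "s \<noteq> 0" "S = (1 - s ^ 2) / m" for s S :: complex
      using that(1) m m1 unfolding that(2) by (simp add: divide_simps) (simp add: algebra_simps eval_nat_numeral)
    have "integral {0..pi/2} (\<lambda>\<theta>. of_real (sin \<theta> ^ 2) / (2 * ?s m \<theta> ^ 3))
        = integral {0..pi/2} (\<lambda>\<theta>. ((1 - m) / ?s m \<theta> ^ 3 / (1 - m) - 1 / ?s m \<theta>) / (2 * m))"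
    proof (rule integral_cong)
      fix \<theta>
      have "of_real (sin \<theta> ^ 2) = (1 - ?s m \<theta> ^ 2) / m"
        using m by (simp add: field_simps)
      then show "of_real (sin \<theta> ^ 2) / (2 * ?s m \<theta> ^ 3) = ((1 - m) / ?s m \<theta> ^ 3 / (1 - m) - 1 / ?s m \<theta>) / (2 * m)"
        using rational[OF slit_radicand_nz[OF m(1), of \<theta>]] by blast
    qed
    also have "\<dots> = integral {0..pi/2} (\<lambda>\<theta>. (1 - m) / ?s m \<theta> ^ 3 / (1 - m) - 1 / ?s m \<theta>) / (2 * m)"
      by simp
    also have "integral {0..pi/2} (\<lambda>\<theta>. (1 - m) / ?s m \<theta> ^ 3 / (1 - m) - 1 / ?s m \<theta>) 
        = integral {0..pi/2} (\<lambda>\<theta>. (1 - m) / ?s m \<theta> ^ 3 / (1 - m)) - paramK m"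
      unfolding paramK_def using m m1 slit_radicand_nz
      by (intro integral_diff integrable_continuous_real continuous_intros continuous_on_radicand) auto
    also have "integral {0..pi/2} (\<lambda>\<theta>. (1 - m) / ?s m \<theta> ^ 3 / (1 - m)) = paramE m / (1 - m)"
      using integral_inverse_cube[OF m(1)] by (metis (no_types) integral_divide)
    finally show ?thesis .
  qed
  ultimately show ?thesis by simp
qed

lemma notin_nonpos_Reals_nz: "z \<notin> \<real>\<^sub>\<le>\<^sub>0 \<Longrightarrow> z \<noteq> 0"
  by auto

lemma csqrt_of_real_mult:
  assumes "x \<ge> 0"
  shows "csqrt (of_real x * z) = of_real (sqrt x) * csqrt z"
proof (cases "x = 0")
  case False
  then show ?thesis
    using assms csqrt_principal[of z]
    by (intro csqrt_unique) (auto simp: power_mult_distrib simp flip: of_real_power simp del: csqrt.simps)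
qed simp

lemma Re_csqrt_pos:
  assumes "z \<notin> \<real>\<^sub>\<le>\<^sub>0"
  shows "Re (csqrt z) > 0"
proof (rule ccontr)
  assume "\<not> Re (csqrt z) > 0"
  then have "Re (csqrt z) = 0" using Re_csqrt[of z] by linarith
  then have "csqrt z = \<i> * of_real (Im (csqrt z))"
    by (simp add: complex_eq_iff del: csqrt.simps)
  then have "z = (\<i> * of_real (Im (csqrt z))) ^ 2"
    by (metis power2_csqrt)
  also have "\<dots> = - of_real (Im (csqrt z) ^ 2)"
    by (simp add: power_mult_distrib del: csqrt.simps)
  also have "\<dots> \<in> \<real>\<^sub>\<le>\<^sub>0"
    by (simp del: of_real_power csqrt.simps)
  finally show False using assms by simp
qed

text \<open>
  If the imaginary parts have opposite signs then so do the arguments of the factors, and their sum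
  cannot leave \<open>(-\<pi>, \<pi>)\<close>.
\<close>

lemma csqrt_mult_opposite:
  assumes a: "a \<notin> \<real>\<^sub>\<le>\<^sub>0" and b: "b \<notin> \<real>\<^sub>\<le>\<^sub>0" and "Im a * Im b \<le> 0"
  shows "csqrt (a * b) = csqrt a * csqrt b"
proof (rule csqrt_unique)
  define u v where "u = csqrt a" and "v = csqrt b"
  have u: "Re u > 0" and v: "Re v > 0"
    using a b Re_csqrt_pos by (auto simp: u_def v_def simp del: csqrt.simps)
  have ua: "Im a = 2 * Re u * Im u" and vb: "Im b = 2 * Re v * Im v"
    using power2_csqrt[of a] power2_csqrt[of b] unfolding u_def[symmetric] v_def[symmetric]
    by (auto simp: power2_eq_square)
  have "4 * (Re u * Re v) * (Im u * Im v) \<le> 0"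
    using assms(3) unfolding ua vb by (simp add: algebra_simps)
  then have "Im u * Im v \<le> 0"
    using u v by (simp add: mult_le_0_iff)
  moreover have "Re u * Re v > 0" using u v by simp
  ultimately show "0 < Re (csqrt a * csqrt b) \<or> Re (csqrt a * csqrt b) = 0 \<and> 0 \<le> Im (csqrt a * csqrt b)"
    unfolding u_def[symmetric] v_def[symmetric] by simp
qed (simp add: power_mult_distrib)

lemma arcsin_sqrt_range:
  assumes "0 \<le> t" "t \<le> 1"
  shows "arcsin (sqrt t) \<in> {0..pi / 2}" "- 1 \<le> sqrt t" "- 1 < sqrt t"
proof -
  show "- 1 < sqrt t" by (rule less_le_trans[of _ 0]) (use assms in auto)
  show "- 1 \<le> sqrt t" by (rule order_trans[of _ 0]) (use assms in auto)
  then show "arcsin (sqrt t) \<in> {0..pi / 2}"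
    using arcsin_le_arcsin[of 0 "sqrt t"] arcsin_le_arcsin[of "sqrt t" 1] assms by (simp add: arcsin_0 arcsin_1)
qed

text \<open>
  The substitution is read through \<open>arcsin\<close>, whose derivative fails to exist only at the endpoint
  \<open>1\<close>, so that the continuous integrand is the one on the \<open>\<theta>\<close>-side.
\<close>

lemma has_integral_sin_substitution:
  fixes f :: "real \<Rightarrow> complex"
  assumes "continuous_on {0..pi / 2} f"
  shows "((\<lambda>l. f (arcsin l) / of_real (sqrt (1 - l ^ 2))) has_integral integral {0..pi / 2} f) {0..1}"
proof -
  have "((\<lambda>l. inverse (sqrt (1 - l ^ 2)) *\<^sub>R f (arcsin l)) has_integral
      (integral {arcsin 0..arcsin 1} f - integral {arcsin 1..arcsin 0} f)) {0..1}"
  proof (rule has_integral_substitution_general[where s = "{1}"])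
    show "arcsin ` {0..1} \<subseteq> {0..pi / 2}"
      using arcsin_le_arcsin[of 0] arcsin_le_arcsin[of _ 1] by (auto simp: arcsin_0 arcsin_1)
    show "(arcsin has_real_derivative inverse (sqrt (1 - l\<^sup>2))) (at l within {0..1})" if "l \<in> {0..1} - {1}" for l
      using that by (intro has_field_derivative_at_within[OF DERIV_arcsin]) auto
  qed (use assms in \<open>auto intro!: continuous_intros\<close>)
  then show ?thesis
    by (simp add: scaleR_conv_of_real field_simps)
qed

lemma legendre_K_integral:
  assumes "m \<in> slit"
  shows "integral {0..1} (\<lambda>l::real. 1 / csqrt ((1 - of_real l ^ 2) * (1 - m * of_real l ^ 2))) = paramK m"
proof (rule integral_unique, rule has_integral_eq[rotated])
  show "((\<lambda>l. 1 / csqrt (1 - m * of_real (sin (arcsin l) ^ 2)) / of_real (sqrt (1 - l ^ 2))) has_integral paramK m) {0..1}"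
    unfolding paramK_def using assms slit_radicand_nz
    by (intro has_integral_sin_substitution continuous_intros continuous_on_radicand) auto
  fix l :: real assume l: "l \<in> {0..1}"
  have "(1 - of_real l ^ 2) * (1 - m * of_real l ^ 2) = of_real (1 - l ^ 2) * (1 - m * of_real (sin (arcsin l) ^ 2))"
    using l by simp
  moreover have "1 - l ^ 2 \<ge> 0" using l by (simp add: power_le_one)
  ultimately show "1 / csqrt (1 - m * of_real (sin (arcsin l) ^ 2)) / of_real (sqrt (1 - l ^ 2))
      = 1 / csqrt ((1 - of_real l ^ 2) * (1 - m * of_real l ^ 2))"
    by (simp only: csqrt_of_real_mult) simp
qed

lemma legendre_E_integral:
  assumes "m \<in> slit"
  shows "integral {0..1} (\<lambda>l::real. csqrt ((1 - m * of_real l ^ 2) / (1 - of_real l ^ 2))) = paramE m"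
proof (rule integral_unique, rule has_integral_eq[rotated])
  show "((\<lambda>l. csqrt (1 - m * of_real (sin (arcsin l) ^ 2)) / of_real (sqrt (1 - l ^ 2))) has_integral paramE m) {0..1}"
    unfolding paramE_def using assms
    by (intro has_integral_sin_substitution continuous_intros continuous_on_radicand) auto
  fix l :: real assume l: "l \<in> {0..1}"
  have "(1 - m * of_real l ^ 2) / (1 - of_real l ^ 2) = of_real (1 / (1 - l ^ 2)) * (1 - m * of_real (sin (arcsin l) ^ 2))"
    using l by simp
  moreover have "1 / (1 - l ^ 2) \<ge> 0" using l by (simp add: power_le_one)
  ultimately show "csqrt (1 - m * of_real (sin (arcsin l) ^ 2)) / of_real (sqrt (1 - l ^ 2))
      = csqrt ((1 - m * of_real l ^ 2) / (1 - of_real l ^ 2))"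
    by (simp only: csqrt_of_real_mult) (simp add: real_sqrt_divide)
qed

section \<open>The elliptic integrals as functions of the modulus\<close>

lemma moduliD:
  assumes "k \<in> moduli"
  shows "k ^ 2 \<in> slit" "1 - k ^ 2 \<in> slit" "k \<noteq> 0" "1 - k ^ 2 \<noteq> 0" "k ^ 2 - 1 \<noteq> 0" "Re k > 0"
proof -
  show k: "Re k > 0" using assms by (simp add: moduli_def)
  then show "k \<noteq> 0" by auto
  have "1 - k ^ 2 \<notin> \<real>\<^sub>\<le>\<^sub>0"
  proof
    assume "1 - k ^ 2 \<in> \<real>\<^sub>\<le>\<^sub>0"
    then have "Im k = 0" "Re k ^ 2 \<ge> 1 ^ 2"
      using k by (auto simp: complex_nonpos_Reals_iff power2_eq_square)
    then show False
      using assms k power2_le_imp_le[of 1 "Re k"] by (auto simp: moduli_def)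
  qed
  then show "k ^ 2 \<in> slit" "1 - k ^ 2 \<noteq> 0" by (auto simp: slit_def)
  then show "k ^ 2 - 1 \<noteq> 0" by auto
  have "k ^ 2 \<notin> \<real>\<^sub>\<le>\<^sub>0"
  proof
    assume "k ^ 2 \<in> \<real>\<^sub>\<le>\<^sub>0"
    then have "Im k = 0" "Re k * Re k \<le> 0"
      using k by (auto simp: complex_nonpos_Reals_iff power2_eq_square)
    then show False using k by (simp add: mult_le_0_iff)
  qed
  then show "1 - k ^ 2 \<in> slit" by (simp add: slit_def)
qed

lemma open_moduli: "open moduli"
proof -
  have "moduli = {k. Re k > 0} \<inter> (\<lambda>k. 1 - k) -` (- \<real>\<^sub>\<le>\<^sub>0)"
    by (auto simp: moduli_def complex_nonpos_Reals_iff)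
  also have "open \<dots>"
    by (intro open_Int open_halfspace_Re_gt open_vimage continuous_intros) auto
  finally show ?thesis .
qed

lemma connected_moduli: "connected moduli"
proof (rule starlike_imp_connected)
  have "closed_segment (1/2) k \<subseteq> moduli" if k: "k \<in> moduli" for k
  proof
    fix x assume "x \<in> closed_segment (1/2) k"
    then obtain u where u: "0 \<le> u" "u \<le> 1" and x: "x = (1 - u) *\<^sub>R (1/2) + u *\<^sub>R k"
      by (auto simp: in_segment)
    have Re: "Re x = (1 - u) / 2 + u * Re k" and Im: "Im x = u * Im k"
      unfolding x by auto
    have "Re x > 0"
      using u k unfolding Re by (cases "u = 0") (auto simp: moduli_def intro: add_nonneg_pos)
    moreover have False if "Im x = 0" "Re x \<ge> 1"
    proof (cases "u = 0")
      case True then show False using that unfolding Re by simp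
    next
      case False
      then have "Im k = 0" using that Im by simp
      then have "Re k < 1" using k by (auto simp: moduli_def)
      then have "u * Re k \<le> u * 1" using u by (intro mult_left_mono) auto
      then have "u = 1" using that(2) u unfolding Re by (simp add: field_simps)
      then show False using that(2) \<open>Re k < 1\<close> unfolding Re by simp
    qed
    ultimately show "x \<in> moduli" by (auto simp: moduli_def)
  qed
  moreover have "1/2 \<in> moduli" by (simp add: moduli_def)
  ultimately show "starlike moduli" unfolding starlike_def by blast
qed

lemma ellK_eq: "k \<in> moduli \<Longrightarrow> ellK k = paramK (k ^ 2)"
  unfolding ellK_def by (rule legendre_K_integral[OF moduliD(1)])

lemma ellE_eq: "k \<in> moduli \<Longrightarrow> ellE k = paramE (k ^ 2)"
  unfolding ellE_def by (rule legendre_E_integral[OF moduliD(1)])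

lemma ellE'_eq: "k \<in> moduli \<Longrightarrow> ellE' k = paramE (1 - k ^ 2)"
  unfolding ellE'_def by (rule legendre_E_integral[OF moduliD(2)])

text \<open>
  On the segment \<open>l = k + s (1 - k)\<close> one has \<open>1 - l\<^sup>2 = (1 - s) (1 - k) (1 + l)\<close> and
  \<open>l\<^sup>2 - k\<^sup>2 = s (1 - k) (l + k)\<close>.  This is \<open>\<surd>(1 + l) \<surd>(l + k)\<close>, what remains of the denominator of
  \<open>K'\<close> after the endpoint singularities \<open>\<surd>s\<close> and \<open>\<surd>(1 - s)\<close> and the factor \<open>1 - k\<close>.
\<close>

definition rootK' :: "complex \<Rightarrow> real \<Rightarrow> complex" where
  "rootK' k s = csqrt (1 + k + (1 - k) * of_real s) * csqrt (2 * k + (1 - k) * of_real s)"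

lemma rootK'_radicands:
  assumes "Re k > 0" "0 \<le> s" "s \<le> 1"
  shows "1 + k + (1 - k) * of_real s \<notin> \<real>\<^sub>\<le>\<^sub>0" "2 * k + (1 - k) * of_real s \<notin> \<real>\<^sub>\<le>\<^sub>0"
proof -
  have "Re (1 + k + (1 - k) * of_real s) = 1 + s + (1 - s) * Re k"
    and "Re (2 * k + (1 - k) * of_real s) = s + (2 - s) * Re k"
    by (simp_all add: algebra_simps)
  moreover have "(1 - s) * Re k \<ge> 0" "(2 - s) * Re k > 0" using assms by simp_all
  ultimately have "Re (1 + k + (1 - k) * of_real s) > 0" "Re (2 * k + (1 - k) * of_real s) > 0"
    using assms by linarith+
  then show "1 + k + (1 - k) * of_real s \<notin> \<real>\<^sub>\<le>\<^sub>0" "2 * k + (1 - k) * of_real s \<notin> \<real>\<^sub>\<le>\<^sub>0"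
    unfolding complex_nonpos_Reals_iff by linarith+
qed

lemma continuous_on_rootK':
  fixes f :: "'a::t2_space \<Rightarrow> complex"
  assumes "continuous_on A f" "continuous_on A g"
    and "\<And>x. x \<in> A \<Longrightarrow> Re (f x) > 0" "\<And>x. x \<in> A \<Longrightarrow> 0 \<le> g x" "\<And>x. x \<in> A \<Longrightarrow> g x \<le> 1"
  shows "continuous_on A (\<lambda>x. rootK' (f x) (g x))"
  unfolding rootK'_def
  by (intro continuous_on_mult continuous_on_compose2[OF continuous_on_csqrt])
     (use assms rootK'_radicands in \<open>auto intro!: continuous_intros\<close>)

lemma rootK'_nz: "Re k > 0 \<Longrightarrow> 0 \<le> s \<Longrightarrow> s \<le> 1 \<Longrightarrow> rootK' k s \<noteq> 0"
  unfolding rootK'_def using rootK'_radicands[of k s, THEN notin_nonpos_Reals_nz] by (simp del: csqrt.simps)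

text \<open>
  The parameter \<open>s = sin\<^sup>2 \<phi>\<close> on the path absorbs the singularities at both ends.
\<close>

lemma ellK'_regular_integral:
  assumes k: "k \<in> moduli"
  shows "ellK' k = integral {0..pi / 2} (\<lambda>\<phi>. 2 / rootK' k (sin \<phi> ^ 2))"
proof -
  let ?f = "\<lambda>\<phi>. 2 / rootK' k (sin \<phi> ^ 2)"
  have Re: "Re k > 0" using k by (simp add: moduli_def)
  have sin2: "sin \<phi> ^ 2 \<le> 1" for \<phi> :: real by (simp add: abs_square_le_1)
  have cont: "continuous_on {0..pi / 2} ?f"
    by (intro continuous_intros continuous_on_rootK') (use Re sin2 rootK'_nz in auto)
  have "((\<lambda>t. (1 / (2 * sqrt t * sqrt (1 - t))) *\<^sub>R ?f (arcsin (sqrt t))) has_integral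
      (integral {arcsin (sqrt 0)..arcsin (sqrt 1)} ?f - integral {arcsin (sqrt 1)..arcsin (sqrt 0)} ?f)) {0..1}"
  proof (rule has_integral_substitution_general[where s = "{0, 1}" and g = "\<lambda>t. arcsin (sqrt t)"])
    show "(\<lambda>t. arcsin (sqrt t)) ` {0..1} \<subseteq> {0..pi / 2}"
      using arcsin_sqrt_range by auto
    show "((\<lambda>t. arcsin (sqrt t)) has_real_derivative 1 / (2 * sqrt t * sqrt (1 - t))) (at t within {0..1})"
      if "t \<in> {0..1} - {0, 1}" for t
      using that arcsin_sqrt_range(3)[of t] by (auto intro!: derivative_eq_intros simp: field_simps)
  qed (use cont arcsin_sqrt_range(2) in \<open>auto intro!: continuous_intros\<close>)
  then have "((\<lambda>t. (1 / (2 * sqrt t * sqrt (1 - t))) *\<^sub>R ?f (arcsin (sqrt t))) has_integral integral {0..pi/2} ?f) {0..1}"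
    by simp
  moreover have "(1 / (2 * sqrt t * sqrt (1 - t))) *\<^sub>R ?f (arcsin (sqrt t)) =
      (let l = linepath k 1 t in 1 / (csqrt (1 - l ^ 2) * csqrt (l ^ 2 - k ^ 2)) * (1 - k))"
    if t: "t \<in> {0..1}" for t
  proof -
    define l where "l = linepath k 1 t"
    have l: "l = k + of_real t * (1 - k)"
      by (simp add: l_def linepath_def scaleR_conv_of_real algebra_simps)
    have sinsq: "sin (arcsin (sqrt t)) ^ 2 = t"
      using t arcsin_sqrt_range(2)[of t] by simp
    have tk: "t * (Im k * Im k) \<le> 2 * (Im k * Im k)" "t * (Im k * Im k) \<le> 1 * (Im k * Im k)"
      using t by (intro mult_right_mono; simp)+
    have nonreal: "1 - k \<notin> \<real>\<^sub>\<le>\<^sub>0" using k by (auto simp: moduli_def complex_nonpos_Reals_iff)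
    (* The factors 1 - k and 1 + l (likewise l + k) have imaginary parts of opposite sign, so the
       principal roots of the products split. *)
    have "1 - l ^ 2 = of_real (1 - t) * ((1 - k) * (1 + k + (1 - k) * of_real t))"
      unfolding l by (simp add: algebra_simps power2_eq_square)
    moreover have "csqrt ((1 - k) * (1 + k + (1 - k) * of_real t)) = csqrt (1 - k) * csqrt (1 + k + (1 - k) * of_real t)"
      using t by (intro csqrt_mult_opposite nonreal rootK'_radicands Re) (use tk in \<open>auto simp: algebra_simps\<close>)
    ultimately have c1: "csqrt (1 - l ^ 2) = of_real (sqrt (1 - t)) * (csqrt (1 - k) * csqrt (1 + k + (1 - k) * of_real t))"
      using t csqrt_of_real_mult[of "1 - t"] by (simp only:) auto
    have "l ^ 2 - k ^ 2 = of_real t * ((1 - k) * (2 * k + (1 - k) * of_real t))"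
      unfolding l by (simp add: algebra_simps power2_eq_square)
    moreover have "csqrt ((1 - k) * (2 * k + (1 - k) * of_real t)) = csqrt (1 - k) * csqrt (2 * k + (1 - k) * of_real t)"
      using t by (intro csqrt_mult_opposite nonreal rootK'_radicands Re) (use tk in \<open>auto simp: algebra_simps\<close>)
    ultimately have c2: "csqrt (l ^ 2 - k ^ 2) = of_real (sqrt t) * (csqrt (1 - k) * csqrt (2 * k + (1 - k) * of_real t))"
      using t csqrt_of_real_mult[of t] by (simp only:) auto
    have "csqrt (1 - k) * csqrt (1 - k) = 1 - k"
      by (metis power2_csqrt power2_eq_square)
    have "1 - k \<noteq> 0" by (rule notin_nonpos_Reals_nz[OF nonreal])
    have cancel: "1 / ((a * (csqrt (1 - k) * p)) * (b * (csqrt (1 - k) * q))) * (1 - k) = 1 / (a * b) / (p * q)" for a b p q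
    proof -
      have "(a * (csqrt (1 - k) * p)) * (b * (csqrt (1 - k) * q)) = (a * b * (p * q)) * (csqrt (1 - k) * csqrt (1 - k))"
        by (simp only: ac_simps)
      then have "(a * (csqrt (1 - k) * p)) * (b * (csqrt (1 - k) * q)) = (a * b * (p * q)) * (1 - k)"
        unfolding \<open>csqrt (1 - k) * csqrt (1 - k) = 1 - k\<close> .
      moreover have "1 / (z * (1 - k)) * (1 - k) = 1 / z" for z
        using \<open>1 - k \<noteq> 0\<close> by simp
      ultimately show ?thesis by (simp only: divide_divide_eq_left)
    qed
    show ?thesis
      unfolding l_def[symmetric] Let_def c1 c2 sinsq rootK'_def cancel
      by (simp add: scaleR_conv_of_real mult.commute)
  qed
  ultimately have "((\<lambda>t. let l = linepath k 1 t in 1 / (csqrt (1 - l ^ 2) * csqrt (l ^ 2 - k ^ 2)) * (1 - k))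
      has_integral integral {0..pi / 2} ?f) {0..1}"
    by (rule has_integral_eq[rotated]) auto
  then have "((\<lambda>l. 1 / (csqrt (1 - l ^ 2) * csqrt (l ^ 2 - k ^ 2))) has_contour_integral integral {0..pi / 2} ?f) (linepath k 1)"
    unfolding has_contour_integral_linepath Let_def by simp
  then show ?thesis
    unfolding ellK'_def by (rule contour_integral_unique)
qed

lemma ellK'_holomorphic: "ellK' holomorphic_on moduli"
proof -
  let ?p = "\<lambda>k s. 1 + k + (1 - k) * of_real s" and ?r = "\<lambda>k s. 2 * k + (1 - k) * of_real s"
  define f' where "f' k \<phi> = - (2 / rootK' k (sin \<phi> ^ 2)) *
      ((1 - of_real (sin \<phi> ^ 2)) / (2 * ?p k (sin \<phi> ^ 2)) + (2 - of_real (sin \<phi> ^ 2)) / (2 * ?r k (sin \<phi> ^ 2)))"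
    for k :: complex and \<phi>
  have sin2: "0 \<le> sin \<phi> ^ 2" "sin \<phi> ^ 2 \<le> 1" for \<phi> :: real by (simp_all add: abs_square_le_1)
  have "((\<lambda>k. integral {0..pi / 2} (\<lambda>\<phi>. 2 / rootK' k (sin \<phi> ^ 2))) has_field_derivative integral {0..pi/2} (f' k)) (at k)"
    if "k \<in> moduli" for k
  proof (rule has_field_derivative_param_integral[OF open_moduli that])
    fix k :: complex and \<phi> :: real assume "k \<in> moduli"
    then have k: "Re k > 0" by (simp add: moduli_def)
    define s where "s = sin \<phi> ^ 2"
    have s: "0 \<le> s" "s \<le> 1" using sin2 by (auto simp: s_def)
    note np = rootK'_radicands[OF k s]
    have d1: "((\<lambda>k. csqrt (?p k s)) has_field_derivative (1 - of_real s) / (2 * csqrt (?p k s))) (at k)"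
      using np by (auto intro!: derivative_eq_intros)
    have d2: "((\<lambda>k. csqrt (?r k s)) has_field_derivative (2 - of_real s) / (2 * csqrt (?r k s))) (at k)"
      using np by (auto intro!: derivative_eq_intros)
    define u v where "u = csqrt (?p k s)" and "v = csqrt (?r k s)"
    have uv: "u \<noteq> 0" "v \<noteq> 0" and u2: "?p k s = u ^ 2" and v2: "?r k s = v ^ 2"
      using np by (auto simp: u_def v_def)
    have "((\<lambda>k. 2 / (csqrt (?p k s) * csqrt (?r k s))) has_field_derivative
       (0 * (u * v) - 2 * ((1 - of_real s) / (2 * u) * v + (2 - of_real s) / (2 * v) * u)) / (u * v * (u * v))) (at k)"
      unfolding u_def v_def
      by (intro DERIV_divide DERIV_const DERIV_mult d1 d2) (use uv in \<open>auto simp: u_def v_def\<close>)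
    also have "(0 * (u * v) - 2 * ((1 - of_real s) / (2 * u) * v + (2 - of_real s) / (2 * v) * u)) / (u * v * (u * v))
       = - (2 / (u * v)) * ((1 - of_real s) / (2 * u ^ 2) + (2 - of_real s) / (2 * v ^ 2))"
      using uv by (simp add: divide_simps) (simp add: algebra_simps power2_eq_square)
    moreover have "csqrt (u ^ 2) = u" "csqrt (v ^ 2) = v"
      unfolding u2[symmetric] v2[symmetric] by (simp_all only: u_def v_def)
    ultimately show "((\<lambda>k. 2 / rootK' k (sin \<phi> ^ 2)) has_field_derivative f' k \<phi>) (at k)"
      unfolding f'_def rootK'_def s_def[symmetric] by (simp only: u2 v2)
  next
    fix k assume "k \<in> moduli"
    then have "Re k > 0" by (simp add: moduli_def)
    then show "continuous_on {0..pi / 2} (\<lambda>\<phi>. 2 / rootK' k (sin \<phi> ^ 2))"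
      by (intro continuous_intros continuous_on_rootK') (use sin2 rootK'_nz in auto)
  next
    have nz0: "?p k (sin \<phi> ^ 2) \<noteq> 0" "?r k (sin \<phi> ^ 2) \<noteq> 0" if "k \<in> moduli" for k and \<phi> :: real
      using rootK'_radicands[OF _ sin2, of k, THEN notin_nonpos_Reals_nz] that
      by (auto simp: moduli_def)
    have nz: "2 * ?p k (sin \<phi> ^ 2) \<noteq> 0" "2 * ?r k (sin \<phi> ^ 2) \<noteq> 0" if "k \<in> moduli" for k and \<phi> :: real
      by (rule no_zero_divisors[OF _ nz0(1)[OF that]] no_zero_divisors[OF _ nz0(2)[OF that]], simp)+
    show "continuous_on (moduli \<times> {0..pi / 2}) (\<lambda>(k, \<phi>). f' k \<phi>)"
      unfolding split_beta f'_def
      by (intro continuous_intros continuous_on_rootK')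
        (use sin2 rootK'_nz nz in \<open>auto simp: moduli_def simp del: of_real_power\<close>)
  qed
  then have "(\<lambda>k. integral {0..pi / 2} (\<lambda>\<phi>. 2 / rootK' k (sin \<phi> ^ 2))) holomorphic_on moduli"
    by (meson field_differentiable_at_within field_differentiable_def holomorphic_on_def)
  then show ?thesis
    by (rule holomorphic_transform) (simp add: ellK'_regular_integral)
qed

text \<open>
  For real \<open>k\<close> the classical substitution \<open>l\<^sup>2 = 1 - (1 - k\<^sup>2) sin\<^sup>2 \<theta>\<close> applies.  It reverses the
  orientation, whence the minus signs.
\<close>

lemma ellK'_real:
  assumes k: "0 < k" "k < 1"
  shows "ellK' (of_real k) = paramK (1 - of_real k ^ 2)"
proof -
  let ?f = "\<lambda>\<theta>. 1 / csqrt (1 - (1 - of_real k ^ 2) * of_real (sin \<theta> ^ 2))"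
  let ?g = "\<lambda>l. arcsin (sqrt ((1 - l ^ 2) / (1 - k ^ 2)))"
  have kmod: "of_real k \<in> moduli" using k by (simp add: moduli_def)
  have k2: "1 - k ^ 2 > 0" using k by (simp add: power_less_one_iff)
  have lk: "k ^ 2 \<le> l ^ 2" "l ^ 2 \<le> 1" if "l \<in> {k..1}" for l
    using that k by (auto intro: power_mono power_le_one)
  have u01: "(1 - l ^ 2) / (1 - k ^ 2) \<in> {0..1}" if "l \<in> {k..1}" for l
    using lk[OF that] k2 by simp
  have cont: "continuous_on {0..pi / 2} ?f"
    using moduliD(2)[OF kmod] slit_radicand_nz
    by (intro continuous_intros continuous_on_radicand) auto
  have sub: "((\<lambda>l. (- l / (sqrt (1 - l ^ 2) * sqrt (l ^ 2 - k ^ 2))) *\<^sub>R ?f (?g l)) has_integral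
      (integral {?g k..?g 1} ?f - integral {?g 1..?g k} ?f)) {k..1}"
  proof (rule has_integral_substitution_general[where s = "{k, 1}" and g = ?g])
    show "?g ` {k..1} \<subseteq> {0..pi / 2}"
    proof clarify
      fix l assume "l \<in> {k..1}"
      from u01[OF this] show "?g l \<in> {0..pi / 2}"
        by (intro arcsin_sqrt_range) auto
    qed
    show "continuous_on {k..1} ?g"
      using u01 k2 by (intro continuous_intros) (auto intro: arcsin_sqrt_range)
    fix l assume l: "l \<in> {k..1} - {k, 1}"
    define u where "u = (1 - l ^ 2) / (1 - k ^ 2)"
    have l2: "k ^ 2 < l ^ 2" "l ^ 2 < 1"
      using l k by (auto intro: power_strict_mono simp: power_less_one_iff)
    then have u: "0 < u" "u < 1" using k2 by (auto simp: u_def)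
    have u': "1 - u = (l ^ 2 - k ^ 2) / (1 - k ^ 2)"
      using k2 by (simp add: u_def field_simps)
    have "((\<lambda>l. (1 - l ^ 2) / (1 - k ^ 2)) has_real_derivative - (2 * l) / (1 - k ^ 2)) (at l within {k..1})"
      using k2 by (auto intro!: derivative_eq_intros)
    from DERIV_chain2[OF DERIV_real_sqrt this] u
    have "((\<lambda>l. sqrt ((1 - l ^ 2) / (1 - k ^ 2))) has_real_derivative
       inverse (sqrt u) / 2 * (- (2 * l) / (1 - k ^ 2))) (at l within {k..1})"
      by (simp add: u_def)
    from DERIV_chain2[OF DERIV_arcsin this] u
    have "(?g has_real_derivative inverse (sqrt (1 - u)) * (inverse (sqrt u) / 2 * (- (2 * l) / (1 - k ^ 2)))) (at l within {k..1})"
      by (simp add: u_def arcsin_sqrt_range(3)[of u, unfolded u_def])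
    also have "inverse (sqrt (1 - u)) * (inverse (sqrt u) / 2 * (- (2 * l) / (1 - k ^ 2)))
       = - l / (sqrt (1 - l ^ 2) * sqrt (l ^ 2 - k ^ 2))"
    proof -
      have "sqrt (1 - u) * sqrt u * (1 - k ^ 2) = sqrt (1 - l ^ 2) * sqrt (l ^ 2 - k ^ 2)"
        using k2 unfolding u' by (simp add: u_def real_sqrt_divide field_simps)
      moreover have "inverse a * (inverse b / 2 * (- (2 * l) / c)) = - l / (a * b * c)" for a b c :: real
        by (simp add: field_simps)
      ultimately show ?thesis by simp
    qed
    finally show "(?g has_real_derivative - l / (sqrt (1 - l ^ 2) * sqrt (l ^ 2 - k ^ 2))) (at l within {k..1})" .
  qed (use cont k in auto)
  have ends: "?g k = pi / 2" "?g 1 = 0"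
    using k2 by (simp_all add: arcsin_1 arcsin_0)
  have "integral {?g k..?g 1} ?f - integral {?g 1..?g k} ?f = - paramK (1 - of_real k ^ 2)"
    unfolding ends by (simp add: paramK_def)
  note this = sub[unfolded this]
  from has_integral_neg[OF this]
  have "((\<lambda>l. - ((- l / (sqrt (1 - l ^ 2) * sqrt (l ^ 2 - k ^ 2))) *\<^sub>R ?f (?g l))) has_integral
      paramK (1 - of_real k ^ 2)) {k..1}"
    by simp
  moreover have "- ((- l / (sqrt (1 - l ^ 2) * sqrt (l ^ 2 - k ^ 2))) *\<^sub>R ?f (?g l)) =
      1 / (csqrt (1 - of_real l ^ 2) * csqrt (of_real l ^ 2 - of_real k ^ 2))" if l: "l \<in> {k..1}" for l
  proof -
    have "sin (?g l) ^ 2 = (1 - l ^ 2) / (1 - k ^ 2)"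
      using u01[OF l] by (simp add: sin_arcsin arcsin_sqrt_range(2))
    then have "1 - (1 - k ^ 2) * sin (?g l) ^ 2 = l ^ 2"
      using k2 by (simp only:) simp
    from arg_cong[OF this, of complex_of_real]
    have "1 - (1 - of_real k ^ 2) * of_real (sin (?g l) ^ 2) = (of_real (l ^ 2) :: complex)"
      by simp
    then have f: "?f (?g l) = 1 / of_real l"
      using l k csqrt_of_real[of "l ^ 2"] by (simp only:) simp
    have "csqrt (1 - of_real l ^ 2) = of_real (sqrt (1 - l ^ 2))"
      "csqrt (of_real l ^ 2 - of_real k ^ 2) = of_real (sqrt (l ^ 2 - k ^ 2))"
      using csqrt_of_real[of "1 - l ^ 2"] csqrt_of_real[of "l ^ 2 - k ^ 2"] lk[OF l] by simp_all
    then show ?thesis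
      unfolding f using l k by (simp add: scaleR_conv_of_real)
  qed
  ultimately have "((\<lambda>l. 1 / (csqrt (1 - of_real l ^ 2) * csqrt (of_real l ^ 2 - of_real k ^ 2))) has_integral
      paramK (1 - of_real k ^ 2)) {k..1}"
    by (rule has_integral_eq[rotated]) auto
  then have "((\<lambda>l. 1 / (csqrt (1 - l ^ 2) * csqrt (l ^ 2 - of_real k ^ 2))) has_contour_integral
      paramK (1 - of_real k ^ 2)) (linepath (of_real k) 1)"
    using k by (subst has_contour_integral_linepath_Reals_iff) auto
  then show ?thesis
    unfolding ellK'_def by (rule contour_integral_unique)
qed

section \<open>Derivatives of the elliptic integrals and the Wronskian\<close>

lemma paramK_complementary_deriv:
  assumes "k \<in> moduli"
  shows "((\<lambda>k. paramK (1 - k ^ 2)) has_field_derivative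
      (paramE (1 - k ^ 2) / k ^ 2 - paramK (1 - k ^ 2)) / (2 * (1 - k ^ 2)) * (- 2 * k)) (at k)"
proof -
  have "((\<lambda>k. 1 - k ^ 2) has_field_derivative - 2 * k) (at k)"
    by (auto intro!: derivative_eq_intros)
  from DERIV_chain2[OF paramK_deriv[OF moduliD(2,4)[OF assms]] this]
  show ?thesis by simp
qed

text \<open>
  Both sides are holomorphic on the connected set of moduli and agree on the interval \<open>(0, 1)\<close>.
\<close>

lemma ellK'_eq:
  assumes "k \<in> moduli"
  shows "ellK' k = paramK (1 - k ^ 2)"
proof -
  have "ellK' k - paramK (1 - k ^ 2) = 0"
  proof (rule analytic_continuation[where f = "\<lambda>k. ellK' k - paramK (1 - k ^ 2)"
        and S = moduli and U = "of_real ` {0<..<1}" and \<xi> = "1/2"])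
    have "(\<lambda>k. paramK (1 - k ^ 2)) holomorphic_on moduli"
      using paramK_complementary_deriv
      by (meson field_differentiable_at_within field_differentiable_def holomorphic_on_def)
    then show "(\<lambda>k. ellK' k - paramK (1 - k ^ 2)) holomorphic_on moduli"
      by (intro holomorphic_on_diff ellK'_holomorphic)
    show "(1/2 :: complex) islimpt of_real ` {0<..<1}"
      unfolding islimpt_approachable
    proof (intro allI impI)
      fix e :: real assume "e > 0"
      define x where "x = 1/2 + min (e / 2) (1/4)"
      have x: "0 < x" "x < 1" "x \<noteq> 1/2" "\<bar>x - 1/2\<bar> < e"
        using \<open>e > 0\<close> by (auto simp: x_def min_def)
      have "dist (of_real x) (1/2 :: complex) = \<bar>x - 1/2\<bar>"
        using dist_of_real[of x "1/2", where ?'a = complex] by (simp add: dist_real_def)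
      moreover have "of_real x \<noteq> (1/2 :: complex)"
        using x(3) of_real_eq_iff[of x "1/2", where ?'a = complex] by simp
      ultimately show "\<exists>z\<in>of_real ` {0<..<1}. z \<noteq> 1/2 \<and> dist z (1/2 :: complex) < e"
        using x by (intro bexI[of _ "of_real x"]) auto
    qed
  qed (use assms open_moduli connected_moduli ellK'_real in \<open>auto simp: moduli_def\<close>)
  then show ?thesis by simp
qed

text \<open>
  These are \<open>\<alpha>\<close> and \<open>\<beta>\<close>, the coefficients of \<open>- A I\<close> in \<open>J1\<close> and of \<open>A I\<close> in \<open>J2\<close>.
\<close>

definition coefJ1 :: "complex \<Rightarrow> complex" where
  "coefJ1 k = ellE k + (k ^ 2 - 1) * ellK k"

definition coefJ2 :: "complex \<Rightarrow> complex" where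
  "coefJ2 k = ellE' k - k ^ 2 * ellK' k"

lemma has_field_derivative_on_moduli:
  assumes "k \<in> moduli" "(g has_field_derivative D) (at k)" "\<And>x. x \<in> moduli \<Longrightarrow> f x = g x" "D = D'"
  shows "(f has_field_derivative D') (at k)"
  using has_field_derivative_transform_within_open[OF assms(2) open_moduli assms(1)] assms(3,4) by auto

lemma
  assumes k: "k \<in> moduli"
  shows ellK_deriv: "(ellK has_field_derivative coefJ1 k / (k * (1 - k ^ 2))) (at k)"
    and ellK'_deriv: "(ellK' has_field_derivative - coefJ2 k / (k * (1 - k ^ 2))) (at k)"
    and ellE_deriv: "(ellE has_field_derivative (ellE k - ellK k) / k) (at k)"
    and ellE'_deriv: "(ellE' has_field_derivative k * (ellK' k - ellE' k) / (1 - k ^ 2)) (at k)"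
proof -
  note nz = moduliD(3,4,5)[OF k]
  have k2: "k ^ 2 \<noteq> 0" using nz by simp
  have sq: "((\<lambda>k. k ^ 2) has_field_derivative 2 * k) (at k)"
    by (auto intro!: derivative_eq_intros)
  have sq': "((\<lambda>k. 1 - k ^ 2) has_field_derivative - 2 * k) (at k)"
    by (auto intro!: derivative_eq_intros)
  show "(ellK has_field_derivative coefJ1 k / (k * (1 - k ^ 2))) (at k)"
    by (rule has_field_derivative_on_moduli[OF k DERIV_chain2[OF paramK_deriv[OF moduliD(1)[OF k] k2] sq] ellK_eq])
      (use nz in \<open>simp_all add: coefJ1_def ellK_eq[OF k] ellE_eq[OF k] divide_simps, simp add: power2_eq_square algebra_simps\<close>)
  show "(ellE has_field_derivative (ellE k - ellK k) / k) (at k)"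
    by (rule has_field_derivative_on_moduli[OF k DERIV_chain2[OF paramE_deriv[OF moduliD(1)[OF k] k2] sq] ellE_eq])
      (use nz in \<open>simp_all add: ellK_eq[OF k] ellE_eq[OF k] divide_simps power2_eq_square\<close>)
  show "(ellK' has_field_derivative - coefJ2 k / (k * (1 - k ^ 2))) (at k)"
    by (rule has_field_derivative_on_moduli[OF k paramK_complementary_deriv[OF k] ellK'_eq])
      (use nz in \<open>simp_all add: coefJ2_def ellK'_eq[OF k] ellE'_eq[OF k] divide_simps, simp add: power2_eq_square algebra_simps\<close>)
  show "(ellE' has_field_derivative k * (ellK' k - ellE' k) / (1 - k ^ 2)) (at k)"
    by (rule has_field_derivative_on_moduli[OF k DERIV_chain2[OF paramE_deriv[OF moduliD(2,4)[OF k]] sq'] ellE'_eq])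
      (use nz in \<open>simp_all add: ellK'_eq[OF k] ellE'_eq[OF k] divide_simps, simp add: algebra_simps\<close>)
qed

text \<open>
  Together with \<open>ellK_deriv\<close> and \<open>ellK'_deriv\<close> this says that \<open>(K, \<alpha>)\<close> and \<open>(K', - \<beta>)\<close> solve the same
  first-order linear system, which has trace zero.
\<close>

lemma
  assumes k: "k \<in> moduli"
  shows coefJ1_deriv: "(coefJ1 has_field_derivative k * ellK k) (at k)"
    and coefJ2_deriv: "(coefJ2 has_field_derivative - (k * ellK' k)) (at k)"
proof -
  note nz = moduliD(3,4,5)[OF k]
  have sq: "((\<lambda>k. k ^ 2) has_field_derivative 2 * k) (at k)"
    and sq': "((\<lambda>k. k ^ 2 - 1) has_field_derivative 2 * k) (at k)"
    by (auto intro!: derivative_eq_intros)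
  show "(coefJ1 has_field_derivative k * ellK k) (at k)"
    unfolding coefJ1_def[abs_def]
    by (rule DERIV_cong[OF DERIV_add[OF ellE_deriv[OF k] DERIV_mult[OF sq' ellK_deriv[OF k]]]])
      (use nz in \<open>simp add: coefJ1_def divide_simps\<close>, simp add: power2_eq_square algebra_simps)
  show "(coefJ2 has_field_derivative - (k * ellK' k)) (at k)"
    unfolding coefJ2_def[abs_def]
    by (rule DERIV_cong[OF DERIV_diff[OF ellE'_deriv[OF k] DERIV_mult[OF sq ellK'_deriv[OF k]]]])
      (use nz in \<open>simp add: coefJ2_def divide_simps\<close>, simp add: power2_eq_square algebra_simps)
qed

definition wronskian :: "complex \<Rightarrow> complex" where
  "wronskian k = coefJ1 k * ellK' k + coefJ2 k * ellK k"

text \<open>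
  The integrand \<open>s - (1 - m) / s\<close> is positive inside the interval, because \<open>s\<^sup>2 > 1 - m\<close> there.
\<close>

lemma paramK_pos:
  assumes "0 < m" "m < 1"
  shows "\<exists>c>0. paramK (of_real m) = of_real c"
    and "\<exists>c>0. paramE (of_real m) - (1 - of_real m) * paramK (of_real m) = of_real c"
proof -
  have pos: "1 - m * sin \<theta> ^ 2 > 0" for \<theta> :: real
  proof -
    have "sin \<theta> ^ 2 \<le> 1" by (simp add: abs_square_le_1)
    then have "m * sin \<theta> ^ 2 \<le> m * 1" using assms by (intro mult_left_mono) auto
    then show ?thesis using assms by linarith
  qed
  have root: "csqrt (1 - of_real m * of_real (sin \<theta> ^ 2)) = of_real (sqrt (1 - m * sin \<theta> ^ 2))" for \<theta> :: real
    using csqrt_of_real[of "1 - m * sin \<theta> ^ 2"] pos[of \<theta>] by simp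
  have cont: "continuous_on {0..pi / 2} (\<lambda>\<theta>. sqrt (1 - m * sin \<theta> ^ 2))"
    by (intro continuous_intros)
  have nz: "sqrt (1 - m * sin \<theta> ^ 2) \<noteq> 0" for \<theta>
    using pos[of \<theta>] by simp
  have contK: "continuous_on {0..pi / 2} (\<lambda>\<theta>. 1 / sqrt (1 - m * sin \<theta> ^ 2))"
    by (intro continuous_on_divide cont continuous_on_const) (use nz in auto)
  have K: "paramK (of_real m) = of_real (integral {0..pi / 2} (\<lambda>\<theta>. 1 / sqrt (1 - m * sin \<theta> ^ 2)))"
    using integral_linear[OF integrable_continuous_real[OF contK] bounded_linear_of_real[where ?'a = complex]]
    unfolding paramK_def root by (simp add: o_def)
  have E: "paramE (of_real m) = of_real (integral {0..pi / 2} (\<lambda>\<theta>. sqrt (1 - m * sin \<theta> ^ 2)))"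
    using integral_linear[OF integrable_continuous_real[OF cont] bounded_linear_of_real[where ?'a = complex]]
    unfolding paramE_def root by (simp add: o_def)
  have "0 < integral {0..pi / 2} (\<lambda>\<theta>. 1 / sqrt (1 - m * sin \<theta> ^ 2))"
    using integral_less_real[OF continuous_on_const[of _ 0] contK] pos by (simp add: not_le)
  then show "\<exists>c>0. paramK (of_real m) = of_real c"
    using K by blast
  let ?g = "\<lambda>\<theta>. sqrt (1 - m * sin \<theta> ^ 2) - (1 - m) * (1 / sqrt (1 - m * sin \<theta> ^ 2))"
  have cont_g: "continuous_on {0..pi / 2} ?g"
    by (intro continuous_on_diff continuous_on_mult cont contK continuous_on_const)
  have "0 < integral {0..pi / 2} ?g"
  proof -
    have "0 < ?g \<theta>" if "\<theta> \<in> {0<..<pi / 2}" for \<theta>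
    proof -
      have "cos \<theta> > 0" using that by (intro cos_gt_zero) auto
      then have "sin \<theta> ^ 2 < 1"
        using sin_cos_squared_add[of \<theta>] by (smt (verit) zero_less_power)
      then have "1 - m < 1 - m * sin \<theta> ^ 2"
        using assms by simp
      also have "\<dots> = sqrt (1 - m * sin \<theta> ^ 2) * sqrt (1 - m * sin \<theta> ^ 2)"
        using pos[of \<theta>] by simp
      finally show ?thesis
        using pos[of \<theta>] by (simp add: field_simps)
    qed
    then show ?thesis
      using integral_less_real[OF continuous_on_const[of _ 0] cont_g] by (simp add: not_le)
  qed
  moreover have "integral {0..pi / 2} ?g = integral {0..pi / 2} (\<lambda>\<theta>. sqrt (1 - m * sin \<theta> ^ 2)) -
      (1 - m) * integral {0..pi / 2} (\<lambda>\<theta>. 1 / sqrt (1 - m * sin \<theta> ^ 2))"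
    by (subst integral_diff)
      (intro integrable_continuous_real cont contK continuous_on_mult continuous_on_const,
       intro integrable_continuous_real cont contK continuous_on_mult continuous_on_const,
       simp only: integral_mult_right)
  ultimately show "\<exists>c>0. paramE (of_real m) - (1 - of_real m) * paramK (of_real m) = of_real c"
    unfolding K E by (intro exI[of _ "integral {0..pi / 2} ?g"]) simp
qed

text \<open>
  The Wronskian of a system of trace zero is constant; at \<open>k = 1/2\<close> all four functions in it are
  positive.
\<close>

lemma wronskian_nz:
  assumes "k \<in> moduli"
  shows "wronskian k \<noteq> 0"
proof -
  have der: "(wronskian has_field_derivative 0) (at x)" if x: "x \<in> moduli" for x
    unfolding wronskian_def[abs_def]
    by (rule DERIV_cong[OF DERIV_add[OF DERIV_mult[OF coefJ1_deriv[OF x] ellK'_deriv[OF x]]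
          DERIV_mult[OF coefJ2_deriv[OF x] ellK_deriv[OF x]]]]) simp
  have "continuous_on moduli wronskian"
    using der by (meson DERIV_isCont continuous_at_imp_continuous_on)
  then obtain c where c: "\<And>x. x \<in> moduli \<Longrightarrow> wronskian x = c"
    using DERIV_zero_connected_constant[OF connected_moduli open_moduli finite.emptyI] der by auto
  have half: "1/2 \<in> moduli" by (simp add: moduli_def)
  have q: "(1/2)\<^sup>2 = (of_real (1/4) :: complex)" "1 - (1/2)\<^sup>2 = (of_real (3/4) :: complex)"
    by (simp_all add: power2_eq_square)
  obtain a b a' b' where pos: "a > 0" "b > 0" "a' > 0" "b' > 0"
    and K: "paramK (of_real (1/4)) = of_real a" "paramK (of_real (3/4)) = of_real a'"
    and E: "paramE (of_real (1/4)) - (1 - of_real (1/4)) * paramK (of_real (1/4)) = of_real b"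
      "paramE (of_real (3/4)) - (1 - of_real (3/4)) * paramK (of_real (3/4)) = of_real b'"
    using paramK_pos[of "1/4"] paramK_pos[of "3/4"] by auto
  have "wronskian (1/2) = of_real (b * a' + b' * a)"
  proof -
    have "coefJ1 (1/2) = of_real b"
      unfolding coefJ1_def ellE_eq[OF half] ellK_eq[OF half] q E(1)[symmetric] by (simp add: algebra_simps)
    moreover have "coefJ2 (1/2) = of_real b'"
      unfolding coefJ2_def ellE'_eq[OF half] ellK'_eq[OF half] q E(2)[symmetric] by (simp add: algebra_simps)
    ultimately show ?thesis
      unfolding wronskian_def ellK_eq[OF half] ellK'_eq[OF half] unfolding q(2) unfolding q(1) K
      by (simp only: of_real_add of_real_mult)
  qed
  moreover have "b * a' + b' * a > 0" using pos by (simp add: add_pos_pos)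
  ultimately have "wronskian (1/2) \<noteq> 0" by (metis less_irrefl of_real_eq_0_iff)
  then show ?thesis using c[OF half] c[OF assms] by simp
qed

section \<open>The canonical coordinates of the Lagrangian\<close>

lemma has_derivative_field_component:
  fixes q :: "complex ^ 'n::finite"
  assumes "(g has_field_derivative g') (at (q $ i))"
  shows "((\<lambda>q. g (q $ i)) has_derivative (\<lambda>h. g' * h $ i)) (at q)"
  using has_derivative_compose[OF has_derivative_component, of g "(*) g'"] assms
  by (simp add: has_field_derivative_def)

lemma J1_eq: "J1 q = 4 * ellK (q $ 3) * q $ 2 - coefJ1 (q $ 3) * q $ 1 * q $ 4"
  by (simp add: J1_def coefJ1_def Let_def)

lemma J2_eq: "J2 q = 4 * ellK' (q $ 3) * q $ 2 + coefJ2 (q $ 3) * q $ 1 * q $ 4"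
  by (simp add: J2_def coefJ2_def Let_def)

lemma
  assumes k: "q $ 3 \<in> moduli"
  shows cdiff_J1: "cdiff J1 q"
    and total_deriv_J1: "total_deriv J1 q h = 4 * ellK (q $ 3) * h $ 2
      + 4 * q $ 2 * coefJ1 (q $ 3) * (h $ 3 / (q $ 3 * (1 - q $ 3 ^ 2)))
      - q $ 3 * ellK (q $ 3) * q $ 1 * q $ 4 * h $ 3 - coefJ1 (q $ 3) * (q $ 4 * h $ 1 + q $ 1 * h $ 4)"
proof -
  note c = has_derivative_component[of _ q]
  note K = has_derivative_field_component[OF ellK_deriv[OF k]]
  note C = has_derivative_field_component[OF coefJ1_deriv[OF k]]
  have D: "(J1 has_derivative (\<lambda>h. 4 * ellK (q $ 3) * h $ 2
      + 4 * q $ 2 * coefJ1 (q $ 3) * (h $ 3 / (q $ 3 * (1 - q $ 3 ^ 2)))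
      - q $ 3 * ellK (q $ 3) * q $ 1 * q $ 4 * h $ 3 - coefJ1 (q $ 3) * (q $ 4 * h $ 1 + q $ 1 * h $ 4))) (at q)"
    unfolding J1_eq[abs_def]
    by (rule has_derivative_eq_rhs[OF has_derivative_diff[OF
          has_derivative_mult[OF has_derivative_mult[OF has_derivative_const K] c]
          has_derivative_mult[OF has_derivative_mult[OF C c] c]]])
      (simp add: fun_eq_iff algebra_simps)
  note tot = total_derivI[OF D]
  show "cdiff J1 q" by (rule tot(2)) (simp add: algebra_simps)
  show "total_deriv J1 q h = 4 * ellK (q $ 3) * h $ 2
      + 4 * q $ 2 * coefJ1 (q $ 3) * (h $ 3 / (q $ 3 * (1 - q $ 3 ^ 2)))
      - q $ 3 * ellK (q $ 3) * q $ 1 * q $ 4 * h $ 3 - coefJ1 (q $ 3) * (q $ 4 * h $ 1 + q $ 1 * h $ 4)"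
    by (subst tot(1)) (simp_all add: algebra_simps)
qed

lemma
  assumes k: "q $ 3 \<in> moduli"
  shows cdiff_J2: "cdiff J2 q"
    and total_deriv_J2: "total_deriv J2 q h = 4 * ellK' (q $ 3) * h $ 2
      - 4 * q $ 2 * coefJ2 (q $ 3) * (h $ 3 / (q $ 3 * (1 - q $ 3 ^ 2)))
      - q $ 3 * ellK' (q $ 3) * q $ 1 * q $ 4 * h $ 3 + coefJ2 (q $ 3) * (q $ 4 * h $ 1 + q $ 1 * h $ 4)"
proof -
  note c = has_derivative_component[of _ q]
  note K = has_derivative_field_component[OF ellK'_deriv[OF k]]
  note C = has_derivative_field_component[OF coefJ2_deriv[OF k]]
  have D: "(J2 has_derivative (\<lambda>h. 4 * ellK' (q $ 3) * h $ 2
      - 4 * q $ 2 * coefJ2 (q $ 3) * (h $ 3 / (q $ 3 * (1 - q $ 3 ^ 2)))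
      - q $ 3 * ellK' (q $ 3) * q $ 1 * q $ 4 * h $ 3 + coefJ2 (q $ 3) * (q $ 4 * h $ 1 + q $ 1 * h $ 4))) (at q)"
    unfolding J2_eq[abs_def]
    by (rule has_derivative_eq_rhs[OF has_derivative_add[OF
          has_derivative_mult[OF has_derivative_mult[OF has_derivative_const K] c]
          has_derivative_mult[OF has_derivative_mult[OF C c] c]]])
      (simp add: fun_eq_iff algebra_simps)
  note tot = total_derivI[OF D]
  show "cdiff J2 q" by (rule tot(2)) (simp add: algebra_simps)
  show "total_deriv J2 q h = 4 * ellK' (q $ 3) * h $ 2
      - 4 * q $ 2 * coefJ2 (q $ 3) * (h $ 3 / (q $ 3 * (1 - q $ 3 ^ 2)))
      - q $ 3 * ellK' (q $ 3) * q $ 1 * q $ 4 * h $ 3 + coefJ2 (q $ 3) * (q $ 4 * h $ 1 + q $ 1 * h $ 4)"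
    by (subst tot(1)) (simp_all add: algebra_simps)
qed

lemma domain_LD:
  assumes "q \<in> domain_L"
  shows "q $ 1 \<noteq> 0" "q $ 3 \<in> moduli" "q $ 4 \<noteq> 0" "J1 q \<noteq> 0" "q $ 3 \<noteq> 0" "1 - q $ 3 ^ 2 \<noteq> 0" "q $ 3 ^ 2 - 1 \<noteq> 0"
  using assms moduliD[of "q $ 3"] by (auto simp: domain_L_def)

lemma open_domain_L: "open domain_L"
proof -
  let ?M = "{q :: complex ^ 4. q $ 3 \<in> moduli}"
  have "open ((\<lambda>q :: complex ^ 4. q $ 3) -` moduli)"
    by (intro open_vimage open_moduli continuous_intros)
  then have M: "open ?M" by (simp add: vimage_def)
  have "continuous_on ?M J1"
    by (rule continuous_on_cdiff) (simp add: cdiff_J1)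
  then have 1: "open (?M \<inter> J1 -` (- {0}))"
    by (intro continuous_open_preimage M) auto
  have 2: "open ((\<lambda>q :: complex ^ 4. q $ 1) -` (- {0}))" "open ((\<lambda>q :: complex ^ 4. q $ 4) -` (- {0}))"
    by (intro open_vimage continuous_intros; simp)+
  have "open ((?M \<inter> J1 -` (- {0})) \<inter> ((\<lambda>q. q $ 1) -` (- {0}) \<inter> (\<lambda>q. q $ 4) -` (- {0})))"
    by (rule open_Int[OF 1 open_Int[OF 2]])
  also have "\<dots> = domain_L" by (auto simp: domain_L_def)
  finally show ?thesis .
qed

lemma
  assumes q: "q \<in> domain_L"
  shows cdiff_calN: "cdiff calN q"
    and total_deriv_calN: "total_deriv calN q h =
      2 * (ellK (q $ 3) * h $ 1 - coefJ1 (q $ 3) * q $ 1 * (h $ 3 / (q $ 3 * (1 - q $ 3 ^ 2)))) / (q $ 1 ^ 2 * J1 q)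
      + 2 * ellK (q $ 3) * total_deriv J1 q h / (q $ 1 * J1 q ^ 2)"
proof -
  note nz = domain_LD[OF q]
  note c = has_derivative_component[of _ q]
  note K = has_derivative_field_component[OF ellK_deriv[OF nz(2)]]
  have D: "(calN has_derivative (\<lambda>h. 
      2 * (ellK (q $ 3) * h $ 1 - coefJ1 (q $ 3) * q $ 1 * (h $ 3 / (q $ 3 * (1 - q $ 3 ^ 2)))) / (q $ 1 ^ 2 * J1 q)
      + 2 * ellK (q $ 3) * total_deriv J1 q h / (q $ 1 * J1 q ^ 2))) (at q)"
    unfolding calN_def[abs_def]
  proof (rule has_derivative_eq_rhs[OF has_derivative_minus[OF has_derivative_divide'[OF 
          has_derivative_mult[OF has_derivative_const K]
          has_derivative_mult[OF c cdiffD[OF cdiff_J1[OF nz(2)]]]]]])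
    show "q $ 1 * J1 q \<noteq> 0" using nz by simp
    have alg: "- (((2 * (\<alpha> / D * d) + 0 * x) * (A * J) - 2 * x * (A * t + a * J)) / (A * J * (A * J)))
      = 2 * (x * a - \<alpha> * A * (d / D)) / (A ^ 2 * J) + 2 * x * t / (A * J ^ 2)"
      if "A \<noteq> 0" "J \<noteq> 0" for x A J d D \<alpha> a t :: complex
    proof -
      define m where "m = \<alpha> / D * d"
      have "\<alpha> * A * (d / D) = A * m" by (simp add: m_def)
      then show ?thesis
        unfolding m_def[symmetric] using that
        by (simp only:) (simp add: divide_simps, simp add: algebra_simps power2_eq_square)
    qed
    show "(\<lambda>h. - (((2 * (coefJ1 (q $ 3) / (q $ 3 * (1 - (q $ 3)\<^sup>2)) * h $ 3) + 0 * ellK (q $ 3)) * (q $ 1 * J1 q) -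
          2 * ellK (q $ 3) * (q $ 1 * total_deriv J1 q h + h $ 1 * J1 q)) / (q $ 1 * J1 q * (q $ 1 * J1 q)))) =
     (\<lambda>h. 2 * (ellK (q $ 3) * h $ 1 - coefJ1 (q $ 3) * q $ 1 * (h $ 3 / (q $ 3 * (1 - q $ 3 ^ 2)))) / (q $ 1 ^ 2 * J1 q)
      + 2 * ellK (q $ 3) * total_deriv J1 q h / (q $ 1 * J1 q ^ 2))"
      by (intro ext alg nz)
  qed
  note tot = total_derivI[OF D]
  show "cdiff calN q" by (rule tot(2)) (simp add: total_deriv_scale algebra_simps add_divide_distrib diff_divide_distrib)
  show "total_deriv calN q h = 
      2 * (ellK (q $ 3) * h $ 1 - coefJ1 (q $ 3) * q $ 1 * (h $ 3 / (q $ 3 * (1 - q $ 3 ^ 2)))) / (q $ 1 ^ 2 * J1 q)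
      + 2 * ellK (q $ 3) * total_deriv J1 q h / (q $ 1 * J1 q ^ 2)"
    by (subst tot(1)) (simp_all add: total_deriv_scale algebra_simps add_divide_distrib diff_divide_distrib)
qed

text \<open>
  Eight times its total derivative is subtracted in the Lagrangian; this cancels the velocity of \<open>B\<close>.
\<close>

definition boundary_term :: "complex ^ 4 \<Rightarrow> complex" where
  "boundary_term q = q $ 2 / q $ 1 * ellK (q $ 3) ^ 2"

lemma
  assumes q: "q \<in> domain_L"
  shows cdiff_boundary_term: "cdiff boundary_term q"
    and total_deriv_boundary_term: "total_deriv boundary_term q h = ellK (q $ 3) ^ 2 * (h $ 2 / q $ 1 - q $ 2 * h $ 1 / q $ 1 ^ 2)
      + 2 * q $ 2 / q $ 1 * ellK (q $ 3) * coefJ1 (q $ 3) * (h $ 3 / (q $ 3 * (1 - q $ 3 ^ 2)))"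
proof -
  note nz = domain_LD[OF q]
  note c = has_derivative_component[of _ q]
  note K = has_derivative_field_component[OF ellK_deriv[OF nz(2)]]
  have D: "(boundary_term has_derivative (\<lambda>h. ellK (q $ 3) ^ 2 * (h $ 2 / q $ 1 - q $ 2 * h $ 1 / q $ 1 ^ 2)
      + 2 * q $ 2 / q $ 1 * ellK (q $ 3) * coefJ1 (q $ 3) * (h $ 3 / (q $ 3 * (1 - q $ 3 ^ 2))))) (at q)"
    unfolding boundary_term_def[abs_def] power2_eq_square[of "ellK _"]
  proof (rule has_derivative_eq_rhs[OF has_derivative_mult[OF has_derivative_divide'[OF c c nz(1)] has_derivative_mult[OF K K]]])
    have alg: "B / A * (x * (\<alpha> / D * d) + \<alpha> / D * d * x) + (b * A - B * a) / (A * A) * (x * x)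
        = x * x * (b / A - B * a / A ^ 2) + 2 * B / A * x * \<alpha> * (d / D)" if "A \<noteq> 0" for A B D \<alpha> a b d x :: complex
    proof -
      define m where "m = \<alpha> / D * d"
      have "2 * B / A * x * \<alpha> * (d / D) = 2 * B / A * x * m" by (simp add: m_def)
      then show ?thesis
        unfolding m_def[symmetric] using that
        by (simp only:) (simp add: divide_simps, simp add: algebra_simps power2_eq_square)
    qed
    show "(\<lambda>h. q $ 2 / q $ 1 *
         (ellK (q $ 3) * (coefJ1 (q $ 3) / (q $ 3 * (1 - (q $ 3)\<^sup>2)) * h $ 3) +
          coefJ1 (q $ 3) / (q $ 3 * (1 - (q $ 3)\<^sup>2)) * h $ 3 * ellK (q $ 3)) +
         (h $ 2 * q $ 1 - q $ 2 * h $ 1) / (q $ 1 * q $ 1) * (ellK (q $ 3) * ellK (q $ 3))) =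
      (\<lambda>h. ellK (q $ 3) * ellK (q $ 3) * (h $ 2 / q $ 1 - q $ 2 * h $ 1 / q $ 1 ^ 2)
      + 2 * q $ 2 / q $ 1 * ellK (q $ 3) * coefJ1 (q $ 3) * (h $ 3 / (q $ 3 * (1 - q $ 3 ^ 2))))"
      by (intro ext alg nz)
  qed
  note tot = total_derivI[OF D]
  show "cdiff boundary_term q" by (rule tot(2)) (simp add: algebra_simps)
  show "total_deriv boundary_term q h = ellK (q $ 3) ^ 2 * (h $ 2 / q $ 1 - q $ 2 * h $ 1 / q $ 1 ^ 2)
      + 2 * q $ 2 / q $ 1 * ellK (q $ 3) * coefJ1 (q $ 3) * (h $ 3 / (q $ 3 * (1 - q $ 3 ^ 2)))"
    by (subst tot(1)) (simp_all add: algebra_simps)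
qed

lemma lagrangian_canonical:
  "lagrangian q v = J1 q ^ 2 * (total_deriv calN q v - 1) + J2 q * total_deriv (\<lambda>q. q $ 4) q v
     + (- 8) * total_deriv boundary_term q v"
  by (simp add: lagrangian_def boundary_term_def[abs_def] total_deriv_component)

text \<open>
  The first claim of the theorem as a rational identity.  Here \<open>\<alpha>\<close> is eliminated by
  \<open>\<alpha> A I = 4 K B - J\<close>, which factors \<open>16 B\<^sup>2 K\<^sup>2 - J\<^sup>2\<close>; \<open>a, b, d, i\<close> are the velocities of
  \<open>A, B, k, I\<close>.
\<close>

lemma lagrangian_coefficients:
  fixes A B k I J K \<alpha> M a b d i :: complex
  assumes nz: "A \<noteq> 0" "I \<noteq> 0" "k \<noteq> 0" "1 - k ^ 2 \<noteq> 0" "J \<noteq> 0" and J: "J = 4 * K * B - \<alpha> * A * I"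
  shows "J ^ 2 * (2 * (K * a - \<alpha> * A * (d / (k * (1 - k ^ 2)))) / (A ^ 2 * J)
        + 2 * K * (4 * K * b + 4 * B * \<alpha> * (d / (k * (1 - k ^ 2))) - k * K * A * I * d - \<alpha> * (I * a + A * i)) / (A * J ^ 2) - 1)
      + M * i - 8 * (K ^ 2 * (b / A - B * a / A ^ 2) + 2 * B / A * K * \<alpha> * (d / (k * (1 - k ^ 2))))
    = 4 * (J * K / A ^ 2) * a - 2 * (k * I * K ^ 2 + (J ^ 2 - 16 * B ^ 2 * K ^ 2) / (k * (k ^ 2 - 1) * I * A ^ 2)) * d
      + (M + 2 * K / (A * I) * (J - 4 * B * K)) * i - J ^ 2"
proof -
  define m where "m = d / (k * (1 - k ^ 2))"
  have "(J ^ 2 - 16 * B ^ 2 * K ^ 2) / (k * (k ^ 2 - 1) * I * A ^ 2) * d = (16 * B ^ 2 * K ^ 2 - J ^ 2) / (I * A ^ 2) * m"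
  proof -
    have "k * (k ^ 2 - 1) = - (k * (1 - k ^ 2))" by (simp add: algebra_simps)
    then show ?thesis
      using nz unfolding m_def by (simp add: divide_simps) (simp add: algebra_simps)
  qed
  also have "16 * B ^ 2 * K ^ 2 - J ^ 2 = \<alpha> * A * I * (J + 4 * B * K)"
    unfolding J by (simp add: algebra_simps power2_eq_square)
  finally have 1: "(J ^ 2 - 16 * B ^ 2 * K ^ 2) / (k * (k ^ 2 - 1) * I * A ^ 2) * d = \<alpha> * (J + 4 * B * K) / A * m"
    using nz by (simp add: power2_eq_square)
  have 2: "2 * K / (A * I) * (J - 4 * B * K) = - 2 * K * \<alpha>"
    using nz unfolding J by (simp add: field_simps)
  have "J ^ 2 * (2 * (K * a - \<alpha> * A * m) / (A ^ 2 * J)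
        + 2 * K * (4 * K * b + 4 * B * \<alpha> * m - k * K * A * I * d - \<alpha> * (I * a + A * i)) / (A * J ^ 2) - 1)
      = 2 * J * (K * a - \<alpha> * A * m) / A ^ 2
        + 2 * K * (4 * K * b + 4 * B * \<alpha> * m - k * K * A * I * d - \<alpha> * (I * a + A * i)) / A - J ^ 2"
    using nz by (simp add: divide_simps) (simp add: algebra_simps power2_eq_square)
  also have "\<dots> + M * i - 8 * (K ^ 2 * (b / A - B * a / A ^ 2) + 2 * B / A * K * \<alpha> * m)
    = 4 * (J * K / A ^ 2) * a - 2 * (k * I * K ^ 2 * d + \<alpha> * (J + 4 * B * K) / A * m) + (M - 2 * K * \<alpha>) * i - J ^ 2"
  proof -
    have "2 * J * K * a / A ^ 2 - 2 * K * \<alpha> * I * a / A + 8 * K ^ 2 * B * a / A ^ 2 = 4 * (J * K / A ^ 2) * a"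
      using nz(1) unfolding J by (simp add: divide_simps) (simp add: algebra_simps power2_eq_square)
    then show ?thesis
      using nz(1) by (simp add: divide_simps) (simp add: algebra_simps power2_eq_square)
  qed
  also have "\<dots> = 4 * (J * K / A ^ 2) * a - 2 * (k * I * K ^ 2 + (J ^ 2 - 16 * B ^ 2 * K ^ 2) / (k * (k ^ 2 - 1) * I * A ^ 2)) * d
      + (M + 2 * K / (A * I) * (J - 4 * B * K)) * i - J ^ 2"
    unfolding 2 1[symmetric] by (simp only: mult.assoc distrib_right) (simp add: left_diff_distrib mult.assoc)
  finally show ?thesis
    unfolding m_def .
qed

text \<open>
  Let \<open>m = dk / (k (1 - k\<^sup>2))\<close>.  Since \<open>N\<close> is \<open>- 2 K / (A J1)\<close>, \<open>dN = dJ1 = 0\<close> gives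
  \<open>K dA = \<alpha> A m\<close>.  Eliminating \<open>dB\<close> between \<open>dJ1 = 0\<close> and \<open>dJ2 = 0\<close> gives \<open>I dA = 4 B m\<close>, because
  the Wronskian does not vanish.  The two relations combine to \<open>J1 m = 0\<close>, so \<open>m\<close> and
  then everything else vanishes.
\<close>

lemma canonical_coordinates_injective:
  assumes q: "q \<in> domain_L"
    and "total_deriv J1 q h = 0" "total_deriv calN q h = 0" "total_deriv J2 q h = 0" "h $ 4 = 0"
  shows "h = 0"
proof -
  note nz = domain_LD[OF q]
  define A B k I where "A = q $ 1" and "B = q $ 2" and "k = q $ 3" and "I = q $ 4"
  define K K' \<alpha> \<beta> where "K = ellK k" and "K' = ellK' k" and "\<alpha> = coefJ1 k" and "\<beta> = coefJ2 k"
  note defs = A_def B_def k_def I_def K_def K'_def \<alpha>_def \<beta>_def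
  define m where "m = h $ 3 / (k * (1 - k ^ 2))"
  have h3: "h $ 3 = m * (k * (1 - k ^ 2))" using nz by (simp add: m_def k_def)
  have W: "\<alpha> * K' + \<beta> * K \<noteq> 0" using wronskian_nz[OF nz(2)] by (simp add: wronskian_def defs)
  have e1: "4 * K * h $ 2 + 4 * B * \<alpha> * m - k * K * A * I * h $ 3 - \<alpha> * (I * h $ 1) = 0"
    using assms(2) unfolding total_deriv_J1[OF nz(2)] by (simp add: assms(5) defs m_def)
  have e2: "4 * K' * h $ 2 - 4 * B * \<beta> * m - k * K' * A * I * h $ 3 + \<beta> * (I * h $ 1) = 0"
    using assms(4) unfolding total_deriv_J2[OF nz(2)] by (simp add: assms(5) defs m_def)
  have e3: "K * h $ 1 = \<alpha> * A * m"
  proof -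
    have "2 * (K * h $ 1 - \<alpha> * A * m) / (A ^ 2 * J1 q) = 0"
      using assms(3) unfolding total_deriv_calN[OF q] assms(2) by (simp only: defs m_def) simp
    then show ?thesis using nz by (simp add: A_def)
  qed
  have "(\<alpha> * K' + \<beta> * K) * (4 * B * m - I * h $ 1) =
      K' * (4 * K * h $ 2 + 4 * B * \<alpha> * m - k * K * A * I * h $ 3 - \<alpha> * (I * h $ 1))
      - K * (4 * K' * h $ 2 - 4 * B * \<beta> * m - k * K' * A * I * h $ 3 + \<beta> * (I * h $ 1))"
    by (simp add: algebra_simps)
  then have e4: "I * h $ 1 = 4 * B * m"
    unfolding e1 e2 using W by simp
  have "J1 q * m = K * (4 * B * m) - I * (\<alpha> * A * m)"
    unfolding J1_eq by (simp add: defs algebra_simps)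
  also have "\<dots> = 0" unfolding e4[symmetric] e3[symmetric] by simp
  finally have "m = 0" using nz by simp
  then have z: "h $ 3 = 0" "h $ 1 = 0"
    using e4 nz by (auto simp: h3 I_def)
  then have "K * h $ 2 = 0" "K' * h $ 2 = 0"
    using e1 e2 \<open>m = 0\<close> by auto
  then have "h $ 2 = 0" using W by auto
  then show ?thesis
    using z assms(5) by (simp add: vec_eq_iff forall_4)
qed

text \<open>
  System (i) is the coordinate vector field of \<open>N\<close> in the coordinates \<open>(J1, N, J2, I)\<close>.
\<close>

lemma canonical_flow:
  assumes q: "q \<in> domain_L"
  shows "total_deriv J1 q (system_ABkI q) = 0" "total_deriv calN q (system_ABkI q) = 1"
    "total_deriv J2 q (system_ABkI q) = 0" "system_ABkI q $ 4 = 0"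
proof -
  note nz = domain_LD[OF q]
  define A B k I where "A = q $ 1" and "B = q $ 2" and "k = q $ 3" and "I = q $ 4"
  note defs = A_def B_def k_def I_def
  have F: "system_ABkI q $ 1 = 2 * A ^ 2 * B" "system_ABkI q $ 2 = 1 / 8 * I ^ 2 * k ^ 2 * (1 - k ^ 2) * A ^ 3"
    "system_ABkI q $ 3 = 1 / 2 * I * k * (1 - k ^ 2) * A ^ 2" "system_ABkI q $ 4 = 0"
    by (simp_all add: system_ABkI_def Let_def defs)
  then show "system_ABkI q $ 4 = 0" by simp
  have m: "system_ABkI q $ 3 / (k * (1 - k ^ 2)) = 1 / 2 * I * A ^ 2"
  proof -
    have "system_ABkI q $ 3 = 1 / 2 * I * A ^ 2 * (k * (1 - k ^ 2))"
      unfolding F by (simp only: ac_simps)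
    moreover have "k * (1 - k ^ 2) \<noteq> 0" using nz by (simp add: k_def)
    ultimately show ?thesis by (subst nonzero_divide_eq_eq)
  qed
  show J1: "total_deriv J1 q (system_ABkI q) = 0"
    unfolding total_deriv_J1[OF nz(2)] defs[symmetric] m unfolding F
    by (simp add: field_simps power2_eq_square power3_eq_cube)
  show "total_deriv J2 q (system_ABkI q) = 0"
    unfolding total_deriv_J2[OF nz(2)] defs[symmetric] m unfolding F
    by (simp add: field_simps power2_eq_square power3_eq_cube)
  have "2 * (ellK k * (2 * A ^ 2 * B) - coefJ1 k * A * (1 / 2 * I * A ^ 2)) = A ^ 2 * J1 q"
    unfolding J1_eq defs[symmetric] by (simp add: algebra_simps power2_eq_square)
  then show "total_deriv calN q (system_ABkI q) = 1"
    unfolding total_deriv_calN[OF q] J1 defs[symmetric] m unfolding F using nz by (simp add: A_def)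
qed

lemma canonical_iff_system:
  assumes "q \<in> domain_L"
  shows "total_deriv J1 q v = 0 \<and> total_deriv calN q v = 1 \<and> total_deriv J2 q v = 0 \<and> v $ 4 = 0
    \<longleftrightarrow> v = system_ABkI q"
proof
  assume "total_deriv J1 q v = 0 \<and> total_deriv calN q v = 1 \<and> total_deriv J2 q v = 0 \<and> v $ 4 = 0"
  then have "v - system_ABkI q = 0"
    by (intro canonical_coordinates_injective[OF assms]) (simp_all add: total_deriv_diff canonical_flow[OF assms])
  then show "v = system_ABkI q" by simp
qed (simp add: canonical_flow[OF assms])

lemma EL_system_ABkI: "EL_system lagrangian domain_L system_ABkI"
  unfolding EL_system_def
proof (intro allI impI)
  fix T X X' assume X: "curve domain_L T X X'"
  have "euler_lagrange lagrangian T X X' \<longleftrightarrow> (\<forall>\<tau>\<in>T. total_deriv J1 (X \<tau>) (X' \<tau>) = 0 \<and>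
    total_deriv calN (X \<tau>) (X' \<tau>) = 1 \<and> total_deriv J2 (X \<tau>) (X' \<tau>) = 0 \<and> total_deriv (\<lambda>q. q $ 4) (X \<tau>) (X' \<tau>) = 0)"
    by (rule euler_lagrange_canonical[OF open_domain_L _ _ _ _ _ _ _ _ X, where f = boundary_term and c = "- 8"])
      (auto simp: cdiff_J1 cdiff_J2 cdiff_calN cdiff_component cdiff_boundary_term domain_LD lagrangian_canonical
        total_deriv_component intro: canonical_coordinates_injective)
  also have "\<dots> \<longleftrightarrow> (\<forall>\<tau>\<in>T. X' \<tau> = system_ABkI (X \<tau>))"
    using X unfolding curve_def total_deriv_component by (intro ball_cong refl canonical_iff_system) auto
  finally show "euler_lagrange lagrangian T X X' \<longleftrightarrow> (\<forall>\<tau>\<in>T. X' \<tau> = system_ABkI (X \<tau>))" .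
qed

section \<open>Substitutions\<close>

text \<open>
  Let the new variables \<open>y\<close> be given by \<open>y\<^sub>i\<^sup>e = \<Psi>\<^sub>i q\<close> with powers \<open>e\<close> of the \<open>y\<^sub>i\<close>, where \<open>\<Psi>\<close> has
  injective differential and the derivative of \<open>y\<^sub>i\<^sup>e\<close> does not vanish.  Differentiating the relation shows
  that the velocities determine each other, and that \<open>flow\<close> identifies the two vector fields.
  Substituting into the Lagrangian by a branch \<open>\<Phi>\<close> of \<open>q\<close> composes \<open>J1, N, J2, I\<close> with \<open>\<Phi>\<close>; the
  differential of \<open>\<Phi>\<close> is injective because \<open>\<Psi>\<^sub>i (\<Phi> y) = y\<^sub>i\<^sup>e\<close>, so the compositions still have
  independent differentials and their canonical equations are those of the curve \<open>\<Phi> (Y \<tau>)\<close>.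
\<close>

lemma EL_system_after_coordinates:
  fixes \<Psi> :: "4 \<Rightarrow> complex ^ 4 \<Rightarrow> complex" and e :: "4 \<Rightarrow> nat"
  assumes \<Psi>: "\<And>q i. q \<in> domain_L \<Longrightarrow> cdiff (\<Psi> i) q"
    and R: "\<And>q y i. q \<in> domain_L \<Longrightarrow> R q y \<Longrightarrow> y $ i ^ e i = \<Psi> i q"
    and nz: "\<And>q y i. q \<in> domain_L \<Longrightarrow> R q y \<Longrightarrow> of_nat (e i) * y $ i ^ (e i - 1) \<noteq> 0"
    and inj: "\<And>q h. q \<in> domain_L \<Longrightarrow> (\<And>i. total_deriv (\<Psi> i) q h = 0) \<Longrightarrow> h = 0"
    and flow: "\<And>q y i. q \<in> domain_L \<Longrightarrow> R q y \<Longrightarrow>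
      total_deriv (\<Psi> i) q (system_ABkI q) = of_nat (e i) * y $ i ^ (e i - 1) * G y $ i"
    and branch: "\<And>V \<Phi> y i. open V \<Longrightarrow> continuous_on V \<Phi> \<Longrightarrow>
      (\<And>y. y \<in> V \<Longrightarrow> \<Phi> y \<in> domain_L) \<Longrightarrow> (\<And>y. y \<in> V \<Longrightarrow> R (\<Phi> y) y) \<Longrightarrow> y \<in> V \<Longrightarrow> cdiff (\<lambda>y. \<Phi> y $ i) y"
  shows "EL_system_after R lagrangian domain_L G"
proof -
  have transfer: "v = system_ABkI q \<longleftrightarrow> w = G y"
    if q: "q \<in> domain_L" "R q y" and vw: "\<And>i. total_deriv (\<Psi> i) q v = of_nat (e i) * y $ i ^ (e i - 1) * w $ i"
    for q y v w
  proof
    assume "v = system_ABkI q"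
    then have "of_nat (e i) * y $ i ^ (e i - 1) * w $ i = of_nat (e i) * y $ i ^ (e i - 1) * G y $ i" for i
      using vw[of i] flow[OF q, of i] by metis
    then have "w $ i = G y $ i" for i
      using nz[OF q, of i] by (metis mult_left_cancel)
    then show "w = G y" by (simp add: vec_eq_iff)
  next
    assume "w = G y"
    then have "total_deriv (\<Psi> i) q (v - system_ABkI q) = 0" for i
      by (simp only: total_deriv_diff vw flow[OF q]) simp
    from inj[OF q(1) this] show "v = system_ABkI q" by simp
  qed
  have power_deriv: "cdiff (\<lambda>y. y $ i ^ e i) y"
    "total_deriv (\<lambda>y. y $ i ^ e i) y w = of_nat (e i) * y $ i ^ (e i - 1) * w $ i" for i and y w :: "complex ^ 4"
  proof -
    have "((\<lambda>z. z ^ e i) has_field_derivative of_nat (e i) * (y $ i) ^ (e i - 1)) (at (y $ i))"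
      by (auto intro!: derivative_eq_intros)
    note power = cdiff_compose_field[OF this cdiff_component]
    show "cdiff (\<lambda>y. y $ i ^ e i) y"
      "total_deriv (\<lambda>y. y $ i ^ e i) y w = of_nat (e i) * y $ i ^ (e i - 1) * w $ i"
      using power by (simp_all add: total_deriv_component)
  qed
  show ?thesis
    unfolding EL_system_after_def
  proof (intro conjI allI impI; elim conjE)
    fix T X X' and Y Y' :: "complex \<Rightarrow> complex ^ 4"
    assume X: "curve domain_L T X X'" and Y: "curve UNIV T Y Y'" and XY: "\<forall>\<tau>\<in>T. R (X \<tau>) (Y \<tau>)"
    have "X' \<tau> = system_ABkI (X \<tau>) \<longleftrightarrow> Y' \<tau> = G (Y \<tau>)" if \<tau>: "\<tau> \<in> T" for \<tau>
    proof (rule transfer)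
      show q: "X \<tau> \<in> domain_L" "R (X \<tau>) (Y \<tau>)" using X XY \<tau> by (auto simp: curve_def)
      fix i
      have "((\<lambda>t. \<Psi> i (X t)) has_field_derivative total_deriv (\<Psi> i) (X \<tau>) (X' \<tau>)) (at \<tau> within T)"
        using X \<tau> by (intro cdiff_along_curve \<Psi>) (auto simp: curve_def)
      moreover have "((\<lambda>t. \<Psi> i (X t)) has_field_derivative total_deriv (\<lambda>y. y $ i ^ e i) (Y \<tau>) (Y' \<tau>)) (at \<tau> within T)"
      proof (rule has_field_derivative_transform_within[OF _ zero_less_one \<tau>])
        show "((\<lambda>t. Y t $ i ^ e i) has_field_derivative total_deriv (\<lambda>y. y $ i ^ e i) (Y \<tau>) (Y' \<tau>)) (at \<tau> within T)"
          using Y \<tau> power_deriv(1) by (intro cdiff_along_curve[where f = "\<lambda>y. y $ i ^ e i"]) (auto simp: curve_def)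
        show "Y t $ i ^ e i = \<Psi> i (X t)" if "t \<in> T" for t
          using R[of "X t" "Y t" i] X XY that by (auto simp: curve_def)
      qed
      ultimately show "total_deriv (\<Psi> i) (X \<tau>) (X' \<tau>) = of_nat (e i) * Y \<tau> $ i ^ (e i - 1) * Y' \<tau> $ i"
        unfolding power_deriv(2)[symmetric] using X \<tau>
        by (intro has_field_derivative_unique) (auto simp: curve_def trivial_limit_within)
    qed
    moreover have "euler_lagrange lagrangian T X X' \<longleftrightarrow> (\<forall>\<tau>\<in>T. X' \<tau> = system_ABkI (X \<tau>))"
      using EL_system_ABkI X unfolding EL_system_def by blast
    ultimately show "euler_lagrange lagrangian T X X' \<longleftrightarrow> (\<forall>\<tau>\<in>T. Y' \<tau> = G (Y \<tau>))"
      by simp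
  next
    fix V :: "(complex ^ 4) set" and \<Phi>
    assume V: "open V" and cont: "continuous_on V \<Phi>" and \<Phi>: "\<forall>y\<in>V. \<Phi> y \<in> domain_L \<and> R (\<Phi> y) y"
    have dom: "\<Phi> y \<in> domain_L" and rel: "R (\<Phi> y) y" if "y \<in> V" for y using \<Phi> that by auto
    have cd: "cdiff (\<lambda>y. \<Phi> y $ i) y" if "y \<in> V" for y i
      by (rule branch[OF V cont dom rel that])
    define D where "D y w = (\<chi> i. total_deriv (\<lambda>y. \<Phi> y $ i) y w)" for y w
    have chain: "cdiff (\<lambda>y. g (\<Phi> y)) y" "total_deriv (\<lambda>y. g (\<Phi> y)) y w = total_deriv g (\<Phi> y) (D y w)"
      if "cdiff g (\<Phi> y)" "y \<in> V" for g y w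
      using cdiff_chain[where \<Phi> = \<Phi>, OF that(1) cd[OF that(2)]] unfolding D_def by auto
    have \<Psi>D: "total_deriv (\<Psi> i) (\<Phi> y) (D y w) = of_nat (e i) * y $ i ^ (e i - 1) * w $ i" if y: "y \<in> V" for i y w
    proof -
      have "total_deriv (\<lambda>y. \<Psi> i (\<Phi> y)) y = total_deriv (\<lambda>y. y $ i ^ e i) y"
        by (rule cdiff_cong(2)[OF V y _ power_deriv(1)]) (simp add: R[OF dom rel])
      then show ?thesis
        using chain(2)[OF \<Psi>[OF dom[OF y]] y] power_deriv(2) by metis
    qed
    have D_inj: "w = 0" if y: "y \<in> V" and "D y w = 0" for y w
    proof -
      have "of_nat (e i) * y $ i ^ (e i - 1) * w $ i = 0" for i
        using \<Psi>D[OF y, of i w] that(2) by simp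
      then have "w $ i = 0" for i
        using nz[OF dom[OF y] rel[OF y], of i] by (metis mult_eq_0_iff)
      then show ?thesis by (simp add: vec_eq_iff)
    qed
    have cds: "cdiff J1 (\<Phi> y)" "cdiff calN (\<Phi> y)" "cdiff J2 (\<Phi> y)" "cdiff (\<lambda>q. q $ 4) (\<Phi> y)" "cdiff boundary_term (\<Phi> y)"
      if "y \<in> V" for y
      using dom[OF that] by (simp_all add: cdiff_J1 cdiff_J2 cdiff_calN cdiff_component cdiff_boundary_term domain_LD)
    show "EL_system (substituted \<Phi> lagrangian) V G"
      unfolding EL_system_def
    proof (intro allI impI)
      fix T Y Y' assume Y: "curve V T Y Y'"
      have "euler_lagrange (substituted \<Phi> lagrangian) T Y Y' \<longleftrightarrow>
        (\<forall>\<tau>\<in>T. total_deriv (\<lambda>y. J1 (\<Phi> y)) (Y \<tau>) (Y' \<tau>) = 0 \<and> total_deriv (\<lambda>y. calN (\<Phi> y)) (Y \<tau>) (Y' \<tau>) = 1 \<and>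
          total_deriv (\<lambda>y. J2 (\<Phi> y)) (Y \<tau>) (Y' \<tau>) = 0 \<and> total_deriv (\<lambda>y. \<Phi> y $ 4) (Y \<tau>) (Y' \<tau>) = 0)"
      proof (rule euler_lagrange_canonical[OF V _ _ _ _ _ _ _ _ Y, where f = "\<lambda>y. boundary_term (\<Phi> y)" and c = "- 8"])
        fix y w assume y: "y \<in> V"
        note cds[OF y, THEN chain(2), OF y]
        then show "substituted \<Phi> lagrangian y w = J1 (\<Phi> y) ^ 2 * (total_deriv (\<lambda>y. calN (\<Phi> y)) y w - 1)
            + J2 (\<Phi> y) * total_deriv (\<lambda>y. \<Phi> y $ 4) y w + (- 8) * total_deriv (\<lambda>y. boundary_term (\<Phi> y)) y w"
          unfolding substituted_def lagrangian_canonical D_def by simp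
        assume "total_deriv (\<lambda>y. J1 (\<Phi> y)) y w = 0" "total_deriv (\<lambda>y. calN (\<Phi> y)) y w = 0"
          "total_deriv (\<lambda>y. J2 (\<Phi> y)) y w = 0" "total_deriv (\<lambda>y. \<Phi> y $ 4) y w = 0"
        then have "D y w = 0"
          using cds[OF y, THEN chain(2), OF y]
          by (intro canonical_coordinates_injective[OF dom[OF y]]) (simp_all add: total_deriv_component)
        then show "w = 0" by (rule D_inj[OF y])
      next
        show "J1 (\<Phi> y) \<noteq> 0" if "y \<in> V" for y using domain_LD(4)[OF dom[OF that]] .
      qed (use cds[THEN chain(1)] in auto)
      also have "\<dots> \<longleftrightarrow> (\<forall>\<tau>\<in>T. Y' \<tau> = G (Y \<tau>))"
      proof (intro ball_cong refl)
        fix \<tau> assume "\<tau> \<in> T"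
        then have y: "Y \<tau> \<in> V" using Y by (simp add: curve_def)
        have "(total_deriv (\<lambda>y. J1 (\<Phi> y)) (Y \<tau>) (Y' \<tau>) = 0 \<and> total_deriv (\<lambda>y. calN (\<Phi> y)) (Y \<tau>) (Y' \<tau>) = 1 \<and>
            total_deriv (\<lambda>y. J2 (\<Phi> y)) (Y \<tau>) (Y' \<tau>) = 0 \<and> total_deriv (\<lambda>y. \<Phi> y $ 4) (Y \<tau>) (Y' \<tau>) = 0)
          \<longleftrightarrow> D (Y \<tau>) (Y' \<tau>) = system_ABkI (\<Phi> (Y \<tau>))"
          unfolding canonical_iff_system[OF dom[OF y], symmetric]
          using cds[OF y, THEN chain(2), OF y, of "Y' \<tau>"] by (simp add: total_deriv_component)
        also have "\<dots> \<longleftrightarrow> Y' \<tau> = G (Y \<tau>)"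
          by (rule transfer[OF dom[OF y] rel[OF y] \<Psi>D[OF y]])
        finally show "(total_deriv (\<lambda>y. J1 (\<Phi> y)) (Y \<tau>) (Y' \<tau>) = 0 \<and> total_deriv (\<lambda>y. calN (\<Phi> y)) (Y \<tau>) (Y' \<tau>) = 1 \<and>
            total_deriv (\<lambda>y. J2 (\<Phi> y)) (Y \<tau>) (Y' \<tau>) = 0 \<and> total_deriv (\<lambda>y. \<Phi> y $ 4) (Y \<tau>) (Y' \<tau>) = 0)
          \<longleftrightarrow> Y' \<tau> = G (Y \<tau>)" .
      qed
      finally show "euler_lagrange (substituted \<Phi> lagrangian) T Y Y' \<longleftrightarrow> (\<forall>\<tau>\<in>T. Y' \<tau> = G (Y \<tau>))" .
    qed
  qed
qed

section \<open>Jacobi's system\<close>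

definition jacobi_coord :: "4 \<Rightarrow> complex ^ 4 \<Rightarrow> complex" where
  "jacobi_coord i q = (vector [q $ 1, q $ 2, q $ 4 - 2 * q $ 4 * q $ 3 ^ 2,
     1 / 8 * (q $ 4 ^ 2 * q $ 3 ^ 2 * (1 - q $ 3 ^ 2))] :: complex ^ 4) $ i"

lemma jacobi_coord_simps:
  "jacobi_coord 1 = (\<lambda>q. q $ 1)" "jacobi_coord 2 = (\<lambda>q. q $ 2)"
  "jacobi_coord 3 = (\<lambda>q. q $ 4 - 2 * q $ 4 * q $ 3 ^ 2)"
  "jacobi_coord 4 = (\<lambda>q. 1 / 8 * (q $ 4 ^ 2 * q $ 3 ^ 2 * (1 - q $ 3 ^ 2)))"
  by (simp_all add: jacobi_coord_def fun_eq_iff)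

lemma
  shows total_deriv_jacobi_a: "total_deriv (jacobi_coord 3) q h = (1 - 2 * q $ 3 ^ 2) * h $ 4 - 4 * q $ 4 * q $ 3 * h $ 3"
    and total_deriv_jacobi_b: "total_deriv (jacobi_coord 4) q h =
      1 / 4 * q $ 4 * q $ 3 ^ 2 * (1 - q $ 3 ^ 2) * h $ 4 + 1 / 4 * q $ 4 ^ 2 * q $ 3 * (1 - 2 * q $ 3 ^ 2) * h $ 3"
proof -
  note c = has_derivative_component[of _ q]
  have "(jacobi_coord 3 has_derivative (\<lambda>h. (1 - 2 * q $ 3 ^ 2) * h $ 4 - 4 * q $ 4 * q $ 3 * h $ 3)) (at q)"
    unfolding jacobi_coord_simps
    by (auto intro!: derivative_eq_intros c simp: fun_eq_iff algebra_simps power2_eq_square)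
  from total_derivI(1)[OF this]
  show "total_deriv (jacobi_coord 3) q h = (1 - 2 * q $ 3 ^ 2) * h $ 4 - 4 * q $ 4 * q $ 3 * h $ 3"
    by (simp add: algebra_simps)
  have "(jacobi_coord 4 has_derivative (\<lambda>h. 1 / 4 * q $ 4 * q $ 3 ^ 2 * (1 - q $ 3 ^ 2) * h $ 4
      + 1 / 4 * q $ 4 ^ 2 * q $ 3 * (1 - 2 * q $ 3 ^ 2) * h $ 3)) (at q)"
    unfolding jacobi_coord_simps
    by (auto intro!: derivative_eq_intros c simp: fun_eq_iff field_simps power2_eq_square)
  from total_derivI(1)[OF this]
  show "total_deriv (jacobi_coord 4) q h = 1 / 4 * q $ 4 * q $ 3 ^ 2 * (1 - q $ 3 ^ 2) * h $ 4
      + 1 / 4 * q $ 4 ^ 2 * q $ 3 * (1 - 2 * q $ 3 ^ 2) * h $ 3"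
    by (simp add: algebra_simps)
qed

text \<open>
  The branch is recovered from \<open>a\<close> and \<open>b\<close> by \<open>I\<^sup>2 = a\<^sup>2 + 32 b\<close> and \<open>k\<^sup>2 = (I - a) / (2 I)\<close>.  The
  Jacobian determinant of \<open>(a, b)\<close> in \<open>(k, I)\<close> is a nonzero multiple of \<open>I\<^sup>2 k\<close>.
\<close>

lemma EL_system_after_jacobi: "EL_system_after jacobi_subst lagrangian domain_L jacobi_system"
proof (rule EL_system_after_coordinates[where \<Psi> = jacobi_coord and e = "\<lambda>_. 1"])
  show "cdiff (jacobi_coord i) q" if "q \<in> domain_L" for q i
    using exhaust_4[of i] by (auto simp: jacobi_coord_simps intro!: cdiff_intros)
  show rel: "y $ i ^ 1 = jacobi_coord i q" if "q \<in> domain_L" "jacobi_subst q y" for q y i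
    using exhaust_4[of i] that(2) by (auto simp: jacobi_coord_simps jacobi_subst_def Let_def field_simps)
  show "h = 0" if q: "q \<in> domain_L" and h: "\<And>i. total_deriv (jacobi_coord i) q h = 0" for q h
  proof -
    note nz = domain_LD[OF q]
    define k I where "k = q $ 3" and "I = q $ 4"
    have "h $ 1 = 0" "h $ 2 = 0"
      using h[of 1] h[of 2] by (simp_all add: jacobi_coord_simps total_deriv_component)
    have a: "(1 - 2 * k ^ 2) * h $ 4 - 4 * I * k * h $ 3 = 0"
      using h[of 3] by (simp add: total_deriv_jacobi_a k_def I_def)
    have b: "1 / 4 * I * k ^ 2 * (1 - k ^ 2) * h $ 4 + 1 / 4 * I ^ 2 * k * (1 - 2 * k ^ 2) * h $ 3 = 0"
      using h[of 4] by (simp only: total_deriv_jacobi_b k_def I_def)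
    have "I ^ 2 * k * h $ 3 =
        4 * (1 - 2 * k ^ 2) * (1 / 4 * I * k ^ 2 * (1 - k ^ 2) * h $ 4 + 1 / 4 * I ^ 2 * k * (1 - 2 * k ^ 2) * h $ 3)
        - I * k ^ 2 * (1 - k ^ 2) * ((1 - 2 * k ^ 2) * h $ 4 - 4 * I * k * h $ 3)"
      by (simp add: field_simps power2_eq_square)
    then have "h $ 3 = 0"
      unfolding a b using nz by (simp add: k_def I_def)
    moreover have "h $ 4 = 0"
    proof (cases "1 - 2 * k ^ 2 = 0")
      case False then show ?thesis using a \<open>h $ 3 = 0\<close> by simp
    next
      case True
      then show ?thesis using b \<open>h $ 3 = 0\<close> nz by (simp add: k_def I_def)
    qed
    ultimately show ?thesis
      using \<open>h $ 1 = 0\<close> \<open>h $ 2 = 0\<close> by (simp add: vec_eq_iff forall_4)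
  qed
  show "total_deriv (jacobi_coord i) q (system_ABkI q) = of_nat 1 * y $ i ^ (1 - 1) * jacobi_system y $ i"
    if q: "q \<in> domain_L" "jacobi_subst q y" for q y i
  proof -
    have y: "y $ 1 = q $ 1" "y $ 2 = q $ 2" "y $ 3 = q $ 4 - 2 * q $ 4 * q $ 3 ^ 2"
      "y $ 4 = 1 / 8 * (q $ 4 ^ 2 * q $ 3 ^ 2 * (1 - q $ 3 ^ 2))"
      using rel[OF q, of 1] rel[OF q, of 2] rel[OF q, of 3] rel[OF q, of 4] by (simp_all add: jacobi_coord_simps)
    show ?thesis
      using exhaust_4[of i]
    proof (elim disjE)
      assume i: "i = 1"
      show ?thesis unfolding i jacobi_coord_simps total_deriv_component
        by (simp add: jacobi_system_def system_ABkI_def Let_def y)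
    next
      assume i: "i = 2"
      show ?thesis unfolding i jacobi_coord_simps total_deriv_component
        by (simp add: jacobi_system_def system_ABkI_def Let_def y)
    next
      assume i: "i = 3"
      show ?thesis unfolding i total_deriv_jacobi_a
        by (simp add: jacobi_system_def system_ABkI_def Let_def y) (simp add: algebra_simps power2_eq_square)
    next
      assume i: "i = 4"
      show ?thesis unfolding i total_deriv_jacobi_b
        by (simp add: jacobi_system_def system_ABkI_def Let_def y) (simp add: field_simps power2_eq_square)
    qed
  qed
  fix V \<Phi> and y :: "complex ^ 4" and i
  assume V: "open V" and cont: "continuous_on V \<Phi>" and dom: "\<And>y. y \<in> V \<Longrightarrow> \<Phi> y \<in> domain_L"
    and R: "\<And>y. y \<in> V \<Longrightarrow> jacobi_subst (\<Phi> y) y" and y: "y \<in> V"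
  have cont_i: "continuous_on V (\<lambda>y. \<Phi> y $ i)" for i
    using cont by (rule continuous_on_component)
  have rel': "y $ 1 = \<Phi> y $ 1" "y $ 2 = \<Phi> y $ 2" "y $ 3 = \<Phi> y $ 4 - 2 * \<Phi> y $ 4 * \<Phi> y $ 3 ^ 2"
      "y $ 4 = 1 / 8 * (\<Phi> y $ 4 ^ 2 * \<Phi> y $ 3 ^ 2 * (1 - \<Phi> y $ 3 ^ 2))" if "y \<in> V" for y
    using rel[OF dom R, OF that that, of 1] rel[OF dom R, OF that that, of 2]
      rel[OF dom R, OF that that, of 3] rel[OF dom R, OF that that, of 4] by (simp_all add: jacobi_coord_simps)
  have 1: "cdiff (\<lambda>y. \<Phi> y $ 1) y"
    by (rule cdiff_cong(1)[OF V y _ cdiff_component[of 1]]) (simp add: rel')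
  have 2: "cdiff (\<lambda>y. \<Phi> y $ 2) y"
    by (rule cdiff_cong(1)[OF V y _ cdiff_component[of 2]]) (simp add: rel')
  have 4: "cdiff (\<lambda>y. \<Phi> y $ 4) y"
  proof (rule cdiff_continuous_sqrt[OF V y cont_i domain_LD(3)[OF dom[OF y]]])
    show "\<Phi> x $ 4 ^ 2 = x $ 3 ^ 2 + 32 * x $ 4" if "x \<in> V" for x
      unfolding rel'(3,4)[OF that] by (simp add: field_simps power2_eq_square)
    show "cdiff (\<lambda>x. x $ 3 ^ 2 + 32 * x $ 4) y" by (intro cdiff_intros)
  qed
  have 3: "cdiff (\<lambda>y. \<Phi> y $ 3) y"
  proof (rule cdiff_continuous_sqrt[OF V y cont_i domain_LD(5)[OF dom[OF y]]])
    show "\<Phi> x $ 3 ^ 2 = (\<Phi> x $ 4 - x $ 3) / (2 * \<Phi> x $ 4)" if "x \<in> V" for x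
      unfolding rel'(3)[OF that] using domain_LD(3)[OF dom[OF that]] by simp
    show "cdiff (\<lambda>x. (\<Phi> x $ 4 - x $ 3) / (2 * \<Phi> x $ 4)) y"
      by (intro cdiff_intros 4) (use domain_LD(3)[OF dom[OF y]] in simp)
  qed
  show "cdiff (\<lambda>y. \<Phi> y $ i) y"
    using exhaust_4[of i] 1 2 3 4 by auto
qed simp

section \<open>The system in x, y, z, u\<close>

text \<open>
  The functions \<open>x, y\<^sup>2, z\<^sup>2, u\<close> of \<open>(A, B, k, I)\<close>.  The auxiliary \<open>J\<close> occurs in them only through
  \<open>12 i J\<^sup>2 = I\<close>.
\<close>

definition xyzu_coord :: "4 \<Rightarrow> complex ^ 4 \<Rightarrow> complex" where
  "xyzu_coord i q = (vector [(1 + \<i>) / of_real (sqrt pi) * (q $ 3 * q $ 1), 1 / 6 * (q $ 4 * q $ 1 ^ 2),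
     1 / 6 * (q $ 4 * (1 - q $ 3 ^ 2) * q $ 1 ^ 2),
     2 * q $ 1 * q $ 2 - 1 / 6 * (q $ 4 * (2 * q $ 3 ^ 2 - 1) * q $ 1 ^ 2)] :: complex ^ 4) $ i"

definition xyzu_power :: "4 \<Rightarrow> nat" where
  "xyzu_power i = (if i = 2 \<or> i = 3 then 2 else 1)"

lemma xyzu_coord_simps:
  "xyzu_coord 1 = (\<lambda>q. (1 + \<i>) / of_real (sqrt pi) * (q $ 3 * q $ 1))"
  "xyzu_coord 2 = (\<lambda>q. 1 / 6 * (q $ 4 * q $ 1 ^ 2))"
  "xyzu_coord 3 = (\<lambda>q. 1 / 6 * (q $ 4 * (1 - q $ 3 ^ 2) * q $ 1 ^ 2))"
  "xyzu_coord 4 = (\<lambda>q. 2 * q $ 1 * q $ 2 - 1 / 6 * (q $ 4 * (2 * q $ 3 ^ 2 - 1) * q $ 1 ^ 2))"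
  by (simp_all add: xyzu_coord_def fun_eq_iff)

lemma
  shows total_deriv_xyzu_x: "total_deriv (xyzu_coord 1) q h = (1 + \<i>) / of_real (sqrt pi) * (q $ 3 * h $ 1 + q $ 1 * h $ 3)"
    and total_deriv_xyzu_y: "total_deriv (xyzu_coord 2) q h = 1 / 6 * q $ 1 ^ 2 * h $ 4 + 1 / 3 * q $ 4 * q $ 1 * h $ 1"
    and total_deriv_xyzu_z: "total_deriv (xyzu_coord 3) q h =
      (1 - q $ 3 ^ 2) * (1 / 6 * q $ 1 ^ 2 * h $ 4 + 1 / 3 * q $ 4 * q $ 1 * h $ 1) - 1 / 3 * q $ 4 * q $ 1 ^ 2 * q $ 3 * h $ 3"
    and total_deriv_xyzu_u: "total_deriv (xyzu_coord 4) q h = 2 * q $ 1 * h $ 2 + 2 * q $ 2 * h $ 1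
      - (2 * q $ 3 ^ 2 - 1) * (1 / 6 * q $ 1 ^ 2 * h $ 4 + 1 / 3 * q $ 4 * q $ 1 * h $ 1) - 2 / 3 * q $ 4 * q $ 1 ^ 2 * q $ 3 * h $ 3"
proof -
  note c = has_derivative_component[of _ q]
  have "(xyzu_coord 1 has_derivative (\<lambda>h. (1 + \<i>) / of_real (sqrt pi) * (q $ 3 * h $ 1 + q $ 1 * h $ 3))) (at q)"
    unfolding xyzu_coord_simps
    by (rule has_derivative_eq_rhs[OF has_derivative_mult_right[OF has_derivative_mult[OF c c]]])
      (simp add: fun_eq_iff mult.commute)
  from total_derivI(1)[OF this]
  show "total_deriv (xyzu_coord 1) q h = (1 + \<i>) / of_real (sqrt pi) * (q $ 3 * h $ 1 + q $ 1 * h $ 3)"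
    by (simp add: algebra_simps)
  have "(xyzu_coord 2 has_derivative (\<lambda>h. 1 / 6 * q $ 1 ^ 2 * h $ 4 + 1 / 3 * q $ 4 * q $ 1 * h $ 1)) (at q)"
    unfolding xyzu_coord_simps
    by (auto intro!: derivative_eq_intros c simp: fun_eq_iff field_simps power2_eq_square)
  from total_derivI(1)[OF this]
  show "total_deriv (xyzu_coord 2) q h = 1 / 6 * q $ 1 ^ 2 * h $ 4 + 1 / 3 * q $ 4 * q $ 1 * h $ 1"
    by (simp add: algebra_simps)
  have "(xyzu_coord 3 has_derivative (\<lambda>h. (1 - q $ 3 ^ 2) * (1 / 6 * q $ 1 ^ 2 * h $ 4 + 1 / 3 * q $ 4 * q $ 1 * h $ 1)
      - 1 / 3 * q $ 4 * q $ 1 ^ 2 * q $ 3 * h $ 3)) (at q)"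
    unfolding xyzu_coord_simps
    by (auto intro!: derivative_eq_intros c simp: fun_eq_iff field_simps power2_eq_square)
  from total_derivI(1)[OF this]
  show "total_deriv (xyzu_coord 3) q h =
      (1 - q $ 3 ^ 2) * (1 / 6 * q $ 1 ^ 2 * h $ 4 + 1 / 3 * q $ 4 * q $ 1 * h $ 1) - 1 / 3 * q $ 4 * q $ 1 ^ 2 * q $ 3 * h $ 3"
    by (simp add: algebra_simps)
  have "(xyzu_coord 4 has_derivative (\<lambda>h. 2 * q $ 1 * h $ 2 + 2 * q $ 2 * h $ 1
      - (2 * q $ 3 ^ 2 - 1) * (1 / 6 * q $ 1 ^ 2 * h $ 4 + 1 / 3 * q $ 4 * q $ 1 * h $ 1) - 2 / 3 * q $ 4 * q $ 1 ^ 2 * q $ 3 * h $ 3)) (at q)"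
    unfolding xyzu_coord_simps
    by (auto intro!: derivative_eq_intros c simp: fun_eq_iff field_simps power2_eq_square)
  from total_derivI(1)[OF this]
  show "total_deriv (xyzu_coord 4) q h = 2 * q $ 1 * h $ 2 + 2 * q $ 2 * h $ 1
      - (2 * q $ 3 ^ 2 - 1) * (1 / 6 * q $ 1 ^ 2 * h $ 4 + 1 / 3 * q $ 4 * q $ 1 * h $ 1) - 2 / 3 * q $ 4 * q $ 1 ^ 2 * q $ 3 * h $ 3"
    by (simp add: algebra_simps)
qed

lemma xyzu_const_nz: "(1 + \<i>) / of_real (sqrt pi) \<noteq> (0 :: complex)"
  by (simp add: complex_eq_iff)

lemma xyzu_substD:
  assumes "xyzu_subst q w"
  shows "w $ 1 = (1 + \<i>) / of_real (sqrt pi) * (q $ 3 * q $ 1)"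
    "w $ 2 ^ 2 = 1 / 6 * (q $ 4 * q $ 1 ^ 2)" "w $ 3 ^ 2 = 1 / 6 * (q $ 4 * (1 - q $ 3 ^ 2) * q $ 1 ^ 2)"
    "w $ 4 = 2 * q $ 1 * q $ 2 - 1 / 6 * (q $ 4 * (2 * q $ 3 ^ 2 - 1) * q $ 1 ^ 2)"
proof -
  obtain J where J: "12 * \<i> * J ^ 2 = q $ 4" and
    w: "w $ 1 = (1 + \<i>) / of_real (sqrt pi) * q $ 3 * q $ 1" "w $ 2 = (1 + \<i>) * J * q $ 1"
      "w $ 3 ^ 2 = 2 * \<i> * J ^ 2 * (1 - q $ 3 ^ 2) * q $ 1 ^ 2"
      "w $ 4 = 2 * q $ 1 * (q $ 2 - \<i> * J ^ 2 * (2 * q $ 3 ^ 2 - 1) * q $ 1)"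
    using assms unfolding xyzu_subst_def Let_def by blast
  show "w $ 1 = (1 + \<i>) / of_real (sqrt pi) * (q $ 3 * q $ 1)" using w(1) by (simp add: mult.assoc)
  have "(1 + \<i>) ^ 2 = 2 * \<i>" by (simp add: power2_eq_square algebra_simps)
  then show "w $ 2 ^ 2 = 1 / 6 * (q $ 4 * q $ 1 ^ 2)"
    unfolding w(2) J[symmetric] by (simp add: power_mult_distrib)
  show "w $ 3 ^ 2 = 1 / 6 * (q $ 4 * (1 - q $ 3 ^ 2) * q $ 1 ^ 2)"
    unfolding w(3) J[symmetric] by simp
  show "w $ 4 = 2 * q $ 1 * q $ 2 - 1 / 6 * (q $ 4 * (2 * q $ 3 ^ 2 - 1) * q $ 1 ^ 2)"
    unfolding w(4) J[symmetric] by (simp add: field_simps power2_eq_square)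
qed

text \<open>
  In the proof \<open>Y = y\<^sup>2 = I A\<^sup>2 / 6\<close>, in terms of which \<open>z\<^sup>2 = Y (1 - k\<^sup>2)\<close> and
  \<open>u = 2 A B - Y (2 k\<^sup>2 - 1)\<close>.  The branch is recovered by \<open>k\<^sup>2 = 1 - z\<^sup>2 / y\<^sup>2\<close> and
  \<open>A\<^sup>2 = x\<^sup>2 / (c\<^sup>2 k\<^sup>2)\<close>, where \<open>x = c k A\<close>, and then rationally.
\<close>

lemma EL_system_after_xyzu: "EL_system_after xyzu_subst lagrangian domain_L xyzu_system"
proof (rule EL_system_after_coordinates[where \<Psi> = xyzu_coord and e = xyzu_power])
  show "cdiff (xyzu_coord i) q" if "q \<in> domain_L" for q i
    using exhaust_4[of i]
    by (elim disjE; simp only: xyzu_coord_simps) (intro cdiff_intros)+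
  show rel: "y $ i ^ xyzu_power i = xyzu_coord i q" if "q \<in> domain_L" "xyzu_subst q y" for q y i
    using exhaust_4[of i] xyzu_substD[OF that(2)]
    by (elim disjE; simp only: xyzu_coord_simps xyzu_power_def) simp_all
  have y_nz: "y $ 2 \<noteq> 0" "y $ 3 \<noteq> 0" if "q \<in> domain_L" "xyzu_subst q y" for q y
    using xyzu_substD(2,3)[OF that(2)] domain_LD[OF that(1)] by auto
  show "of_nat (xyzu_power i) * y $ i ^ (xyzu_power i - 1) \<noteq> 0" if "q \<in> domain_L" "xyzu_subst q y" for q y i
    using exhaust_4[of i] y_nz[OF that] by (auto simp: xyzu_power_def)
  show "h = 0" if q: "q \<in> domain_L" and h: "\<And>i. total_deriv (xyzu_coord i) q h = 0" for q h
  proof -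
    note nz = domain_LD[OF q]
    have e1: "q $ 3 * h $ 1 + q $ 1 * h $ 3 = 0"
      using h[of 1] xyzu_const_nz by (simp only: total_deriv_xyzu_x mult_eq_0_iff) simp
    have e2: "1 / 6 * q $ 1 ^ 2 * h $ 4 + 1 / 3 * q $ 4 * q $ 1 * h $ 1 = 0"
      using h[of 2] by (simp only: total_deriv_xyzu_y)
    have "h $ 3 = 0"
      using h[of 3] nz unfolding total_deriv_xyzu_z e2 by simp
    then have "h $ 1 = 0" using e1 nz by simp
    then have "h $ 4 = 0" using e2 nz by simp
    have "h $ 2 = 0"
      using h[of 4] nz unfolding total_deriv_xyzu_u e2 unfolding \<open>h $ 3 = 0\<close> \<open>h $ 1 = 0\<close> by simp
    then show ?thesis
      using \<open>h $ 3 = 0\<close> \<open>h $ 1 = 0\<close> \<open>h $ 4 = 0\<close> by (simp add: vec_eq_iff forall_4)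
  qed
  show "total_deriv (xyzu_coord i) q (system_ABkI q) = of_nat (xyzu_power i) * y $ i ^ (xyzu_power i - 1) * xyzu_system y $ i"
    if q: "q \<in> domain_L" "xyzu_subst q y" for q y i
  proof -
    define A B k I where "A = q $ 1" and "B = q $ 2" and "k = q $ 3" and "I = q $ 4"
    note defs = A_def B_def k_def I_def
    note s = xyzu_substD[OF q(2), folded defs]
    define Y where "Y = 1 / 6 * (I * A ^ 2)"
    have y2: "y $ 2 ^ 2 = Y" and y3: "y $ 3 ^ 2 = Y * (1 - k ^ 2)" and y4: "y $ 4 = 2 * A * B - Y * (2 * k ^ 2 - 1)"
      unfolding s Y_def by simp_all
    have p4: "z ^ 4 = (z ^ 2) ^ 2" for z :: complex by (simp flip: power_mult)
    have y24: "y $ 2 ^ 4 = Y ^ 2" and y34: "y $ 3 ^ 4 = (Y * (1 - k ^ 2)) ^ 2"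
      unfolding p4 y2 y3 by (rule refl)+
    have I: "I * A ^ 2 = 6 * Y" by (simp add: Y_def)
    have F: "system_ABkI q $ 1 = 2 * A ^ 2 * B" "system_ABkI q $ 2 = 1 / 8 * I ^ 2 * k ^ 2 * (1 - k ^ 2) * A ^ 3"
      "system_ABkI q $ 3 = 1 / 2 * I * k * (1 - k ^ 2) * A ^ 2" "system_ABkI q $ 4 = 0"
      by (simp_all add: system_ABkI_def Let_def defs)
    have F3: "system_ABkI q $ 3 = 3 * k * (1 - k ^ 2) * Y" and F2: "q $ 1 * system_ABkI q $ 2 = 9 / 2 * k ^ 2 * (1 - k ^ 2) * Y ^ 2"
      unfolding F Y_def by (simp_all add: A_def field_simps power2_eq_square power3_eq_cube)
    have G: "xyzu_system y $ 1 = (y $ 4 + y $ 2 ^ 2 + y $ 3 ^ 2) * y $ 1" "xyzu_system y $ 2 = (y $ 4 + y $ 2 ^ 2 - 2 * y $ 3 ^ 2) * y $ 2"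
      "xyzu_system y $ 3 = (y $ 4 - 2 * y $ 2 ^ 2 + y $ 3 ^ 2) * y $ 3"
      "xyzu_system y $ 4 = y $ 4 ^ 2 - y $ 2 ^ 4 + y $ 2 ^ 2 * y $ 3 ^ 2 - y $ 3 ^ 4"
      by (simp_all add: xyzu_system_def Let_def)
    show ?thesis
      using exhaust_4[of i]
    proof (elim disjE)
      assume i: "i = 1"
      have "q $ 3 * system_ABkI q $ 1 + q $ 1 * system_ABkI q $ 3 = (2 * A * B - Y * (2 * k ^ 2 - 1) + Y + Y * (1 - k ^ 2)) * (k * A)"
        unfolding F3 F(1) defs[symmetric] by (simp add: algebra_simps power2_eq_square)
      then show ?thesis
        unfolding i total_deriv_xyzu_x xyzu_power_def G y4 y2 y3 s(1) by simp
    next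
      assume i: "i = 2"
      have "1 / 6 * q $ 1 ^ 2 * system_ABkI q $ 4 + 1 / 3 * q $ 4 * q $ 1 * system_ABkI q $ 1 = 4 * A * B * Y"
        unfolding F defs[symmetric] Y_def by (simp add: algebra_simps power2_eq_square)
      moreover have "2 * y $ 2 * ((2 * A * B - Y * (2 * k ^ 2 - 1) + Y - 2 * (Y * (1 - k ^ 2))) * y $ 2) = 4 * A * B * y $ 2 ^ 2"
        by (simp add: algebra_simps power2_eq_square)
      ultimately show ?thesis
        unfolding i total_deriv_xyzu_y xyzu_power_def G y4 y3 y2 by simp
    next
      assume i: "i = 3"
      have "1 / 6 * q $ 1 ^ 2 * system_ABkI q $ 4 + 1 / 3 * q $ 4 * q $ 1 * system_ABkI q $ 1 = 4 * A * B * Y"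
        unfolding F defs[symmetric] Y_def by (simp add: algebra_simps power2_eq_square)
      moreover have "1 / 3 * q $ 4 * q $ 1 ^ 2 * q $ 3 * system_ABkI q $ 3 = 6 * k ^ 2 * (1 - k ^ 2) * Y ^ 2"
        unfolding F3 defs[symmetric] Y_def by (simp add: field_simps power2_eq_square)
      ultimately have "total_deriv (xyzu_coord 3) q (system_ABkI q) = 
          (1 - k ^ 2) * (4 * A * B * Y) - 6 * k ^ 2 * (1 - k ^ 2) * Y ^ 2"
        unfolding total_deriv_xyzu_z by (simp only: k_def)
      also have "\<dots> = 2 * (2 * A * B - Y * (2 * k ^ 2 - 1) - 2 * Y + Y * (1 - k ^ 2)) * (Y * (1 - k ^ 2))"
        by (simp add: algebra_simps power2_eq_square)
      also have "\<dots> = 2 * y $ 3 * ((2 * A * B - Y * (2 * k ^ 2 - 1) - 2 * Y + Y * (1 - k ^ 2)) * y $ 3)"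
        unfolding y3[symmetric] by (simp add: power2_eq_square mult.left_commute mult.assoc)
      finally show ?thesis
        unfolding i xyzu_power_def G y4 y3 y2 by simp
    next
      assume i: "i = 4"
      have "1 / 6 * q $ 1 ^ 2 * system_ABkI q $ 4 + 1 / 3 * q $ 4 * q $ 1 * system_ABkI q $ 1 = 4 * A * B * Y"
        unfolding F defs[symmetric] Y_def by (simp add: algebra_simps power2_eq_square)
      moreover have "2 / 3 * q $ 4 * q $ 1 ^ 2 * q $ 3 * system_ABkI q $ 3 = 12 * k ^ 2 * (1 - k ^ 2) * Y ^ 2"
        unfolding F3 defs[symmetric] Y_def by (simp add: field_simps power2_eq_square)
      moreover have "2 * q $ 1 * system_ABkI q $ 2 = 9 * k ^ 2 * (1 - k ^ 2) * Y ^ 2"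
        unfolding mult.assoc F2 by simp
      moreover have "2 * q $ 2 * system_ABkI q $ 1 = 4 * A ^ 2 * B ^ 2"
        unfolding F defs[symmetric] by (simp add: power2_eq_square)
      ultimately have "total_deriv (xyzu_coord 4) q (system_ABkI q) = 9 * k ^ 2 * (1 - k ^ 2) * Y ^ 2 + 4 * A ^ 2 * B ^ 2
          - (2 * k ^ 2 - 1) * (4 * A * B * Y) - 12 * k ^ 2 * (1 - k ^ 2) * Y ^ 2"
        unfolding total_deriv_xyzu_u by (simp only: k_def)
      also have "\<dots> = (2 * A * B - Y * (2 * k ^ 2 - 1)) ^ 2 - Y ^ 2 + Y * (Y * (1 - k ^ 2)) - (Y * (1 - k ^ 2)) ^ 2"
        by (simp add: algebra_simps power2_eq_square)
      finally show ?thesis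
        unfolding i xyzu_power_def G y4 y3 y2 y24 y34 by simp
    qed
  qed
  fix V \<Phi> and y :: "complex ^ 4" and i
  assume V: "open V" and cont: "continuous_on V \<Phi>" and dom: "\<And>y. y \<in> V \<Longrightarrow> \<Phi> y \<in> domain_L"
    and R: "\<And>y. y \<in> V \<Longrightarrow> xyzu_subst (\<Phi> y) y" and y: "y \<in> V"
  have cont_i: "continuous_on V (\<lambda>y. \<Phi> y $ i)" for i
    using cont by (rule continuous_on_component)
  define c :: complex where "c = (1 + \<i>) / of_real (sqrt pi)"
  have c: "c \<noteq> 0" unfolding c_def by (rule xyzu_const_nz)
  note s = xyzu_substD[OF R, folded c_def]
  note yn = y_nz[OF dom R]
  have ksq: "1 - x $ 3 ^ 2 / x $ 2 ^ 2 = \<Phi> x $ 3 ^ 2" if "x \<in> V" for x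
    unfolding s[OF that] using domain_LD[OF dom[OF that]] by (simp add: field_simps)
  have 1: "cdiff (\<lambda>y. \<Phi> y $ 1) y"
  proof (rule cdiff_continuous_sqrt[OF V y cont_i domain_LD(1)[OF dom[OF y]]])
    show "\<Phi> x $ 1 ^ 2 = x $ 1 ^ 2 / (c ^ 2 * (1 - x $ 3 ^ 2 / x $ 2 ^ 2))" if "x \<in> V" for x
      unfolding ksq[OF that] s(1)[OF that] using c domain_LD[OF dom[OF that]] by (simp add: power_mult_distrib)
    show "cdiff (\<lambda>x. x $ 1 ^ 2 / (c ^ 2 * (1 - x $ 3 ^ 2 / x $ 2 ^ 2))) y"
      by (intro cdiff_intros) (use yn[OF y y] ksq[OF y] c domain_LD[OF dom[OF y]] in \<open>simp_all\<close>)
  qed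
  have 3: "cdiff (\<lambda>y. \<Phi> y $ 3) y"
  proof (rule cdiff_cong(1)[OF V y])
    show "\<Phi> x $ 3 = x $ 1 / (c * \<Phi> x $ 1)" if "x \<in> V" for x
      unfolding s(1)[OF that] using c domain_LD[OF dom[OF that]] by simp
    show "cdiff (\<lambda>x. x $ 1 / (c * \<Phi> x $ 1)) y"
      by (intro cdiff_intros 1) (use c domain_LD[OF dom[OF y]] in simp)
  qed
  have 4: "cdiff (\<lambda>y. \<Phi> y $ 4) y"
  proof (rule cdiff_cong(1)[OF V y])
    show "\<Phi> x $ 4 = 6 * x $ 2 ^ 2 / \<Phi> x $ 1 ^ 2" if "x \<in> V" for x
      unfolding s(2)[OF that] using domain_LD[OF dom[OF that]] by simp
    show "cdiff (\<lambda>x. 6 * x $ 2 ^ 2 / \<Phi> x $ 1 ^ 2) y"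
      by (intro cdiff_intros 1) (use domain_LD[OF dom[OF y]] in simp)
  qed
  have 2: "cdiff (\<lambda>y. \<Phi> y $ 2) y"
  proof (rule cdiff_cong(1)[OF V y])
    show "\<Phi> x $ 2 = (x $ 4 + 1 / 6 * (\<Phi> x $ 4 * (2 * \<Phi> x $ 3 ^ 2 - 1) * \<Phi> x $ 1 ^ 2)) / (2 * \<Phi> x $ 1)" if "x \<in> V" for x
      unfolding s(4)[OF that] using domain_LD[OF dom[OF that]] by simp
    show "cdiff (\<lambda>x. (x $ 4 + 1 / 6 * (\<Phi> x $ 4 * (2 * \<Phi> x $ 3 ^ 2 - 1) * \<Phi> x $ 1 ^ 2)) / (2 * \<Phi> x $ 1)) y"
      by (intro cdiff_intros 1 3 4) (use domain_LD[OF dom[OF y]] in simp)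
  qed
  show "cdiff (\<lambda>y. \<Phi> y $ i) y"
    using exhaust_4[of i] 1 2 3 4 by auto
qed

theorem theorem10:
  shows
    "(\<forall>q\<in>domain_L. \<forall>v. lagrangian q v =
       (let A = q $ 1; B = q $ 2; k = q $ 3; I = q $ 4;
            A' = v $ 1; k' = v $ 3; I' = v $ 4; K = ellK k
        in 4 * (J1 q * K / A ^ 2) * A'
           - 2 * (k * I * K ^ 2 + (J1 q ^ 2 - 16 * B ^ 2 * K ^ 2) / (k * (k ^ 2 - 1) * I * A ^ 2)) * k'
           + (J2 q + 2 * K / (A * I) * (J1 q - 4 * B * K)) * I'
           - J1 q ^ 2)) \<and>
     EL_system lagrangian domain_L system_ABkI \<and>
     EL_system_after jacobi_subst lagrangian domain_L jacobi_system \<and>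
     EL_system_after xyzu_subst lagrangian domain_L xyzu_system"
proof (intro conjI ballI allI EL_system_ABkI EL_system_after_jacobi EL_system_after_xyzu)
  fix q v assume q: "q \<in> domain_L"
  note nz = domain_LD[OF q]
  have L: "lagrangian q v = J1 q ^ 2 * (total_deriv calN q v - 1) + J2 q * v $ 4 - 8 * total_deriv boundary_term q v"
    by (simp add: lagrangian_canonical total_deriv_component)
  show "lagrangian q v =
       (let A = q $ 1; B = q $ 2; k = q $ 3; I = q $ 4;
            A' = v $ 1; k' = v $ 3; I' = v $ 4; K = ellK k
        in 4 * (J1 q * K / A ^ 2) * A'
           - 2 * (k * I * K ^ 2 + (J1 q ^ 2 - 16 * B ^ 2 * K ^ 2) / (k * (k ^ 2 - 1) * I * A ^ 2)) * k'
           + (J2 q + 2 * K / (A * I) * (J1 q - 4 * B * K)) * I'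
           - J1 q ^ 2)"
    unfolding L Let_def total_deriv_calN[OF q] total_deriv_J1[OF nz(2)] total_deriv_boundary_term[OF q]
    by (rule lagrangian_coefficients[OF nz(1,3,5,6,4) J1_eq])
qed

end
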